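(* Let $\mathbb{F}$ be a finite field and let $K$ be a field of characteristic $0$. Then the category $\operatorname{Rep}(\mathbb{F};K)$ is semisimple.
   Context: $\operatorname{Rep}(\mathbb{F};K)$ denotes the category whose objects are the (arbitrary, covariant) functors from the category of finite dimensional $\mathbb{F}$-vector spaces and $\mathbb{F}$-linear maps to the category of $K$-modules, and whose morphisms are natural transformations. It is a $K$-linear abelian category with kernels, cokernels and exactness defined objectwise. *)

theory Defs
  imports "Jordan_Normal_Form.Missing_VectorSpace"
begin

section \<open>Categories\<close>

text \<open>
  Composition \<open>Cmp C X Y Z g f\<close> of \<open>f : X \<rightarrow> Y\<close> and \<open>g : Y \<rightarrow> Z\<close> carries the three objects
  because an arrow does not determine its source and target: hom-sets need not be disjoint.
\<close>

record ('o, 'a) precat =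
  Ob :: "'o set"
  Mor :: "'o \<Rightarrow> 'o \<Rightarrow> 'a set"
  Idn :: "'o \<Rightarrow> 'a"
  Cmp :: "'o \<Rightarrow> 'o \<Rightarrow> 'o \<Rightarrow> 'a \<Rightarrow> 'a \<Rightarrow> 'a"

locale category =
  fixes C :: "('o, 'a) precat"
  assumes idn_closed: "X \<in> Ob C \<Longrightarrow> Idn C X \<in> Mor C X X"
    and cmp_closed:
      "\<lbrakk>X \<in> Ob C; Y \<in> Ob C; Z \<in> Ob C; f \<in> Mor C X Y; g \<in> Mor C Y Z\<rbrakk>
        \<Longrightarrow> Cmp C X Y Z g f \<in> Mor C X Z"
    and cmp_idn_right:
      "\<lbrakk>X \<in> Ob C; Y \<in> Ob C; f \<in> Mor C X Y\<rbrakk> \<Longrightarrow> Cmp C X X Y f (Idn C X) = f"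
    and cmp_idn_left:
      "\<lbrakk>X \<in> Ob C; Y \<in> Ob C; f \<in> Mor C X Y\<rbrakk> \<Longrightarrow> Cmp C X Y Y (Idn C Y) f = f"
    and cmp_assoc:
      "\<lbrakk>W \<in> Ob C; X \<in> Ob C; Y \<in> Ob C; Z \<in> Ob C; f \<in> Mor C W X; g \<in> Mor C X Y; h \<in> Mor C Y Z\<rbrakk>
        \<Longrightarrow> Cmp C W X Z (Cmp C X Y Z h g) f = Cmp C W Y Z h (Cmp C W X Y g f)"

definition zero_object :: "('o, 'a) precat \<Rightarrow> 'o \<Rightarrow> bool" where
  "zero_object C Z \<longleftrightarrow>
    Z \<in> Ob C \<and> (\<forall>X \<in> Ob C. (\<exists>!f. f \<in> Mor C Z X) \<and> (\<exists>!f. f \<in> Mor C X Z))"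

definition monic :: "('o, 'a) precat \<Rightarrow> 'o \<Rightarrow> 'o \<Rightarrow> 'a \<Rightarrow> bool" where
  "monic C X Y m \<longleftrightarrow> m \<in> Mor C X Y \<and>
    (\<forall>W \<in> Ob C. \<forall>f \<in> Mor C W X. \<forall>g \<in> Mor C W X.
      Cmp C W X Y m f = Cmp C W X Y m g \<longrightarrow> f = g)"

definition isomorphism :: "('o, 'a) precat \<Rightarrow> 'o \<Rightarrow> 'o \<Rightarrow> 'a \<Rightarrow> bool" where
  "isomorphism C X Y f \<longleftrightarrow> f \<in> Mor C X Y \<and>
    (\<exists>g \<in> Mor C Y X. Cmp C X Y X g f = Idn C X \<and> Cmp C Y X Y f g = Idn C Y)"

definition simple_object :: "('o, 'a) precat \<Rightarrow> 'o \<Rightarrow> bool" where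
  "simple_object C S \<longleftrightarrow> S \<in> Ob C \<and> \<not> zero_object C S \<and>
    (\<forall>X \<in> Ob C. \<forall>m. monic C X S m \<longrightarrow> zero_object C X \<or> isomorphism C X S m)"

definition is_coproduct ::
  "('o, 'a) precat \<Rightarrow> 'i set \<Rightarrow> ('i \<Rightarrow> 'o) \<Rightarrow> 'o \<Rightarrow> ('i \<Rightarrow> 'a) \<Rightarrow> bool" where
  "is_coproduct C I X T \<iota> \<longleftrightarrow>
    T \<in> Ob C \<and> (\<forall>i \<in> I. X i \<in> Ob C \<and> \<iota> i \<in> Mor C (X i) T) \<and>
    (\<forall>Y \<in> Ob C. \<forall>\<phi>. (\<forall>i \<in> I. \<phi> i \<in> Mor C (X i) Y) \<longrightarrow>
      (\<exists>!h. h \<in> Mor C T Y \<and> (\<forall>i \<in> I. Cmp C (X i) T Y h (\<iota> i) = \<phi> i)))"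

text \<open>
  A category is semisimple if every object is a (possibly infinite) direct sum of simple objects.
  The direct sum is indexed by the set of its own legs \<open>(S, \<iota>)\<close>, \<open>\<iota> : S \<rightarrow> T\<close>.  When there are zero
  morphisms, as in an abelian category, this loses no generality: legs at different indices of a
  coproduct of nonzero objects are different.
\<close>

definition semisimple_category :: "('o, 'a) precat \<Rightarrow> bool" where
  "semisimple_category C \<longleftrightarrow>
    (\<forall>T \<in> Ob C. \<exists>I. (\<forall>(S, \<iota>) \<in> I. simple_object C S) \<and> is_coproduct C I fst T snd)"


section \<open>Functor categories\<close>

record ('o1, 'a1, 'o2, 'a2) functor_data =
  omap :: "'o1 \<Rightarrow> 'o2"
  amap :: "'o1 \<Rightarrow> 'o1 \<Rightarrow> 'a1 \<Rightarrow> 'a2"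

definition functors ::
  "('o1, 'a1) precat \<Rightarrow> ('o2, 'a2) precat \<Rightarrow> ('o1, 'a1, 'o2, 'a2) functor_data set" where
  "functors C D = {T.
    (\<forall>X \<in> Ob C. omap T X \<in> Ob D) \<and>
    (\<forall>X \<in> Ob C. \<forall>Y \<in> Ob C. \<forall>f \<in> Mor C X Y. amap T X Y f \<in> Mor D (omap T X) (omap T Y)) \<and>
    (\<forall>X \<in> Ob C. amap T X X (Idn C X) = Idn D (omap T X)) \<and>
    (\<forall>X \<in> Ob C. \<forall>Y \<in> Ob C. \<forall>Z \<in> Ob C. \<forall>f \<in> Mor C X Y. \<forall>g \<in> Mor C Y Z.
      amap T X Z (Cmp C X Y Z g f) =
        Cmp D (omap T X) (omap T Y) (omap T Z) (amap T Y Z g) (amap T X Y f))}"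

definition nat_trans ::
  "('o1, 'a1) precat \<Rightarrow> ('o2, 'a2) precat \<Rightarrow> ('o1, 'a1, 'o2, 'a2) functor_data \<Rightarrow>
    ('o1, 'a1, 'o2, 'a2) functor_data \<Rightarrow> ('o1 \<Rightarrow> 'a2) set" where
  "nat_trans C D S T = {\<eta>. \<eta> \<in> (\<Pi>\<^sub>E X \<in> Ob C. Mor D (omap S X) (omap T X)) \<and>
    (\<forall>X \<in> Ob C. \<forall>Y \<in> Ob C. \<forall>f \<in> Mor C X Y.
      Cmp D (omap S X) (omap S Y) (omap T Y) (\<eta> Y) (amap S X Y f) =
      Cmp D (omap S X) (omap T X) (omap T Y) (amap T X Y f) (\<eta> X))}"

definition functor_category ::
  "('o1, 'a1) precat \<Rightarrow> ('o2, 'a2) precat \<Rightarrow>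
    (('o1, 'a1, 'o2, 'a2) functor_data, 'o1 \<Rightarrow> 'a2) precat" where
  "functor_category C D =
    \<lparr>Ob = functors C D,
     Mor = nat_trans C D,
     Idn = (\<lambda>T. \<lambda>X \<in> Ob C. Idn D (omap T X)),
     Cmp = (\<lambda>S T U \<theta> \<eta>. \<lambda>X \<in> Ob C. Cmp D (omap S X) (omap T X) (omap U X) (\<theta> X) (\<eta> X))\<rparr>"

lemma functor_category_category:
  assumes "category C" and "category D"
  shows "category (functor_category C D)"
proof -
  interpret C: category C by fact
  interpret D: category D by fact
  have ob: "omap T X \<in> Ob D" if "T \<in> functors C D" "X \<in> Ob C" for T X
    using that by (auto simp: functors_def)
  have ar: "amap T X Y f \<in> Mor D (omap T X) (omap T Y)"
    if "T \<in> functors C D" "X \<in> Ob C" "Y \<in> Ob C" "f \<in> Mor C X Y" for T X Y f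
    using that by (auto simp: functors_def)
  have cp: "\<eta> X \<in> Mor D (omap S X) (omap T X)" if "\<eta> \<in> nat_trans C D S T" "X \<in> Ob C" for \<eta> S T X
    using that by (auto simp: nat_trans_def PiE_def Pi_def)
  have ex: "\<eta> \<in> extensional (Ob C)" if "\<eta> \<in> nat_trans C D S T" for \<eta> S T
    using that by (auto simp: nat_trans_def PiE_def)
  have nt: "Cmp D (omap S X) (omap S Y) (omap T Y) (\<eta> Y) (amap S X Y f) =
      Cmp D (omap S X) (omap T X) (omap T Y) (amap T X Y f) (\<eta> X)"
    if "\<eta> \<in> nat_trans C D S T" "X \<in> Ob C" "Y \<in> Ob C" "f \<in> Mor C X Y" for \<eta> S T X Y f
    using that by (auto simp: nat_trans_def)
  show ?thesis
  proof (unfold_locales; simp add: functor_category_def)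
    fix T assume "T \<in> functors C D"
    then show "(\<lambda>X\<in>Ob C. Idn D (omap T X)) \<in> nat_trans C D T T"
      by (simp add: nat_trans_def ob ar D.idn_closed D.cmp_idn_left D.cmp_idn_right)
  next
    fix S T U \<eta> \<theta>
    assume F: "S \<in> functors C D" "T \<in> functors C D" "U \<in> functors C D"
      and N: "\<eta> \<in> nat_trans C D S T" "\<theta> \<in> nat_trans C D T U"
    have "Cmp D (omap S X) (omap S Y) (omap U Y)
            (Cmp D (omap S Y) (omap T Y) (omap U Y) (\<theta> Y) (\<eta> Y)) (amap S X Y f) =
          Cmp D (omap S X) (omap U X) (omap U Y) (amap U X Y f)
            (Cmp D (omap S X) (omap T X) (omap U X) (\<theta> X) (\<eta> X))"
      if X: "X \<in> Ob C" and Y: "Y \<in> Ob C" and f: "f \<in> Mor C X Y" for X Y f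
    proof -
      note m = ob[OF F(1) X] ob[OF F(1) Y] ob[OF F(2) X] ob[OF F(2) Y] ob[OF F(3) X] ob[OF F(3) Y]
        ar[OF F(1) X Y f] ar[OF F(2) X Y f] ar[OF F(3) X Y f]
        cp[OF N(1) X] cp[OF N(1) Y] cp[OF N(2) X] cp[OF N(2) Y]
      have "Cmp D (omap S X) (omap S Y) (omap U Y)
            (Cmp D (omap S Y) (omap T Y) (omap U Y) (\<theta> Y) (\<eta> Y)) (amap S X Y f) =
          Cmp D (omap S X) (omap T Y) (omap U Y) (\<theta> Y)
            (Cmp D (omap S X) (omap S Y) (omap T Y) (\<eta> Y) (amap S X Y f))"
        by (rule D.cmp_assoc) (fact m)+
      also have "\<dots> = Cmp D (omap S X) (omap T Y) (omap U Y) (\<theta> Y)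
            (Cmp D (omap S X) (omap T X) (omap T Y) (amap T X Y f) (\<eta> X))"
        by (simp add: nt[OF N(1) X Y f])
      also have "\<dots> = Cmp D (omap S X) (omap T X) (omap U Y)
            (Cmp D (omap T X) (omap T Y) (omap U Y) (\<theta> Y) (amap T X Y f)) (\<eta> X)"
        by (rule D.cmp_assoc[symmetric]) (fact m)+
      also have "\<dots> = Cmp D (omap S X) (omap T X) (omap U Y)
            (Cmp D (omap T X) (omap U X) (omap U Y) (amap U X Y f) (\<theta> X)) (\<eta> X)"
        by (simp add: nt[OF N(2) X Y f])
      also have "\<dots> = Cmp D (omap S X) (omap U X) (omap U Y) (amap U X Y f)
            (Cmp D (omap S X) (omap T X) (omap U X) (\<theta> X) (\<eta> X))"
        by (rule D.cmp_assoc) (fact m)+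
      finally show ?thesis .
    qed
    moreover have "Cmp D (omap S X) (omap T X) (omap U X) (\<theta> X) (\<eta> X) \<in> Mor D (omap S X) (omap U X)"
      if "X \<in> Ob C" for X
      using that F N by (meson D.cmp_closed cp ob)
    ultimately show "(\<lambda>X\<in>Ob C. Cmp D (omap S X) (omap T X) (omap U X) (\<theta> X) (\<eta> X))
        \<in> nat_trans C D S U"
      by (simp add: nat_trans_def)
  next
    fix S T \<eta>
    assume F: "S \<in> functors C D" "T \<in> functors C D" and N: "\<eta> \<in> nat_trans C D S T"
    show "(\<lambda>X\<in>Ob C. Cmp D (omap S X) (omap S X) (omap T X) (\<eta> X)
        (if X \<in> Ob C then Idn D (omap S X) else undefined)) = \<eta>"
      by (rule extensionalityI[of _ "Ob C"]) (use F N in \<open>auto simp: ex ob cp D.cmp_idn_right\<close>)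
    show "(\<lambda>X\<in>Ob C. Cmp D (omap S X) (omap T X) (omap T X)
        (if X \<in> Ob C then Idn D (omap T X) else undefined) (\<eta> X)) = \<eta>"
      by (rule extensionalityI[of _ "Ob C"]) (use F N in \<open>auto simp: ex ob cp D.cmp_idn_left\<close>)
  next
    fix R S T U \<eta> \<theta> \<zeta>
    assume F: "R \<in> functors C D" "S \<in> functors C D" "T \<in> functors C D" "U \<in> functors C D"
      and N: "\<eta> \<in> nat_trans C D R S" "\<theta> \<in> nat_trans C D S T" "\<zeta> \<in> nat_trans C D T U"
    show "(\<lambda>X\<in>Ob C. Cmp D (omap R X) (omap S X) (omap U X)
          (if X \<in> Ob C then Cmp D (omap S X) (omap T X) (omap U X) (\<zeta> X) (\<theta> X) else undefined) (\<eta> X)) =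
        (\<lambda>X\<in>Ob C. Cmp D (omap R X) (omap T X) (omap U X) (\<zeta> X)
          (if X \<in> Ob C then Cmp D (omap R X) (omap S X) (omap T X) (\<theta> X) (\<eta> X) else undefined))"
      by (rule restrict_ext) (simp add: D.cmp_assoc ob[OF F(1)] ob[OF F(2)] ob[OF F(3)] ob[OF F(4)]
          cp[OF N(1)] cp[OF N(2)] cp[OF N(3)])
  qed
qed


section \<open>The category of generic representations\<close>

text \<open>
  Arrows of modules are linear maps restricted to their domain, so that two arrows are equal as soon
  as they agree on the carrier.
\<close>

definition module_category ::
  "('r, 'm) ring_scheme \<Rightarrow> (('r, 'b) module, 'b \<Rightarrow> 'b) precat" where
  "module_category R =
    \<lparr>Ob = {M. module R M},
     Mor = (\<lambda>M N. module_hom R M N \<inter> extensional (carrier M)),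
     Idn = (\<lambda>M. \<lambda>x \<in> carrier M. x),
     Cmp = (\<lambda>L M N g f. compose (carrier L) g f)\<rparr>"

definition fin_dim_category ::
  "('r, 'm) ring_scheme \<Rightarrow> (('r, 'b) module, 'b \<Rightarrow> 'b) precat" where
  "fin_dim_category F =
    (module_category F)\<lparr>Ob := {V. vectorspace F V \<and> vectorspace.fin_dim F V}\<rparr>"

lemma module_category_category:
  fixes R :: "('r, 'm) ring_scheme"
  shows "category (module_category R :: (('r, 'b) module, 'b \<Rightarrow> 'b) precat)"
proof (unfold_locales; simp add: module_category_def)
  fix M :: "('r, 'b) module" assume "module R M"
  then interpret module R M .
  show "(\<lambda>x\<in>carrier M. x) \<in> module_hom R M M"
    by (auto simp: module_hom_def)
next
  fix L M N :: "('r, 'b) module" and f g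
  assume M: "module R L" "module R M" "module R N"
    and f: "f \<in> module_hom R L M \<and> f \<in> extensional (carrier L)"
    and g: "g \<in> module_hom R M N \<and> g \<in> extensional (carrier M)"
  interpret L: module R L by fact
  show "compose (carrier L) g f \<in> module_hom R L N"
    using f g by (auto simp: module_hom_def compose_def Pi_def)
next
  fix M N :: "('r, 'b) module" and f
  assume f: "f \<in> module_hom R M N \<and> f \<in> extensional (carrier M)"
  show "compose (carrier M) f (\<lambda>x\<in>carrier M. x) = f"
    by (rule extensionalityI[of _ "carrier M"]) (use f in \<open>auto simp: compose_def\<close>)
  show "compose (carrier M) (\<lambda>x\<in>carrier N. x) f = f"
    by (rule extensionalityI[of _ "carrier M"])
      (use f in \<open>auto simp: compose_def module_hom_def Pi_def\<close>)
next
  fix K L M N :: "('r, 'b) module" and f g h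
  assume "f \<in> module_hom R K L \<and> f \<in> extensional (carrier K)"
  then show "compose (carrier K) (compose (carrier L) h g) f =
      compose (carrier K) h (compose (carrier K) g f)"
    by (auto simp: compose_def module_hom_def Pi_def fun_eq_iff)
qed

lemma full_subcategory_category:
  assumes "category C" and "A \<subseteq> Ob C"
  shows "category (C\<lparr>Ob := A\<rparr>)"
proof -
  interpret C: category C by fact
  show ?thesis
    by unfold_locales (use assms(2) in \<open>auto simp: subset_iff C.idn_closed C.cmp_closed
      C.cmp_idn_right C.cmp_idn_left C.cmp_assoc\<close>)
qed

lemma fin_dim_category_category: "category (fin_dim_category F)"
  unfolding fin_dim_category_def
  by (rule full_subcategory_category[OF module_category_category])
    (auto simp: module_category_def vectorspace_def)

text \<open>
  The types \<open>'v\<close> and \<open>'w\<close> from which the carriers of the \<open>F\<close>-vector spaces and of the \<open>K\<close>-modules are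
  taken play the role of universes.  For finite \<open>F\<close>, every finite dimensional vector space has a copy
  with carrier in \<open>'v\<close> as soon as \<open>'v\<close> is infinite.
\<close>

type_synonym ('f, 'v, 'k, 'w) rep =
  "(('f, 'v) module, 'v \<Rightarrow> 'v, ('k, 'w) module, 'w \<Rightarrow> 'w) functor_data"

type_synonym ('f, 'v, 'k, 'w) rep_category =
  "(('f, 'v, 'k, 'w) rep, ('f, 'v) module \<Rightarrow> 'w \<Rightarrow> 'w) precat"

definition Rep ::
  "('f, 'm) ring_scheme \<Rightarrow> ('k, 'n) ring_scheme \<Rightarrow> ('f, 'v, 'k, 'w) rep_category" where
  "Rep F K = functor_category (fin_dim_category F) (module_category K)"

lemma Rep_category: "category (Rep F K)"
  unfolding Rep_def
  by (intro functor_category_category fin_dim_category_category module_category_category)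

end

theory Submission
  imports Defs "HOL.Rat"
begin

text \<open>
  Why every generic representation is a direct sum of simple ones.

  \<^bold>\<open>Endomorphism algebras are separable.\<close>  Let \<open>W\<close> be a vector space of finite dimension over the
  field \<open>F\<close> with \<open>q\<close> elements, and let \<open>A\<close> be the rational algebra of the finite monoid \<open>End W\<close>.  It is
  not a group algebra, so Maschke's theorem does not apply, but it carries a nondegenerate trace form:
  for \<open>\<chi>(h) = q [tr h = 1] - 1\<close> the matrix \<open>\<chi>(g f)\<close> is inverted by the equally simple matrix
  \<open>Q(f, g) = ([tr (g f) = 1] - [tr (g f) = 0]) / |End W|\<close>, a rational substitute for the Fourier
  transform (lemma \<open>\<chi>_Q_dual\<close>).  For an algebra with such a form, the Higman trace
  \<open>b \<mapsto> \<Sum> Q(f, g) f b g\<close> takes central values, and if it takes the value \<open>1\<close> at \<open>b\<close>, then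
  \<open>\<Sum> Q(f, g) f \<otimes> b g\<close> is a separability idempotent: it multiplies to \<open>1\<close> and commutes with \<open>A\<close>.
  A suitable \<open>b\<close> is found by induction along the coordinate projections
  \<open>0 = p\<^sub>0, p\<^sub>1, \<dots>, p\<^sub>n = 1\<close> of \<open>W\<close>.  If \<open>a\<close> solves the problem for the corner \<open>r G r\<close> of a monoid \<open>G\<close>,
  then the Higman trace of \<open>a\<close>, formed in \<open>G\<close>, is a central element \<open>e\<close> with \<open>e r = r\<close>, that is, an
  identity element for the ideal spanned by \<open>G r G\<close>.  When all elements of \<open>G\<close> outside \<open>G r G\<close> are
  units, only the group of units survives in the complementary ideal of \<open>1 - e\<close>, and there Maschke's
  averaging applies (theorems \<open>separable_step\<close> and \<open>separable_from_corner\<close>).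

  \<^bold>\<open>Complements.\<close>  Averaging a \<open>K\<close>-linear projection with the separability idempotent gives, for each
  functor \<open>T\<close> and each space \<open>V\<close>, a complement of every \<open>End V\<close>-submodule of \<open>T(V)\<close> (theorem
  \<open>stable_complement\<close>).  A Zorn argument then yields a simple \<open>End V\<close>-submodule that meets a given
  proper submodule only in \<open>0\<close> (theorem \<open>simple_stable_outside\<close>).

  \<^bold>\<open>From spaces to functors.\<close>  A simple \<open>End V\<close>-submodule \<open>C\<close> of \<open>T(V)\<close> generates a simple subfunctor
  of \<open>T\<close> (lemma \<open>generated_simple\<close>).  The point is that a subfunctor \<open>N\<close> of it with \<open>N(V) = 0\<close> vanishes
  at every \<open>W\<close>; one of \<open>V\<close> and \<open>W\<close> is a retract of the other, and the nontrivial case, where \<open>V\<close> is a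
  retract of \<open>W\<close>, follows by choosing a complement of \<open>N(W)\<close>.  Hence \<open>T\<close> is the sum of its simple
  subfunctors, and a maximal family of simple subfunctors whose sum is direct already has sum \<open>T\<close>.
  Such a direct sum is a coproduct in the category, and simple subfunctors are simple objects because
  kernels and images of morphisms are subfunctors.
\<close>

section \<open>Monoid algebras with a symmetrizing form\<close>

lemma sum_of_bool_mult_point [simp]:
  fixes f :: "'a \<Rightarrow> rat"
  assumes "finite A"
  shows "(\<Sum>x\<in>A. of_bool (a = x) * f x) = (if a \<in> A then f a else 0)"
  using assms by (simp add: of_bool_def if_distrib [of "\<lambda>z. z * _"] sum.delta' cong: if_cong)

text \<open>
  The matrix \<open>Q\<close> is inverse to the matrix of the form \<open>(x, y) \<mapsto> \<chi>(x y)\<close> on the rational monoid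
  algebra of \<open>G\<close>; so it witnesses that this form is nondegenerate, and \<open>\<Sum> Q(f, g) f \<otimes> g\<close> is the
  Casimir element of the form.  An element \<open>\<Sum> a(x) x\<close> of the monoid algebra is represented below by
  the functional \<open>\<phi> \<mapsto> \<Sum> a(x) \<phi>(x)\<close>, and an element of its tensor square by a functional on functions
  of two variables.  Products then become substitutions in the test function, and no convolution
  product has to be introduced.
\<close>
locale symmetrizing_form = monoid G for G (structure) +
  fixes \<chi> :: "'a \<Rightarrow> rat" and Q :: "'a \<Rightarrow> 'a \<Rightarrow> rat"
  assumes finite_carrier: "finite (carrier G)"
    and trace: "\<lbrakk>x \<in> carrier G; y \<in> carrier G\<rbrakk> \<Longrightarrow> \<chi> (x \<otimes> y) = \<chi> (y \<otimes> x)"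
    and Q_sym: "\<lbrakk>x \<in> carrier G; y \<in> carrier G\<rbrakk> \<Longrightarrow> Q x y = Q y x"
    and dual: "\<lbrakk>f \<in> carrier G; x \<in> carrier G\<rbrakk>
      \<Longrightarrow> (\<Sum>g\<in>carrier G. Q f g * \<chi> (g \<otimes> x)) = of_bool (f = x)"
begin

text \<open>
  A one-sided inverse is two-sided here because both matrices are symmetric.
\<close>
lemma dual':
  assumes "g \<in> carrier G" "h \<in> carrier G"
  shows "(\<Sum>f\<in>carrier G. \<chi> (g \<otimes> f) * Q f h) = of_bool (g = h)"
proof -
  have "(\<Sum>f\<in>carrier G. \<chi> (g \<otimes> f) * Q f h) = (\<Sum>f\<in>carrier G. Q h f * \<chi> (f \<otimes> g))"
    using assms by (intro sum.cong) (auto simp: trace[of g] Q_sym[of h])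
  then show ?thesis using dual[OF assms(2,1)] by (simp add: eq_commute)
qed

lemma Q_unique:
  assumes "symmetrizing_form G \<chi> Q'" and f: "f \<in> carrier G" and h: "h \<in> carrier G"
  shows "Q' f h = Q f h"
proof -
  interpret Q': symmetrizing_form G \<chi> Q' by fact
  have "Q' f h = (\<Sum>x\<in>carrier G. of_bool (f = x) * Q' x h)"
    using f finite_carrier by simp
  also have "\<dots> = (\<Sum>x\<in>carrier G. \<Sum>g\<in>carrier G. Q f g * (\<chi> (g \<otimes> x) * Q' x h))"
    by (intro sum.cong) (simp_all add: dual[OF f, symmetric] sum_distrib_right mult.assoc)
  also have "\<dots> = (\<Sum>g\<in>carrier G. Q f g * of_bool (g = h))"
    by (subst sum.swap) (simp add: sum_distrib_left[symmetric] Q'.dual' h)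
  also have "\<dots> = Q f h"
    using h finite_carrier by (simp add: mult.commute[of "Q f _"])
  finally show ?thesis .
qed

text \<open>
  The Casimir element \<open>\<Omega>\<close> satisfies \<open>y \<Omega> = \<Omega> y\<close>: expanding \<open>y f\<close> in the basis \<open>G\<close> by means of \<open>Q\<close> and
  \<open>\<chi>\<close> produces the factor \<open>\<chi>(v y f)\<close>, and summing it over \<open>f\<close> against \<open>Q(f, g)\<close> singles out \<open>g = v y\<close>.
\<close>
lemma casimir:
  assumes y: "y \<in> carrier G"
  shows "(\<Sum>f\<in>carrier G. \<Sum>g\<in>carrier G. Q f g * \<Phi> (y \<otimes> f) g) =
         (\<Sum>f\<in>carrier G. \<Sum>g\<in>carrier G. Q f g * \<Phi> f (g \<otimes> y))"
proof -
  have "(\<Sum>f\<in>carrier G. \<Sum>g\<in>carrier G. Q f g * \<Phi> (y \<otimes> f) g) =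
        (\<Sum>f\<in>carrier G. \<Sum>g\<in>carrier G. \<Sum>u\<in>carrier G. \<Sum>v\<in>carrier G.
           Q u v * \<Phi> u g * (\<chi> (v \<otimes> y \<otimes> f) * Q f g))"
  proof (intro sum.cong refl)
    fix f g assume f: "f \<in> carrier G" and g: "g \<in> carrier G"
    have "Q f g * \<Phi> (y \<otimes> f) g = (\<Sum>u\<in>carrier G. of_bool (u = y \<otimes> f) * (\<Phi> u g * Q f g))"
      using y f finite_carrier by simp
    also have "\<dots> = (\<Sum>u\<in>carrier G. \<Sum>v\<in>carrier G. Q u v * \<Phi> u g * (\<chi> (v \<otimes> y \<otimes> f) * Q f g))"
      using y f by (intro sum.cong refl)
        (simp add: dual[symmetric] sum_distrib_right m_assoc, intro sum.cong refl, simp add: m_assoc)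
    finally show "Q f g * \<Phi> (y \<otimes> f) g = \<dots>" .
  qed
  also have "\<dots> = (\<Sum>u\<in>carrier G. \<Sum>v\<in>carrier G. \<Sum>g\<in>carrier G. \<Sum>f\<in>carrier G.
           Q u v * \<Phi> u g * (\<chi> (v \<otimes> y \<otimes> f) * Q f g))"
    by (subst sum.swap, subst (2) sum.swap, subst sum.swap, subst (3) sum.swap, subst (2) sum.swap) simp
  also have "\<dots> = (\<Sum>u\<in>carrier G. \<Sum>v\<in>carrier G. \<Sum>g\<in>carrier G. of_bool (v \<otimes> y = g) * (Q u v * \<Phi> u g))"
    using y by (intro sum.cong refl) (subst sum_distrib_left[symmetric], subst dual', auto)
  also have "\<dots> = (\<Sum>u\<in>carrier G. \<Sum>v\<in>carrier G. Q u v * \<Phi> u (v \<otimes> y))"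
    using y finite_carrier by (intro sum.cong refl) simp
  finally show ?thesis .
qed

text \<open>
  The functional of the Higman trace \<open>\<Sum> Q(f, g) f b g\<close> of the element \<open>b\<close>.
\<close>
definition higman :: "('a \<Rightarrow> rat) \<Rightarrow> ('a \<Rightarrow> rat) \<Rightarrow> rat" where
  "higman b \<phi> = (\<Sum>f\<in>carrier G. \<Sum>g\<in>carrier G. Q f g * (\<Sum>h\<in>carrier G. b h * \<phi> (f \<otimes> h \<otimes> g)))"

lemma higman_cong:
  "(\<And>x. x \<in> carrier G \<Longrightarrow> \<phi> x = \<psi> x) \<Longrightarrow> higman b \<phi> = higman b \<psi>"
  unfolding higman_def by (intro sum.cong refl arg_cong2[of _ _ _ _ "(*)"]) auto

lemma higman_add: "higman (\<lambda>x. a x + b x) \<phi> = higman a \<phi> + higman b \<phi>"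
  by (simp add: higman_def distrib_right distrib_left sum.distrib)

lemma higman_scale: "higman b (\<lambda>x. r * \<phi> x) = r * higman b \<phi>"
  by (simp add: higman_def sum_distrib_left ac_simps)

lemma higman_sum: "higman b (\<lambda>x. \<Sum>i\<in>I. \<phi> i x) = (\<Sum>i\<in>I. higman b (\<phi> i))"
  unfolding higman_def sum_distrib_left
  by (subst (2) sum.swap, subst sum.swap, subst (3) sum.swap, subst (4) sum.swap) (simp add: sum.swap[of _ _ I])

lemma higman_central:
  assumes y: "y \<in> carrier G"
  shows "higman b (\<lambda>x. \<phi> (x \<otimes> y)) = higman b (\<lambda>x. \<phi> (y \<otimes> x))"
proof -
  have "higman b (\<lambda>x. \<phi> (x \<otimes> y)) = (\<Sum>f\<in>carrier G. \<Sum>g\<in>carrier G.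
      Q f g * (\<lambda>f g. \<Sum>h\<in>carrier G. b h * \<phi> (f \<otimes> h \<otimes> g)) f (g \<otimes> y))"
    unfolding higman_def using y by (intro sum.cong refl arg_cong2[of _ _ _ _ "(*)"]) (auto simp: m_assoc)
  also have "\<dots> = higman b (\<lambda>x. \<phi> (y \<otimes> x))"
    unfolding higman_def using y
    by (subst casimir[OF y, symmetric], intro sum.cong refl arg_cong2[of _ _ _ _ "(*)"])
      (auto simp: m_assoc)
  finally show ?thesis .
qed

text \<open>
  The Casimir identity restricted to one row: \<open>Q(f, g) = Q(1, g f)\<close> for a unit \<open>f\<close>.
\<close>
lemma Q_unit_shift:
  assumes f: "f \<in> Units G"
  shows "(\<Sum>g\<in>carrier G. Q f g * K g) = (\<Sum>g\<in>carrier G. Q \<one> g * K (g \<otimes> inv f))"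
proof -
  have fc: "f \<in> carrier G" and ic: "inv f \<in> carrier G" using f by auto
  have eq: "f \<otimes> u = f \<longleftrightarrow> u = \<one>" if "u \<in> carrier G" for u
    using f fc that by (metis Units_l_cancel one_closed r_one)
  have "(\<Sum>g\<in>carrier G. Q \<one> g * K (g \<otimes> inv f)) =
      (\<Sum>u\<in>carrier G. of_bool (u = \<one>) * (\<Sum>g\<in>carrier G. Q u g * K (g \<otimes> inv f)))"
    using finite_carrier by simp
  also have "\<dots> = (\<Sum>u\<in>carrier G. \<Sum>g\<in>carrier G. Q u g * (of_bool (f \<otimes> u = f) * K (g \<otimes> inv f)))"
    by (intro sum.cong refl) (simp add: eq)
  also have "\<dots> = (\<Sum>u\<in>carrier G. \<Sum>g\<in>carrier G. Q u g * (of_bool (u = f) * K (g \<otimes> f \<otimes> inv f)))"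
    by (rule casimir[OF fc, of "\<lambda>u g. of_bool (u = f) * K (g \<otimes> inv f)"])
  also have "\<dots> = (\<Sum>u\<in>carrier G. of_bool (u = f) * (\<Sum>g\<in>carrier G. Q u g * K g))"
    unfolding sum_distrib_left using f fc by (intro sum.cong refl) (auto simp: m_assoc)
  also have "\<dots> = (\<Sum>g\<in>carrier G. Q f g * K g)"
    using finite_carrier fc by simp
  finally show ?thesis ..
qed

text \<open>
  Let \<open>e\<close> be the Higman trace of \<open>a\<close>.  By hypothesis it lies in the span of the ideal \<open>N\<close> and is an
  identity element there, so it remains to write \<open>1 - e\<close> as a Higman trace.  Multiplication by
  \<open>1 - e\<close> kills \<open>N\<close>, so only units contribute, and the answer is the one of Maschke's theorem for the
  group of units, corrected for the form in use: \<open>1 - e\<close> is the Higman trace of the average of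
  \<open>c(t\<inverse>) (1 - e) t\<close> over all units \<open>t\<close>, where \<open>c(y) = \<chi>((1 - e) y)\<close> is the form on the complementary
  ideal.  In the resulting sum over units \<open>f\<close>, \<open>g\<close>, \<open>t\<close>, duality evaluates the sum over \<open>g\<close> for a fixed
  product \<open>t g\<close>, and this leaves only the terms with \<open>t g = 1\<close>.
\<close>
theorem separable_step:
  assumes N: "N \<subseteq> carrier G"
    and ideal_l: "\<And>x s. x \<in> carrier G \<Longrightarrow> s \<in> N \<Longrightarrow> x \<otimes> s \<in> N"
    and ideal_r: "\<And>x s. x \<in> carrier G \<Longrightarrow> s \<in> N \<Longrightarrow> s \<otimes> x \<in> N"
    and units_or: "carrier G \<subseteq> Units G \<union> N"
    and idl: "\<And>s \<phi>. s \<in> N \<Longrightarrow> higman a (\<lambda>x. \<phi> (x \<otimes> s)) = \<phi> s"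
    and supp: "\<And>\<phi>. (\<And>s. s \<in> N \<Longrightarrow> \<phi> s = 0) \<Longrightarrow> higman a \<phi> = 0"
  shows "\<exists>b. \<forall>\<phi>. higman b \<phi> = \<phi> \<one>"
proof (cases "\<one> \<in> N")
  case True
  have "higman a \<phi> = \<phi> \<one>" for \<phi>
    using idl[OF True, of \<phi>] by (simp cong: higman_cong)
  then show ?thesis by blast
next
  case one: False
  let ?U = "Units G" and ?M = "carrier G"
  have finU: "finite ?U" using finite_carrier by (rule finite_subset[rotated]) auto
  have inv_mult: "inv (t \<otimes> g) = inv g \<otimes> inv t" if "t \<in> ?U" "g \<in> ?U" for t g
  proof -
    have c: "t \<in> ?M" "g \<in> ?M" "inv t \<in> ?M" "inv g \<in> ?M" using that by auto
    have "inv g \<otimes> inv t \<otimes> (t \<otimes> g) = inv g \<otimes> (inv t \<otimes> t) \<otimes> g"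
      "t \<otimes> g \<otimes> (inv g \<otimes> inv t) = t \<otimes> (g \<otimes> inv g) \<otimes> inv t"
      using c by (simp_all add: m_assoc)
    then show ?thesis using that c by (intro inv_unique'[symmetric]) auto
  qed
  have UN: "u \<notin> N" if "u \<in> ?U" for u
    using ideal_l[of "inv u" u] that one by auto
  define c where "c y = \<chi> y - higman a (\<lambda>x. \<chi> (x \<otimes> y))" for y
  have cN: "c y = 0" if "y \<in> N" for y using idl[OF that] by (simp add: c_def)
  define B where "B \<psi> = (\<Sum>t\<in>?U. c (inv t) * (\<psi> t - higman a (\<lambda>x. \<psi> (x \<otimes> t)))) / of_nat (card ?U)" for \<psi>
  define b where "b h = B (\<lambda>x. of_bool (x = h))" for h
  have B: "(\<Sum>h\<in>?M. b h * \<psi> h) = B \<psi>" for \<psi>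
  proof -
    have ex: "\<psi> x = (\<Sum>h\<in>?M. \<psi> h * of_bool (x = h))" if "x \<in> ?M" for x
      using that finite_carrier by (simp add: mult.commute[of "\<psi> _"])
    have "B \<psi> = (\<Sum>t\<in>?U. c (inv t) * ((\<Sum>h\<in>?M. \<psi> h * of_bool (t = h))
         - (\<Sum>h\<in>?M. \<psi> h * higman a (\<lambda>x. of_bool (x \<otimes> t = h))))) / of_nat (card ?U)"
      unfolding B_def
    proof (intro arg_cong2[of _ _ _ _ "(/)"] sum.cong refl arg_cong2[of _ _ _ _ "(*)"] arg_cong2[of _ _ _ _ "(-)"])
      fix t assume t: "t \<in> ?U"
      then show "\<psi> t = (\<Sum>h\<in>?M. \<psi> h * of_bool (t = h))" by (intro ex) auto
      have "higman a (\<lambda>x. \<psi> (x \<otimes> t)) = higman a (\<lambda>x. \<Sum>h\<in>?M. \<psi> h * of_bool (x \<otimes> t = h))"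
        using t by (intro higman_cong ex) auto
      then show "higman a (\<lambda>x. \<psi> (x \<otimes> t)) = (\<Sum>h\<in>?M. \<psi> h * higman a (\<lambda>x. of_bool (x \<otimes> t = h)))"
        by (simp add: higman_sum higman_scale)
    qed
    also have "\<dots> = (\<Sum>h\<in>?M. b h * \<psi> h)"
      unfolding b_def B_def sum_subtractf[symmetric] sum_distrib_left sum_distrib_right sum_divide_distrib
      by (subst sum.swap) (simp add: algebra_simps)
    finally show ?thesis ..
  qed
  have "higman (\<lambda>x. a x + b x) \<phi> = \<phi> \<one>" for \<phi>
  proof -
    \<comment> \<open>The test function \<open>\<phi>\<close> after multiplication by \<open>1 - e\<close>.\<close>
    define \<phi>' where "\<phi>' u = \<phi> u - higman a (\<lambda>x. \<phi> (x \<otimes> u))" for u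
    have \<phi>'N: "\<phi>' u = 0" if "u \<in> N" for u using idl[OF that] by (simp add: \<phi>'_def)
    let ?k = "of_nat (card ?U) :: rat"
    have Bf: "B (\<lambda>h. \<phi> (f \<otimes> h \<otimes> g)) = (\<Sum>t\<in>?U. c (inv t) * \<phi>' (f \<otimes> t \<otimes> g)) / ?k"
      if f: "f \<in> ?M" and g: "g \<in> ?M" for f g
      unfolding B_def \<phi>'_def
    proof (intro arg_cong2[of _ _ _ _ "(/)"] sum.cong refl arg_cong2[of _ _ _ _ "(*)"] arg_cong2[of _ _ _ _ "(-)"])
      fix t assume t: "t \<in> ?U"
      have "higman a (\<lambda>x. \<phi> (f \<otimes> (x \<otimes> t) \<otimes> g)) = higman a (\<lambda>x. (\<lambda>z. \<phi> (z \<otimes> (t \<otimes> g))) (f \<otimes> x))"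
        using f g t by (intro higman_cong) (auto simp: m_assoc)
      also have "\<dots> = higman a (\<lambda>x. \<phi> (x \<otimes> f \<otimes> (t \<otimes> g)))"
        by (rule higman_central[OF f, symmetric])
      also have "\<dots> = higman a (\<lambda>x. \<phi> (x \<otimes> (f \<otimes> t \<otimes> g)))"
        using f g t by (intro higman_cong) (auto simp: m_assoc)
      finally show "higman a (\<lambda>x. \<phi> (f \<otimes> (x \<otimes> t) \<otimes> g)) = higman a (\<lambda>x. \<phi> (x \<otimes> (f \<otimes> t \<otimes> g)))" .
    qed
    \<comment> \<open>The sum over \<open>g\<close> with \<open>t g = v\<close> fixed; it extends to all \<open>g\<close> since \<open>c\<close> vanishes on \<open>N\<close>, and then it is
        the coefficient of \<open>1 - e\<close> at the unit \<open>v\<close>.\<close>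
    have inner: "(\<Sum>g\<in>?U. Q \<one> g * c (g \<otimes> inv v)) = of_bool (v = \<one>)" if v: "v \<in> ?U" for v
    proof -
      have iv: "inv v \<in> ?M" using v by auto
      have eq: "\<one> = inv v \<longleftrightarrow> v = \<one>" using v by (metis Units_inv_inv inv_one)
      have "(\<Sum>g\<in>?U. Q \<one> g * c (g \<otimes> inv v)) = (\<Sum>g\<in>?M. Q \<one> g * c (g \<otimes> inv v))"
        by (rule sum.mono_neutral_left) (use finite_carrier units_or iv ideal_r cN in auto)
      also have "\<dots> = (\<Sum>g\<in>?M. Q \<one> g * \<chi> (g \<otimes> inv v))
          - higman a (\<lambda>x. \<Sum>g\<in>?M. Q \<one> g * \<chi> (x \<otimes> (g \<otimes> inv v)))"
        by (simp add: c_def higman_sum higman_scale sum_subtractf right_diff_distrib)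
      also have "higman a (\<lambda>x. \<Sum>g\<in>?M. Q \<one> g * \<chi> (x \<otimes> (g \<otimes> inv v)))
          = higman a (\<lambda>x. \<Sum>g\<in>?M. Q \<one> g * \<chi> (g \<otimes> (inv v \<otimes> x)))"
        using iv by (intro higman_cong sum.cong refl arg_cong2[of _ _ _ _ "(*)"], subst trace)
          (auto simp: m_assoc)
      also have "\<dots> = higman a (\<lambda>x. of_bool (\<one> = inv v \<otimes> x))"
        using iv by (intro higman_cong dual) auto
      also have "\<dots> = 0"
        using ideal_l[OF iv] one by (intro supp) auto
      also have "(\<Sum>g\<in>?M. Q \<one> g * \<chi> (g \<otimes> inv v)) = of_bool (\<one> = inv v)"
        using iv by (intro dual) auto
      finally show ?thesis by (simp add: eq)
    qed
    have conj: "(\<Sum>g\<in>?M. Q f g * (\<Sum>t\<in>?U. c (inv t) * \<phi>' (f \<otimes> t \<otimes> g))) = \<phi>' \<one>" if f: "f \<in> ?U" for f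
    proof -
      have fc: "f \<in> ?M" and ic: "inv f \<in> ?M" using f by auto
      have "(\<Sum>g\<in>?M. Q f g * (\<Sum>t\<in>?U. c (inv t) * \<phi>' (f \<otimes> t \<otimes> g)))
          = (\<Sum>g\<in>?M. Q \<one> g * (\<Sum>t\<in>?U. c (inv t) * \<phi>' (f \<otimes> t \<otimes> (g \<otimes> inv f))))"
        by (rule Q_unit_shift[OF f])
      also have "\<dots> = (\<Sum>g\<in>?U. Q \<one> g * (\<Sum>t\<in>?U. c (inv t) * \<phi>' (f \<otimes> t \<otimes> (g \<otimes> inv f))))"
      proof (rule sum.mono_neutral_right)
        have "\<phi>' (f \<otimes> t \<otimes> (g \<otimes> inv f)) = 0" if "g \<in> ?M - ?U" "t \<in> ?U" for g t
        proof -
          have "g \<in> N" using that units_or by blast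
          then show ?thesis using that(2) fc ic by (intro \<phi>'N ideal_l ideal_r) auto
        qed
        then show "\<forall>g\<in>?M - ?U. Q \<one> g * (\<Sum>t\<in>?U. c (inv t) * \<phi>' (f \<otimes> t \<otimes> (g \<otimes> inv f))) = 0"
          by (simp add: sum.neutral)
      qed (use finite_carrier in auto)
      also have "\<dots> = (\<Sum>g\<in>?U. Q \<one> g * (\<Sum>v\<in>?U. c (g \<otimes> inv v) * \<phi>' (f \<otimes> v \<otimes> inv f)))"
      proof (rule sum.cong[OF refl], rule arg_cong2[of _ _ _ _ "(*)", OF refl])
        fix g assume g: "g \<in> ?U"
        have canc: "g \<otimes> (inv g \<otimes> z) = z" "inv g \<otimes> (g \<otimes> z) = z" if "z \<in> ?M" for z
          using g that m_assoc[of g "inv g" z] m_assoc[of "inv g" g z] by (auto simp: Units_closed)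
        show "(\<Sum>t\<in>?U. c (inv t) * \<phi>' (f \<otimes> t \<otimes> (g \<otimes> inv f))) = (\<Sum>v\<in>?U. c (g \<otimes> inv v) * \<phi>' (f \<otimes> v \<otimes> inv f))"
          using g fc ic
          by (intro sum.reindex_bij_witness[of _ "\<lambda>v. v \<otimes> inv g" "\<lambda>t. t \<otimes> g"])
            (auto simp: m_assoc inv_mult canc Units_closed)
      qed
      also have "\<dots> = (\<Sum>v\<in>?U. (\<Sum>g\<in>?U. Q \<one> g * c (g \<otimes> inv v)) * \<phi>' (f \<otimes> v \<otimes> inv f))"
        unfolding sum_distrib_left sum_distrib_right by (subst sum.swap) (simp add: mult.assoc)
      also have "\<dots> = (\<Sum>v\<in>?U. of_bool (v = \<one>) * \<phi>' (f \<otimes> v \<otimes> inv f))"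
        by (intro sum.cong refl) (simp add: inner)
      also have "\<dots> = \<phi>' \<one>"
        using finU f fc by simp
      finally show ?thesis .
    qed
    have "higman b \<phi> = (\<Sum>f\<in>?M. \<Sum>g\<in>?M. Q f g * ((\<Sum>t\<in>?U. c (inv t) * \<phi>' (f \<otimes> t \<otimes> g)) / ?k))"
      unfolding higman_def by (intro sum.cong refl) (simp add: B Bf)
    also have "\<dots> = (\<Sum>f\<in>?M. (\<Sum>g\<in>?M. Q f g * (\<Sum>t\<in>?U. c (inv t) * \<phi>' (f \<otimes> t \<otimes> g)))) / ?k"
      by (simp only: sum_divide_distrib[symmetric] times_divide_eq_right)
    also have "\<dots> = (\<Sum>f\<in>?U. (\<Sum>g\<in>?M. Q f g * (\<Sum>t\<in>?U. c (inv t) * \<phi>' (f \<otimes> t \<otimes> g)))) / ?k"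
    proof (intro arg_cong2[of _ _ _ _ "(/)"] sum.mono_neutral_right refl)
      have "\<phi>' (f \<otimes> t \<otimes> g) = 0" if "f \<in> ?M - ?U" "g \<in> ?M" "t \<in> ?U" for f g t
      proof -
        have "f \<in> N" using that units_or by blast
        then show ?thesis using that by (intro \<phi>'N ideal_r) auto
      qed
      then show "\<forall>f\<in>?M - ?U. (\<Sum>g\<in>?M. Q f g * (\<Sum>t\<in>?U. c (inv t) * \<phi>' (f \<otimes> t \<otimes> g))) = 0"
        by (simp add: sum.neutral)
    qed (use finite_carrier in auto)
    also have "\<dots> = \<phi>' \<one>"
      using finU Units_one_closed by (auto simp: conj)
    also have "\<dots> = \<phi> \<one> - higman a \<phi>"
      by (simp add: \<phi>'_def cong: higman_cong)
    finally show ?thesis by (simp add: higman_add)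
  qed
  then show ?thesis by blast
qed


text \<open>
  Multiplying the second factor of the Casimir element by \<open>b\<close> from the left preserves its commutation
  with \<open>y\<close>, and turns its product into the Higman trace of \<open>b\<close>.
\<close>
lemma higman_casimir_idempotent:
  assumes b: "\<And>\<phi>. higman b \<phi> = \<phi> \<one>"
  shows "\<exists>w :: 'a \<Rightarrow> 'a \<Rightarrow> rat.
    (\<forall>y\<in>carrier G. \<forall>\<Phi>. (\<Sum>f\<in>carrier G. \<Sum>g\<in>carrier G. w f g * \<Phi> (y \<otimes> f) g) =
       (\<Sum>f\<in>carrier G. \<Sum>g\<in>carrier G. w f g * \<Phi> f (g \<otimes> y))) \<and>
    (\<forall>\<phi>. (\<Sum>f\<in>carrier G. \<Sum>g\<in>carrier G. w f g * \<phi> (f \<otimes> g)) = \<phi> \<one>)"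
proof -
  let ?M = "carrier G"
  define w where "w f k = (\<Sum>g\<in>?M. \<Sum>h\<in>?M. of_bool (k = h \<otimes> g) * (Q f g * b h))" for f k
  have w: "(\<Sum>f\<in>?M. \<Sum>k\<in>?M. w f k * \<Phi> f k) = (\<Sum>f\<in>?M. \<Sum>g\<in>?M. Q f g * (\<Sum>h\<in>?M. b h * \<Phi> f (h \<otimes> g)))" for \<Phi>
  proof (rule sum.cong[OF refl])
    fix f assume "f \<in> ?M"
    have "(\<Sum>k\<in>?M. w f k * \<Phi> f k) =
        (\<Sum>k\<in>?M. \<Sum>g\<in>?M. \<Sum>h\<in>?M. of_bool (k = h \<otimes> g) * (Q f g * b h * \<Phi> f k))"
      by (simp add: w_def sum_distrib_right mult.assoc)
    also have "\<dots> = (\<Sum>g\<in>?M. \<Sum>h\<in>?M. \<Sum>k\<in>?M. of_bool (k = h \<otimes> g) * (Q f g * b h * \<Phi> f k))"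
      by (subst sum.swap, subst (2) sum.swap) simp
    also have "\<dots> = (\<Sum>g\<in>?M. Q f g * (\<Sum>h\<in>?M. b h * \<Phi> f (h \<otimes> g)))"
      using finite_carrier by (simp add: sum_distrib_left mult.assoc)
    finally show "(\<Sum>k\<in>?M. w f k * \<Phi> f k) = \<dots>" .
  qed
  show ?thesis
  proof (intro exI[of _ w] conjI ballI allI)
    fix y and \<Phi> :: "'a \<Rightarrow> 'a \<Rightarrow> rat" assume y: "y \<in> ?M"
    show "(\<Sum>f\<in>?M. \<Sum>g\<in>?M. w f g * \<Phi> (y \<otimes> f) g) = (\<Sum>f\<in>?M. \<Sum>g\<in>?M. w f g * \<Phi> f (g \<otimes> y))"
      unfolding w using y
      by (subst casimir[OF y, of "\<lambda>f g. \<Sum>h\<in>?M. b h * \<Phi> f (h \<otimes> g)"]) (simp add: m_assoc)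
  next
    fix \<phi> :: "'a \<Rightarrow> rat"
    show "(\<Sum>f\<in>?M. \<Sum>g\<in>?M. w f g * \<phi> (f \<otimes> g)) = \<phi> \<one>"
      unfolding w b[symmetric] higman_def by (simp add: m_assoc)
  qed
qed

end

section \<open>Corners\<close>

definition corner :: "('a, 'b) monoid_scheme \<Rightarrow> 'a \<Rightarrow> ('a, 'b) monoid_scheme" where
  "corner G p = G\<lparr>carrier := {x \<in> carrier G. p \<otimes>\<^bsub>G\<^esub> x = x \<and> x \<otimes>\<^bsub>G\<^esub> p = x}, one := p\<rparr>"

lemma corner_simps [simp]:
  "mult (corner G p) = mult G" "one (corner G p) = p"
  "x \<in> carrier (corner G p) \<longleftrightarrow> x \<in> carrier G \<and> p \<otimes>\<^bsub>G\<^esub> x = x \<and> x \<otimes>\<^bsub>G\<^esub> p = x"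
  by (simp_all add: corner_def)

context symmetrizing_form
begin

context
  fixes p
  assumes p: "p \<in> carrier G" and pp: "p \<otimes> p = p"
begin

abbreviation "trim x \<equiv> p \<otimes> x \<otimes> p"

lemma trim_corner: "x \<in> carrier G \<Longrightarrow> trim x \<in> carrier (corner G p)"
  using p pp by (simp add: m_assoc) (simp add: m_assoc[symmetric])

lemma finite_corner: "finite (carrier (corner G p))"
  using finite_carrier by (rule finite_subset[rotated]) (auto simp: corner_def)

text \<open>
  The Casimir element of the corner is the image of that of \<open>G\<close> under \<open>x \<mapsto> p x p\<close> in both factors.
\<close>
definition corner_Q :: "'a \<Rightarrow> 'a \<Rightarrow> rat" where
  "corner_Q f g = (\<Sum>x\<in>carrier G. \<Sum>y\<in>carrier G. of_bool (f = trim x) * (of_bool (g = trim y) * Q x y))"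

lemma corner_Q_right:
  "(\<Sum>g\<in>carrier (corner G p). corner_Q f g * K g) =
   (\<Sum>x\<in>carrier G. of_bool (f = trim x) * (\<Sum>y\<in>carrier G. Q x y * K (trim y)))"
proof -
  have "(\<Sum>g\<in>carrier (corner G p). corner_Q f g * K g) =
      (\<Sum>g\<in>carrier (corner G p). \<Sum>x\<in>carrier G. \<Sum>y\<in>carrier G.
        of_bool (g = trim y) * (of_bool (f = trim x) * (Q x y * K g)))"
    by (simp add: corner_Q_def sum_distrib_left sum_distrib_right ac_simps)
  also have "\<dots> = (\<Sum>x\<in>carrier G. \<Sum>y\<in>carrier G. \<Sum>g\<in>carrier (corner G p).
        of_bool (g = trim y) * (of_bool (f = trim x) * (Q x y * K g)))"
    by (subst sum.swap, subst (2) sum.swap) simp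
  also have "\<dots> = (\<Sum>x\<in>carrier G. \<Sum>y\<in>carrier G. of_bool (f = trim x) * (Q x y * K (trim y)))"
    using finite_corner trim_corner by (intro sum.cong refl) (simp del: corner_simps)
  finally show ?thesis by (simp add: sum_distrib_left)
qed

lemma corner_form: "symmetrizing_form (corner G p) \<chi> corner_Q"
proof -
  interpret C: monoid "corner G p"
    by (rule monoidI) (use p pp in \<open>auto simp: m_assoc, simp_all add: m_assoc[symmetric]\<close>)
  show ?thesis
  proof (unfold_locales, goal_cases)
    case 1
    show ?case by (rule finite_corner)
  next
    case (2 x y)
    then show ?case by (simp add: trace)
  next
    case (3 x y)
    show ?case unfolding corner_Q_def
      by (subst sum.swap) (intro sum.cong refl, simp add: Q_sym)
  next
    case (4 f z)
    then have z: "z \<in> carrier G" "trim z = z" by auto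
    have "(\<Sum>g\<in>carrier (corner G p). corner_Q f g * \<chi> (g \<otimes> z)) =
        (\<Sum>x\<in>carrier G. of_bool (f = trim x) * (\<Sum>y\<in>carrier G. Q x y * \<chi> (y \<otimes> z)))"
      unfolding corner_Q_right
    proof (intro sum.cong refl arg_cong2[of _ _ _ _ "(*)"])
      fix y assume y: "y \<in> carrier G"
      have "\<chi> (trim y \<otimes> z) = \<chi> (p \<otimes> (y \<otimes> (p \<otimes> z)))"
        using y p z by (simp add: m_assoc)
      also have "\<dots> = \<chi> (y \<otimes> z)"
        using y p z 4 by (subst trace) (auto simp: m_assoc)
      finally show "\<chi> (trim y \<otimes> z) = \<chi> (y \<otimes> z)" .
    qed
    also have "\<dots> = (\<Sum>x\<in>carrier G. of_bool (x = z) * of_bool (f = trim x))"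
      by (intro sum.cong refl) (simp add: dual z)
    also have "\<dots> = of_bool (f = z)"
      using z finite_carrier by simp
    finally show ?case by simp
  qed
qed

text \<open>
  On elements of the corner, its Higman trace is that of \<open>G\<close> followed by \<open>x \<mapsto> p x p\<close>.  This lets a
  solution in the corner be used in \<open>G\<close>, where its Higman trace is in addition central.
\<close>
lemma corner_higman:
  assumes "symmetrizing_form (corner G p) \<chi> Q'"
  shows "symmetrizing_form.higman (corner G p) Q' a \<phi> =
    higman (\<lambda>h. of_bool (h \<in> carrier (corner G p)) * a h) (\<lambda>x. \<phi> (trim x))"
proof -
  interpret Q': symmetrizing_form "corner G p" \<chi> Q' by fact
  let ?C = "carrier (corner G p)"
  have "Q'.higman a \<phi> = (\<Sum>f\<in>?C. \<Sum>g\<in>?C. corner_Q f g * (\<Sum>h\<in>?C. a h * \<phi> (f \<otimes> h \<otimes> g)))"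
    unfolding Q'.higman_def by (intro sum.cong refl) (simp add: Q'.Q_unique[OF corner_form] del: corner_simps(3))
  also have "\<dots> = (\<Sum>f\<in>?C. \<Sum>x\<in>carrier G. of_bool (f = trim x) *
      (\<Sum>y\<in>carrier G. Q x y * (\<Sum>h\<in>?C. a h * \<phi> (f \<otimes> h \<otimes> trim y))))"
    by (simp only: corner_Q_right)
  also have "\<dots> = (\<Sum>x\<in>carrier G. \<Sum>f\<in>?C. of_bool (f = trim x) *
      (\<Sum>y\<in>carrier G. Q x y * (\<Sum>h\<in>?C. a h * \<phi> (f \<otimes> h \<otimes> trim y))))"
    by (rule sum.swap)
  also have "\<dots> = (\<Sum>x\<in>carrier G. \<Sum>y\<in>carrier G. Q x y * (\<Sum>h\<in>?C. a h * \<phi> (trim x \<otimes> h \<otimes> trim y)))"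
    by (rule sum.cong[OF refl]) (use finite_corner trim_corner in \<open>simp del: corner_simps(3)\<close>)
  also have "\<dots> = (\<Sum>x\<in>carrier G. \<Sum>y\<in>carrier G. Q x y * (\<Sum>h\<in>?C. a h * \<phi> (trim (x \<otimes> h \<otimes> y))))"
  proof (intro sum.cong refl arg_cong2[of _ _ _ _ "(*)"] arg_cong[of _ _ \<phi>])
    fix x y h assume xy: "x \<in> carrier G" "y \<in> carrier G" and h: "h \<in> ?C"
    have hc: "h \<in> carrier G" using h by simp
    have "h \<otimes> (p \<otimes> z) = h \<otimes> z" "p \<otimes> (h \<otimes> z) = h \<otimes> z" if "z \<in> carrier G" for z
      using h p that m_assoc[of h p z] m_assoc[of p h z] by auto
    then show "trim x \<otimes> h \<otimes> trim y = trim (x \<otimes> h \<otimes> y)"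
      using xy hc p by (simp add: m_assoc)
  qed
  also have "\<dots> = higman (\<lambda>h. of_bool (h \<in> ?C) * a h) (\<lambda>x. \<phi> (trim x))"
    unfolding higman_def
  proof (rule sum.cong[OF refl], rule sum.cong[OF refl], rule arg_cong2[of _ _ _ _ "(*)", OF refl])
    fix x y
    show "(\<Sum>h\<in>?C. a h * \<phi> (trim (x \<otimes> h \<otimes> y))) =
        (\<Sum>h\<in>carrier G. of_bool (h \<in> ?C) * a h * \<phi> (trim (x \<otimes> h \<otimes> y)))"
      by (rule sum.mono_neutral_cong_left) (use finite_carrier in auto)
  qed
  finally show ?thesis .
qed

end

end

text \<open>
  For an algebra with a nondegenerate trace form, separability is equivalent to the solvability of
  this equation (Higman's criterion); the matrix \<open>Q\<close> is determined by \<open>\<chi>\<close>.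
\<close>
definition separable :: "('a, 'b) monoid_scheme \<Rightarrow> ('a \<Rightarrow> rat) \<Rightarrow> bool" where
  "separable G \<chi> \<longleftrightarrow> (\<exists>Q b. symmetrizing_form G \<chi> Q \<and>
    (\<forall>\<phi>. symmetrizing_form.higman G Q b \<phi> = \<phi> \<one>\<^bsub>G\<^esub>))"

text \<open>
  Let \<open>a\<close> be a solution in the corner and \<open>e\<close> its Higman trace in \<open>G\<close>.  Since \<open>e\<close> is central,
  \<open>e u r v = u (r e r) v = u r v\<close>, so \<open>e\<close> is an identity element for the ideal spanned by \<open>G r G\<close>.
\<close>
theorem (in symmetrizing_form) separable_from_corner:
  assumes r: "r \<in> carrier G" and rr: "r \<otimes> r = r"
    and sep: "separable (corner G r) \<chi>"
    and cov: "\<And>x. x \<in> carrier G \<Longrightarrow> x \<in> Units G \<or> (\<exists>u\<in>carrier G. \<exists>v\<in>carrier G. x = u \<otimes> r \<otimes> v)"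
  shows "separable G \<chi>"
proof -
  obtain Q' a where Q': "symmetrizing_form (corner G r) \<chi> Q'"
    and a: "\<And>\<phi>. symmetrizing_form.higman (corner G r) Q' a \<phi> = \<phi> r"
    using sep by (auto simp: separable_def)
  define a' where "a' h = of_bool (h \<in> carrier (corner G r)) * a h" for h
  have a': "higman a' (\<lambda>x. \<phi> (r \<otimes> x \<otimes> r)) = \<phi> r" for \<phi>
    using corner_higman[OF r rr Q', of a \<phi>] a by (simp add: a'_def[abs_def] del: corner_simps(3))
  define N where "N = {u \<otimes> r \<otimes> v | u v. u \<in> carrier G \<and> v \<in> carrier G}"
  have "\<exists>b. \<forall>\<phi>. higman b \<phi> = \<phi> \<one>"
  proof (rule separable_step[of N a'])
    show "N \<subseteq> carrier G" using r by (auto simp: N_def)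
    show "x \<otimes> s \<in> N" if x: "x \<in> carrier G" and s: "s \<in> N" for x s
    proof -
      obtain u v where "u \<in> carrier G" "v \<in> carrier G" "s = u \<otimes> r \<otimes> v" using s by (auto simp: N_def)
      then show ?thesis using x r unfolding N_def
        by (intro CollectI exI[of _ "x \<otimes> u"] exI[of _ v]) (simp add: m_assoc)
    qed
    show "s \<otimes> x \<in> N" if x: "x \<in> carrier G" and s: "s \<in> N" for x s
    proof -
      obtain u v where "u \<in> carrier G" "v \<in> carrier G" "s = u \<otimes> r \<otimes> v" using s by (auto simp: N_def)
      then show ?thesis using x r unfolding N_def
        by (intro CollectI exI[of _ u] exI[of _ "v \<otimes> x"]) (simp add: m_assoc)
    qed
    show "carrier G \<subseteq> Units G \<union> N" using cov unfolding N_def by blast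
    show "higman a' (\<lambda>x. \<phi> (x \<otimes> s)) = \<phi> s" if s: "s \<in> N" for s \<phi>
    proof -
      obtain u v where u: "u \<in> carrier G" and v: "v \<in> carrier G" and s: "s = u \<otimes> r \<otimes> v"
        using s by (auto simp: N_def)
      have sr: "s = u \<otimes> r \<otimes> (r \<otimes> v)"
        using u v r rr by (simp add: s m_assoc) (simp add: m_assoc[symmetric])
      have "higman a' (\<lambda>x. \<phi> (x \<otimes> s)) = higman a' (\<lambda>x. (\<lambda>z. \<phi> (z \<otimes> (r \<otimes> v))) (x \<otimes> (u \<otimes> r)))"
        using u v r by (intro higman_cong) (simp add: sr m_assoc)
      also have "\<dots> = higman a' (\<lambda>x. (\<lambda>z. \<phi> (z \<otimes> (r \<otimes> v))) (u \<otimes> r \<otimes> x))"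
        by (rule higman_central) (use u r in simp)
      also have "\<dots> = higman a' (\<lambda>x. (\<lambda>z. \<phi> (u \<otimes> z \<otimes> v)) (r \<otimes> x \<otimes> r))"
        using u v r by (intro higman_cong) (simp add: m_assoc)
      also have "\<dots> = \<phi> s" by (subst a') (simp add: s)
      finally show ?thesis .
    qed
    show "higman a' \<phi> = 0" if \<phi>: "\<And>s. s \<in> N \<Longrightarrow> \<phi> s = 0" for \<phi>
      unfolding higman_def
    proof (intro sum.neutral ballI)
      fix f g assume f: "f \<in> carrier G" and g: "g \<in> carrier G"
      have "a' h * \<phi> (f \<otimes> h \<otimes> g) = 0" if h: "h \<in> carrier G" for h
      proof (cases "h \<in> carrier (corner G r)")
        case True
        then have "f \<otimes> h \<otimes> g = f \<otimes> r \<otimes> (h \<otimes> g)"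
          using f g r h by (metis corner_simps(3) m_assoc m_closed)
        then have "f \<otimes> h \<otimes> g \<in> N" using f g h unfolding N_def by (intro CollectI exI[of _ f] exI[of _ "h \<otimes> g"]) simp
        then show ?thesis using \<phi> by simp
      qed (simp add: a'_def)
      then show "Q f g * (\<Sum>h\<in>carrier G. a' h * \<phi> (f \<otimes> h \<otimes> g)) = 0" by (simp add: sum.neutral)
    qed
  qed
  then show ?thesis unfolding separable_def using symmetrizing_form_axioms by blast
qed

text \<open>
  Maschke's theorem.
\<close>
theorem (in symmetrizing_form) separable_group:
  assumes "carrier G \<subseteq> Units G"
  shows "separable G \<chi>"
proof -
  have "\<exists>b. \<forall>\<phi>. higman b \<phi> = \<phi> \<one>"
    by (rule separable_step[of "{}" "\<lambda>_. 0"]) (use assms in \<open>auto simp: higman_def\<close>)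
  then show ?thesis unfolding separable_def using symmetrizing_form_axioms by blast
qed

section \<open>Endomorphisms of a space with coordinates\<close>

definition End :: "('f, 'm) ring_scheme \<Rightarrow> ('f, 'v, 'z) module_scheme \<Rightarrow> ('v \<Rightarrow> 'v) monoid" where
  "End F W = \<lparr>carrier = module_hom F W W \<inter> extensional (carrier W),
     mult = compose (carrier W), one = (\<lambda>x\<in>carrier W. x)\<rparr>"

lemma (in module) End_monoid: "monoid (End R M)"
proof (rule monoidI; unfold End_def; simp)
  fix x y z assume x: "x \<in> module_hom R M M \<and> x \<in> extensional (carrier M)"
    and y: "y \<in> module_hom R M M \<and> y \<in> extensional (carrier M)"
    and z: "z \<in> module_hom R M M \<and> z \<in> extensional (carrier M)"
  show "compose (carrier M) x y \<in> module_hom R M M"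
    using x y by (auto simp: module_hom_def compose_def Pi_def)
  show "compose (carrier M) (compose (carrier M) x y) z = compose (carrier M) x (compose (carrier M) y z)"
    using z by (intro compose_assoc[symmetric]) (auto simp: module_hom_def)
  show "compose (carrier M) (\<lambda>x\<in>carrier M. x) x = x" "compose (carrier M) x (\<lambda>x\<in>carrier M. x) = x"
    using x by (auto simp: module_hom_def compose_def extensional_def fun_eq_iff Pi_def)
next
  show "(\<lambda>x\<in>carrier M. x) \<in> module_hom R M M" by (auto simp: module_hom_def)
qed

lemma (in abelian_monoid) finsum_swap:
  assumes "finite A" "finite B" and c: "\<And>a b. a \<in> A \<Longrightarrow> b \<in> B \<Longrightarrow> f a b \<in> carrier G"
  shows "(\<Oplus>a\<in>A. \<Oplus>b\<in>B. f a b) = (\<Oplus>b\<in>B. \<Oplus>a\<in>A. f a b)"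
  using assms(1) c
proof (induction A rule: finite_induct)
  case empty
  then show ?case using assms(2) by (simp add: finsum_zero)
next
  case (insert x A)
  have "(\<Oplus>b\<in>B. \<Oplus>a\<in>insert x A. f a b) = (\<Oplus>b\<in>B. f x b \<oplus> (\<Oplus>a\<in>A. f a b))"
    using insert by (intro finsum_cong') (auto intro!: finsum_insert)
  also have "\<dots> = (\<Oplus>b\<in>B. f x b) \<oplus> (\<Oplus>b\<in>B. \<Oplus>a\<in>A. f a b)"
    using insert.prems by (intro finsum_addf) (auto intro!: finsum_closed)
  finally show ?case
    using insert by (subst finsum_insert) (auto intro!: finsum_closed)
qed

lemma (in module) coordinate_map_hom:
  assumes V: "module R V" and B: "finite B"
    and \<phi>: "\<And>b x. b \<in> B \<Longrightarrow> x \<in> carrier V \<Longrightarrow> \<phi> b x \<in> carrier R"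
    and \<phi>_add: "\<And>b x y. b \<in> B \<Longrightarrow> x \<in> carrier V \<Longrightarrow> y \<in> carrier V \<Longrightarrow> \<phi> b (x \<oplus>\<^bsub>V\<^esub> y) = \<phi> b x \<oplus>\<^bsub>R\<^esub> \<phi> b y"
    and \<phi>_smult: "\<And>b r x. b \<in> B \<Longrightarrow> r \<in> carrier R \<Longrightarrow> x \<in> carrier V \<Longrightarrow> \<phi> b (r \<odot>\<^bsub>V\<^esub> x) = r \<otimes>\<^bsub>R\<^esub> \<phi> b x"
    and g: "\<And>b. b \<in> B \<Longrightarrow> g b \<in> carrier M"
  shows "(\<lambda>x\<in>carrier V. \<Oplus>\<^bsub>M\<^esub>b\<in>B. \<phi> b x \<odot>\<^bsub>M\<^esub> g b) \<in> module_hom R V M"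
proof -
  interpret V: module R V by fact
  let ?f = "\<lambda>x. \<Oplus>\<^bsub>M\<^esub>b\<in>B. \<phi> b x \<odot>\<^bsub>M\<^esub> g b"
  have cl: "?f x \<in> carrier M" if "x \<in> carrier V" for x
    using \<phi> g that by (intro M.finsum_closed) auto
  have add: "?f (x \<oplus>\<^bsub>V\<^esub> y) = ?f x \<oplus>\<^bsub>M\<^esub> ?f y" if x: "x \<in> carrier V" and y: "y \<in> carrier V" for x y
  proof -
    have "?f (x \<oplus>\<^bsub>V\<^esub> y) = (\<Oplus>\<^bsub>M\<^esub>b\<in>B. \<phi> b x \<odot>\<^bsub>M\<^esub> g b \<oplus>\<^bsub>M\<^esub> \<phi> b y \<odot>\<^bsub>M\<^esub> g b)"
      using x y \<phi> g by (intro M.finsum_cong') (auto simp: \<phi>_add smult_l_distr)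
    also have "\<dots> = ?f x \<oplus>\<^bsub>M\<^esub> ?f y"
      using x y \<phi> g by (intro M.finsum_addf) auto
    finally show ?thesis .
  qed
  have smult: "?f (r \<odot>\<^bsub>V\<^esub> x) = r \<odot>\<^bsub>M\<^esub> ?f x" if r: "r \<in> carrier R" and x: "x \<in> carrier V" for r x
  proof -
    have "?f (r \<odot>\<^bsub>V\<^esub> x) = (\<Oplus>\<^bsub>M\<^esub>b\<in>B. r \<odot>\<^bsub>M\<^esub> (\<phi> b x \<odot>\<^bsub>M\<^esub> g b))"
      using x r \<phi> g by (intro M.finsum_cong') (auto simp: \<phi>_smult smult_assoc1)
    also have "\<dots> = r \<odot>\<^bsub>M\<^esub> ?f x"
      using x r \<phi> g B by (intro finsum_smult_ldistr[symmetric]) auto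
    finally show ?thesis .
  qed
  show ?thesis unfolding module_hom_def using cl add smult by simp
qed

lemma (in module) functional_finsum:
  assumes A: "finite A"
    and \<phi>: "\<And>x. x \<in> carrier M \<Longrightarrow> \<phi> x \<in> carrier R"
    and \<phi>_add: "\<And>x y. x \<in> carrier M \<Longrightarrow> y \<in> carrier M \<Longrightarrow> \<phi> (x \<oplus>\<^bsub>M\<^esub> y) = \<phi> x \<oplus>\<^bsub>R\<^esub> \<phi> y"
    and \<phi>_smult: "\<And>r x. r \<in> carrier R \<Longrightarrow> x \<in> carrier M \<Longrightarrow> \<phi> (r \<odot>\<^bsub>M\<^esub> x) = r \<otimes>\<^bsub>R\<^esub> \<phi> x"
    and c: "\<And>b. b \<in> A \<Longrightarrow> c b \<in> carrier R" and g: "\<And>b. b \<in> A \<Longrightarrow> g b \<in> carrier M"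
  shows "\<phi> (\<Oplus>\<^bsub>M\<^esub>b\<in>A. c b \<odot>\<^bsub>M\<^esub> g b) = (\<Oplus>\<^bsub>R\<^esub>b\<in>A. c b \<otimes>\<^bsub>R\<^esub> \<phi> (g b))"
  using A c g
proof (induction A rule: finite_induct)
  case empty
  have "\<phi> (\<zero>\<^bsub>R\<^esub> \<odot>\<^bsub>M\<^esub> \<zero>\<^bsub>M\<^esub>) = \<zero>\<^bsub>R\<^esub> \<otimes>\<^bsub>R\<^esub> \<phi> \<zero>\<^bsub>M\<^esub>" by (rule \<phi>_smult) auto
  then show ?case using \<phi> by simp
next
  case (insert a A)
  have cl: "(\<Oplus>\<^bsub>M\<^esub>b\<in>A. c b \<odot>\<^bsub>M\<^esub> g b) \<in> carrier M"
    using insert.prems by (intro M.finsum_closed) auto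
  have "(\<Oplus>\<^bsub>M\<^esub>b\<in>insert a A. c b \<odot>\<^bsub>M\<^esub> g b) = c a \<odot>\<^bsub>M\<^esub> g a \<oplus>\<^bsub>M\<^esub> (\<Oplus>\<^bsub>M\<^esub>b\<in>A. c b \<odot>\<^bsub>M\<^esub> g b)"
    using insert by (intro M.finsum_insert) auto
  moreover have "(\<Oplus>\<^bsub>R\<^esub>b\<in>insert a A. c b \<otimes>\<^bsub>R\<^esub> \<phi> (g b)) = c a \<otimes>\<^bsub>R\<^esub> \<phi> (g a) \<oplus>\<^bsub>R\<^esub> (\<Oplus>\<^bsub>R\<^esub>b\<in>A. c b \<otimes>\<^bsub>R\<^esub> \<phi> (g b))"
    using insert \<phi> by (intro R.finsum_insert) auto
  moreover have "\<phi> (\<Oplus>\<^bsub>M\<^esub>b\<in>A. c b \<odot>\<^bsub>M\<^esub> g b) = (\<Oplus>\<^bsub>R\<^esub>b\<in>A. c b \<otimes>\<^bsub>R\<^esub> \<phi> (g b))"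
    using insert by simp
  ultimately show ?case using cl insert.prems by (simp add: \<phi>_add \<phi>_smult)
qed

text \<open>
  The coefficient of \<open>x\<close> at the basis vector \<open>b\<close> is \<open>\<xi> b x\<close>.
\<close>
locale coordinates = vectorspace F W for F :: "('f, 'm) ring_scheme" and W :: "('f, 'v, 'z) module_scheme" +
  fixes B :: "'v set" and \<xi> :: "'v \<Rightarrow> 'v \<Rightarrow> 'f"
  assumes finite_field: "finite (carrier F)"
    and finite_B: "finite B" and B_sub: "B \<subseteq> carrier W"
    and \<xi>_closed [simp, intro]: "\<lbrakk>b \<in> B; x \<in> carrier W\<rbrakk> \<Longrightarrow> \<xi> b x \<in> carrier F"
    and \<xi>_add: "\<lbrakk>b \<in> B; x \<in> carrier W; y \<in> carrier W\<rbrakk> \<Longrightarrow> \<xi> b (x \<oplus>\<^bsub>W\<^esub> y) = \<xi> b x \<oplus>\<^bsub>F\<^esub> \<xi> b y"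
    and \<xi>_smult: "\<lbrakk>b \<in> B; r \<in> carrier F; x \<in> carrier W\<rbrakk> \<Longrightarrow> \<xi> b (r \<odot>\<^bsub>W\<^esub> x) = r \<otimes>\<^bsub>F\<^esub> \<xi> b x"
    and \<xi>_delta: "\<lbrakk>b \<in> B; c \<in> B\<rbrakk> \<Longrightarrow> \<xi> b c = (if b = c then \<one>\<^bsub>F\<^esub> else \<zero>\<^bsub>F\<^esub>)"
    and expand: "x \<in> carrier W \<Longrightarrow> x = (\<Oplus>\<^bsub>W\<^esub>b\<in>B. \<xi> b x \<odot>\<^bsub>W\<^esub> b)"

lemma (in vectorspace) coordinates_exist:
  assumes "fin_dim" and fin: "finite (carrier K)"
  shows "\<exists>B \<xi>. coordinates K V B \<xi>"
proof -
  obtain B where finB: "finite B" and basis: "basis B"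
    using finite_basis_exists[OF assms(1)] by blast
  have BV: "B \<subseteq> carrier V" using basis by (simp add: basis_def)
  then have ex1: "\<exists>!a. a \<in> B \<rightarrow>\<^sub>E carrier K \<and> lincomb a B = v" if "v \<in> carrier V" for v
    using basis_criterion[OF finB] basis that by blast
  define co where "co v = (THE a. a \<in> B \<rightarrow>\<^sub>E carrier K \<and> lincomb a B = v)" for v
  have co: "co v \<in> B \<rightarrow>\<^sub>E carrier K" "lincomb (co v) B = v" if "v \<in> carrier V" for v
    using theI'[OF ex1[OF that]] by (simp_all add: co_def)
  have coI: "co v b = a b" if "b \<in> B" "a \<in> B \<rightarrow> carrier K" "lincomb a B = v" for a v b
  proof -
    have v: "v \<in> carrier V" using that BV by blast
    have "lincomb (restrict a B) B = lincomb a B"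
      by (rule lincomb_cong) (use that BV in auto)
    then have "restrict a B \<in> B \<rightarrow>\<^sub>E carrier K \<and> lincomb (restrict a B) B = v"
      using that by auto
    then have "co v = restrict a B"
      unfolding co_def by (rule the1_equality[OF ex1[OF v]])
    then show ?thesis using that by simp
  qed
  have "coordinates K V B (\<lambda>b v. co v b)"
  proof (unfold_locales)
    show "finite (carrier K)" "finite B" "B \<subseteq> carrier V" by fact+
  next
    fix b x assume "b \<in> B" "x \<in> carrier V"
    then show "co x b \<in> carrier K" using co by blast
  next
    fix b x y assume b: "b \<in> B" and x: "x \<in> carrier V" and y: "y \<in> carrier V"
    have cl: "co x \<in> B \<rightarrow> carrier K" "co y \<in> B \<rightarrow> carrier K" using co x y by blast+
    show "co (x \<oplus>\<^bsub>V\<^esub> y) b = co x b \<oplus>\<^bsub>K\<^esub> co y b"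
      by (rule coI[of b "\<lambda>d. co x d \<oplus>\<^bsub>K\<^esub> co y d"])
        (use cl finB BV co[OF x] co[OF y] b in \<open>auto simp: lincomb_sum\<close>)
  next
    fix b c x assume b: "b \<in> B" and c: "c \<in> carrier K" and x: "x \<in> carrier V"
    have cl: "co x \<in> B \<rightarrow> carrier K" using co x by blast
    show "co (c \<odot>\<^bsub>V\<^esub> x) b = c \<otimes>\<^bsub>K\<^esub> co x b"
      by (rule coI[of b "\<lambda>d. c \<otimes>\<^bsub>K\<^esub> co x d"])
        (use cl BV co[OF x] b c in \<open>auto simp: lincomb_smult\<close>)
  next
    fix b c assume b: "b \<in> B" and c: "c \<in> B"
    let ?\<delta> = "\<lambda>d. if d = c then \<one>\<^bsub>K\<^esub> else \<zero>\<^bsub>K\<^esub>"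
    have "lincomb ?\<delta> B = (\<Oplus>\<^bsub>V\<^esub>d\<in>B. if c = d then d else \<zero>\<^bsub>V\<^esub>)"
      unfolding lincomb_def using BV by (intro finsum_cong') auto
    also have "\<dots> = c" using BV c finB by (intro finsum_singleton) auto
    finally have lc: "lincomb ?\<delta> B = c" .
    show "co c b = (if b = c then \<one>\<^bsub>K\<^esub> else \<zero>\<^bsub>K\<^esub>)"
      by (rule coI[of b "?\<delta>"]) (use b in simp, simp add: Pi_def, rule lc)
  next
    fix x assume "x \<in> carrier V"
    then show "x = (\<Oplus>\<^bsub>V\<^esub>b\<in>B. co x b \<odot>\<^bsub>V\<^esub> b)" using co(2)[of x] by (simp add: lincomb_def)
  qed
  then show ?thesis by blast
qed

context coordinates
begin

abbreviation "M \<equiv> carrier (End F W)"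

abbreviation comp (infixl "\<bullet>" 70) where "f \<bullet> g \<equiv> f \<otimes>\<^bsub>End F W\<^esub> g"

lemma End_iff: "f \<in> M \<longleftrightarrow> f \<in> module_hom F W W \<and> f \<in> extensional (carrier W)"
  by (simp add: End_def)

lemma End_closed [simp, intro]: "f \<in> M \<Longrightarrow> x \<in> carrier W \<Longrightarrow> f x \<in> carrier W"
  unfolding End_iff by (blast dest: module_hom_closed)

lemma End_add: "f \<in> M \<Longrightarrow> x \<in> carrier W \<Longrightarrow> y \<in> carrier W \<Longrightarrow> f (x \<oplus>\<^bsub>W\<^esub> y) = f x \<oplus>\<^bsub>W\<^esub> f y"
  unfolding End_iff by (blast intro: module_hom_add)

lemma End_smult: "f \<in> M \<Longrightarrow> r \<in> carrier F \<Longrightarrow> x \<in> carrier W \<Longrightarrow> f (r \<odot>\<^bsub>W\<^esub> x) = r \<odot>\<^bsub>W\<^esub> f x"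
  unfolding End_iff by (blast intro: module_hom_smult)

lemma End_eqI: "f \<in> M \<Longrightarrow> g \<in> M \<Longrightarrow> (\<And>x. x \<in> carrier W \<Longrightarrow> f x = g x) \<Longrightarrow> f = g"
  by (rule extensionalityI[of _ "carrier W"]) (simp_all add: End_iff)

lemma End_mult [simp]: "x \<in> carrier W \<Longrightarrow> (f \<bullet> g) x = f (g x)"
  by (simp add: End_def compose_def)

lemma End_one [simp]: "x \<in> carrier W \<Longrightarrow> \<one>\<^bsub>End F W\<^esub> x = x"
  by (simp add: End_def)

lemma End_I:
  assumes "\<And>x. x \<in> carrier W \<Longrightarrow> f x \<in> carrier W"
    and "\<And>x y. x \<in> carrier W \<Longrightarrow> y \<in> carrier W \<Longrightarrow> f (x \<oplus>\<^bsub>W\<^esub> y) = f x \<oplus>\<^bsub>W\<^esub> f y"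
    and "\<And>c x. c \<in> carrier F \<Longrightarrow> x \<in> carrier W \<Longrightarrow> f (c \<odot>\<^bsub>W\<^esub> x) = c \<odot>\<^bsub>W\<^esub> f x"
  shows "restrict f (carrier W) \<in> M"
  using assms unfolding End_iff module_hom_def by simp

sublocale E: monoid "End F W" by (rule End_monoid)

lemma B_closed [simp, intro]: "b \<in> B \<Longrightarrow> b \<in> carrier W"
  using B_sub by blast

lemma finite_W: "finite (carrier W)"
proof (rule finite_subset)
  show "carrier W \<subseteq> (\<lambda>a. \<Oplus>\<^bsub>W\<^esub>b\<in>B. a b \<odot>\<^bsub>W\<^esub> b) ` (B \<rightarrow>\<^sub>E carrier F)"
  proof
    fix x assume x: "x \<in> carrier W"
    have "x = (\<Oplus>\<^bsub>W\<^esub>b\<in>B. restrict (\<lambda>b. \<xi> b x) B b \<odot>\<^bsub>W\<^esub> b)"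
      using x by (subst expand[OF x], intro finsum_cong') auto
    then show "x \<in> (\<lambda>a. \<Oplus>\<^bsub>W\<^esub>b\<in>B. a b \<odot>\<^bsub>W\<^esub> b) ` (B \<rightarrow>\<^sub>E carrier F)"
      using x by (intro image_eqI) auto
  qed
  show "finite ((\<lambda>a. \<Oplus>\<^bsub>W\<^esub>b\<in>B. a b \<odot>\<^bsub>W\<^esub> b) ` (B \<rightarrow>\<^sub>E carrier F))"
    using finite_B finite_field by (intro finite_imageI finite_PiE) auto
qed

lemma finite_M: "finite M"
proof (rule finite_subset)
  show "M \<subseteq> carrier W \<rightarrow>\<^sub>E carrier W" by (auto simp: PiE_def End_iff dest: module_hom_closed)
qed (intro finite_PiE finite_W)

lemma \<xi>_zero: "b \<in> B \<Longrightarrow> \<xi> b \<zero>\<^bsub>W\<^esub> = \<zero>\<^bsub>F\<^esub>"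
  using \<xi>_smult[of b "\<zero>\<^bsub>F\<^esub>" "\<zero>\<^bsub>W\<^esub>"] by simp

lemma End_zero: "f \<in> M \<Longrightarrow> f \<zero>\<^bsub>W\<^esub> = \<zero>\<^bsub>W\<^esub>"
  using End_smult[of f "\<zero>\<^bsub>F\<^esub>" "\<zero>\<^bsub>W\<^esub>"] by simp

lemma End_expand:
  assumes f: "f \<in> M" and x: "x \<in> carrier W"
  shows "f x = (\<Oplus>\<^bsub>W\<^esub>b\<in>B. \<xi> b x \<odot>\<^bsub>W\<^esub> f b)"
proof -
  have "f (\<Oplus>\<^bsub>W\<^esub>b\<in>A. \<xi> b x \<odot>\<^bsub>W\<^esub> b) = (\<Oplus>\<^bsub>W\<^esub>b\<in>A. \<xi> b x \<odot>\<^bsub>W\<^esub> f b)" if "A \<subseteq> B" for A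
    using finite_subset[OF that finite_B] that
  proof (induction A rule: finite_induct)
    case (insert a A)
    then show ?case
      using f x by (subst (1 2) finsum_insert) (auto simp: End_add End_smult subset_iff intro!: finsum_closed)
  qed (simp add: End_zero f)
  from this[OF subset_refl] show ?thesis by (simp only: expand[OF x, symmetric])
qed

lemma \<xi>_End_expand:
  assumes f: "f \<in> M" and x: "x \<in> carrier W" and d: "d \<in> B"
  shows "\<xi> d (f x) = (\<Oplus>\<^bsub>F\<^esub>b\<in>B. \<xi> b x \<otimes>\<^bsub>F\<^esub> \<xi> d (f b))"
  unfolding End_expand[OF f x]
  by (rule functional_finsum[OF finite_B]) (use f x d in \<open>auto simp: \<xi>_add \<xi>_smult\<close>)

lemma End_eqI_basis:
  assumes "f \<in> M" "g \<in> M" "\<And>b. b \<in> B \<Longrightarrow> f b = g b"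
  shows "f = g"
proof (rule End_eqI[OF assms(1,2)])
  fix x assume x: "x \<in> carrier W"
  have "(\<Oplus>\<^bsub>W\<^esub>b\<in>B. \<xi> b x \<odot>\<^bsub>W\<^esub> f b) = (\<Oplus>\<^bsub>W\<^esub>b\<in>B. \<xi> b x \<odot>\<^bsub>W\<^esub> g b)"
    by (rule M.finsum_cong') (use assms x in auto)
  then show "f x = g x" by (simp only: End_expand[OF assms(1) x] End_expand[OF assms(2) x])
qed

definition lin :: "('v \<Rightarrow> 'v) \<Rightarrow> 'v \<Rightarrow> 'v" where
  "lin g = (\<lambda>x\<in>carrier W. \<Oplus>\<^bsub>W\<^esub>b\<in>B. \<xi> b x \<odot>\<^bsub>W\<^esub> g b)"

lemma lin_closed [simp, intro]:
  assumes g: "\<And>b. b \<in> B \<Longrightarrow> g b \<in> carrier W"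
  shows "lin g \<in> M"
  unfolding End_iff lin_def
  by (intro conjI coordinate_map_hom module_axioms finite_B restrict_extensional)
    (use g in \<open>auto simp: \<xi>_add \<xi>_smult\<close>)

lemma lin_basis [simp]:
  assumes g: "\<And>b. b \<in> B \<Longrightarrow> g b \<in> carrier W" and b: "b \<in> B"
  shows "lin g b = g b"
proof -
  have "lin g b = (\<Oplus>\<^bsub>W\<^esub>d\<in>B. if b = d then g d else \<zero>\<^bsub>W\<^esub>)"
    unfolding lin_def using b g by (auto intro!: M.finsum_cong' simp: \<xi>_delta)
  also have "\<dots> = g b" using b g finite_B by (intro M.finsum_singleton) auto
  finally show ?thesis .
qed


section \<open>The trace form over a finite field\<close>

definition tr :: "('v \<Rightarrow> 'v) \<Rightarrow> 'f" where
  "tr f = (\<Oplus>\<^bsub>F\<^esub>b\<in>B. \<xi> b (f b))"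

lemma tr_closed [simp]: "f \<in> M \<Longrightarrow> tr f \<in> carrier F"
  unfolding tr_def by (rule R.finsum_closed) auto

lemma tr_mult_expand:
  assumes f: "f \<in> M" and g: "g \<in> M"
  shows "tr (f \<bullet> g) = (\<Oplus>\<^bsub>F\<^esub>b\<in>B. \<Oplus>\<^bsub>F\<^esub>c\<in>B. \<xi> c (g b) \<otimes>\<^bsub>F\<^esub> \<xi> b (f c))"
  unfolding tr_def
proof (rule R.finsum_cong')
  fix b assume b: "b \<in> B"
  then show "\<xi> b ((f \<bullet> g) b) = (\<Oplus>\<^bsub>F\<^esub>c\<in>B. \<xi> c (g b) \<otimes>\<^bsub>F\<^esub> \<xi> b (f c))"
    using \<xi>_End_expand[OF f _ b, of "g b"] g by simp
qed (use f g in \<open>auto intro!: R.finsum_closed\<close>)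

lemma tr_commute:
  assumes f: "f \<in> M" and g: "g \<in> M"
  shows "tr (f \<bullet> g) = tr (g \<bullet> f)"
proof -
  have "tr (f \<bullet> g) = (\<Oplus>\<^bsub>F\<^esub>c\<in>B. \<Oplus>\<^bsub>F\<^esub>b\<in>B. \<xi> c (g b) \<otimes>\<^bsub>F\<^esub> \<xi> b (f c))"
    unfolding tr_mult_expand[OF f g] using f g finite_B by (intro R.finsum_swap) auto
  also have "\<dots> = tr (g \<bullet> f)"
    unfolding tr_mult_expand[OF g f]
    using f g by (intro R.finsum_cong' refl) (auto intro!: R.finsum_closed simp: R.m_comm)
  finally show ?thesis .
qed

text \<open>
  Translation by \<open>r t\<close> in the vector space of endomorphisms.
\<close>
definition shift :: "'f \<Rightarrow> ('v \<Rightarrow> 'v) \<Rightarrow> ('v \<Rightarrow> 'v) \<Rightarrow> 'v \<Rightarrow> 'v" where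
  "shift r t g = (\<lambda>x\<in>carrier W. g x \<oplus>\<^bsub>W\<^esub> r \<odot>\<^bsub>W\<^esub> t x)"

lemma shift_closed [simp, intro]:
  assumes "r \<in> carrier F" "t \<in> M" "g \<in> M"
  shows "shift r t g \<in> M"
  unfolding shift_def
proof (rule End_I)
  fix x y assume x: "x \<in> carrier W" and y: "y \<in> carrier W"
  show "g (x \<oplus>\<^bsub>W\<^esub> y) \<oplus>\<^bsub>W\<^esub> r \<odot>\<^bsub>W\<^esub> t (x \<oplus>\<^bsub>W\<^esub> y) =
      g x \<oplus>\<^bsub>W\<^esub> r \<odot>\<^bsub>W\<^esub> t x \<oplus>\<^bsub>W\<^esub> (g y \<oplus>\<^bsub>W\<^esub> r \<odot>\<^bsub>W\<^esub> t y)"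
    using assms x y by (simp add: End_add smult_r_distr M.a_ac)
next
  fix c x assume c: "c \<in> carrier F" and x: "x \<in> carrier W"
  have "r \<odot>\<^bsub>W\<^esub> (c \<odot>\<^bsub>W\<^esub> t x) = c \<odot>\<^bsub>W\<^esub> (r \<odot>\<^bsub>W\<^esub> t x)"
    using assms c x by (simp add: smult_assoc1[symmetric] R.m_comm)
  then show "g (c \<odot>\<^bsub>W\<^esub> x) \<oplus>\<^bsub>W\<^esub> r \<odot>\<^bsub>W\<^esub> t (c \<odot>\<^bsub>W\<^esub> x) = c \<odot>\<^bsub>W\<^esub> (g x \<oplus>\<^bsub>W\<^esub> r \<odot>\<^bsub>W\<^esub> t x)"
    using assms c x by (simp add: End_smult smult_r_distr)
qed (use assms in auto)

lemma tr_shift_right: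
  assumes r: "r \<in> carrier F" and t: "t \<in> M" and g: "g \<in> M" and s: "s \<in> M"
  shows "tr (shift r t g \<bullet> s) =
    tr (g \<bullet> s) \<oplus>\<^bsub>F\<^esub> r \<otimes>\<^bsub>F\<^esub> tr (t \<bullet> s)"
proof -
  have "tr (shift r t g \<bullet> s) =
      (\<Oplus>\<^bsub>F\<^esub>b\<in>B. \<xi> b (g (s b)) \<oplus>\<^bsub>F\<^esub> r \<otimes>\<^bsub>F\<^esub> \<xi> b (t (s b)))"
    unfolding tr_def using assms
    by (intro R.finsum_cong') (auto simp: shift_def \<xi>_add \<xi>_smult)
  also have "\<dots> = (\<Oplus>\<^bsub>F\<^esub>b\<in>B. \<xi> b (g (s b))) \<oplus>\<^bsub>F\<^esub> (\<Oplus>\<^bsub>F\<^esub>b\<in>B. r \<otimes>\<^bsub>F\<^esub> \<xi> b (t (s b)))"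
    using assms by (intro R.finsum_addf) auto
  also have "(\<Oplus>\<^bsub>F\<^esub>b\<in>B. r \<otimes>\<^bsub>F\<^esub> \<xi> b (t (s b))) = r \<otimes>\<^bsub>F\<^esub> (\<Oplus>\<^bsub>F\<^esub>b\<in>B. \<xi> b (t (s b)))"
    using assms finite_B by (intro R.finsum_rdistr[symmetric]) auto
  finally show ?thesis unfolding tr_def using assms by (simp cong: R.finsum_cong)
qed

lemma tr_shift_left:
  assumes "r \<in> carrier F" "t \<in> M" "g \<in> M" "s \<in> M"
  shows "tr (s \<bullet> shift r t g) =
    tr (s \<bullet> g) \<oplus>\<^bsub>F\<^esub> r \<otimes>\<^bsub>F\<^esub> tr (s \<bullet> t)"
  using tr_shift_right[OF assms] assms by (simp add: tr_commute[of s])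

definition zero_map :: "'v \<Rightarrow> 'v" where "zero_map = (\<lambda>x\<in>carrier W. \<zero>\<^bsub>W\<^esub>)"

lemma zero_map_apply [simp]: "x \<in> carrier W \<Longrightarrow> zero_map x = \<zero>\<^bsub>W\<^esub>"
  by (simp add: zero_map_def)

lemma zero_map_closed [simp, intro]: "zero_map \<in> M"
  unfolding zero_map_def by (rule End_I) auto

lemma tr_zero_map [simp]: "tr zero_map = \<zero>\<^bsub>F\<^esub>"
proof -
  have "tr zero_map = (\<Oplus>\<^bsub>F\<^esub>b\<in>B. \<zero>\<^bsub>F\<^esub>)"
    unfolding tr_def by (rule R.finsum_cong') (auto simp: zero_map_def \<xi>_zero)
  then show ?thesis by simp
qed

lemma tr_nondegenerate:
  assumes s: "s \<in> M" and "s \<noteq> zero_map"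
  shows "\<exists>t\<in>M. tr (t \<bullet> s) = \<one>\<^bsub>F\<^esub>"
proof -
  obtain c where c: "c \<in> B" "s c \<noteq> \<zero>\<^bsub>W\<^esub>"
    using End_eqI_basis[OF s zero_map_closed] \<open>s \<noteq> zero_map\<close> by (auto simp: zero_map_def)
  have "\<exists>b\<in>B. \<xi> b (s c) \<noteq> \<zero>\<^bsub>F\<^esub>"
  proof (rule ccontr)
    assume "\<not> ?thesis"
    then have "(\<Oplus>\<^bsub>W\<^esub>b\<in>B. \<xi> b (s c) \<odot>\<^bsub>W\<^esub> b) = (\<Oplus>\<^bsub>W\<^esub>b\<in>B. \<zero>\<^bsub>W\<^esub>)"
      by (intro M.finsum_cong') auto
    then show False using expand[of "s c"] c s by simp
  qed
  then obtain b where b: "b \<in> B" "\<xi> b (s c) \<noteq> \<zero>\<^bsub>F\<^esub>" by blast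
  define k where "k = inv\<^bsub>F\<^esub> (\<xi> b (s c))"
  have k: "k \<in> carrier F" "k \<otimes>\<^bsub>F\<^esub> \<xi> b (s c) = \<one>\<^bsub>F\<^esub>"
    using b c s field_Units by (auto simp: k_def)
  define g where "g d = (if d = b then k \<odot>\<^bsub>W\<^esub> c else \<zero>\<^bsub>W\<^esub>)" for d
  have g: "d \<in> B \<Longrightarrow> g d \<in> carrier W" for d using k c by (auto simp: g_def)
  have "tr (s \<bullet> lin g) = (\<Oplus>\<^bsub>F\<^esub>d\<in>B. if b = d then k \<otimes>\<^bsub>F\<^esub> \<xi> d (s c) else \<zero>\<^bsub>F\<^esub>)"
    unfolding tr_def using g s k c
    by (intro R.finsum_cong') (auto simp: g_def End_smult \<xi>_smult End_zero \<xi>_zero)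
  also have "\<dots> = k \<otimes>\<^bsub>F\<^esub> \<xi> b (s c)"
    using finite_B b k c s by (intro R.finsum_singleton) auto
  finally have "tr (s \<bullet> lin g) = \<one>\<^bsub>F\<^esub>" using k by simp
  then show ?thesis using tr_commute[OF s lin_closed[OF g]] lin_closed[OF g] by auto
qed

lemma card_translate:
  assumes r: "r \<in> carrier F" and t: "t \<in> M"
    and PR: "\<And>g. g \<in> M \<Longrightarrow> P g \<longleftrightarrow> R (shift r t g)"
  shows "card {g \<in> M. P g} = card {g \<in> M. R g}"
proof -
  have inj: "inj_on (shift r t) M"
  proof (rule inj_onI)
    fix g h assume g: "g \<in> M" and h: "h \<in> M" and e: "shift r t g = shift r t h"
    show "g = h"
    proof (rule End_eqI[OF g h])
      fix x assume x: "x \<in> carrier W"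
      have "g x \<oplus>\<^bsub>W\<^esub> r \<odot>\<^bsub>W\<^esub> t x = h x \<oplus>\<^bsub>W\<^esub> r \<odot>\<^bsub>W\<^esub> t x"
        using fun_cong[OF e, of x] x by (simp add: shift_def)
      then show "g x = h x" using g h x r t by (simp add: M.add.right_cancel)
    qed
  qed
  then have surj: "shift r t ` M = M"
    using finite_M r t by (intro endo_inj_surj) auto
  have "shift r t ` {g \<in> M. P g} = {g \<in> M. R g}"
  proof (intro equalityI subsetI)
    fix h assume "h \<in> shift r t ` {g \<in> M. P g}"
    then show "h \<in> {g \<in> M. R g}" using PR r t by blast
  next
    fix h assume h: "h \<in> {g \<in> M. R g}"
    then have "h \<in> shift r t ` M" using surj by blast
    then obtain g where "g \<in> M" "h = shift r t g" by blast
    then show "h \<in> shift r t ` {g \<in> M. P g}" using PR h by blast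
  qed
  then show ?thesis
    using card_image[OF inj_on_subset[OF inj]] by (metis (no_types, lifting) mem_Collect_eq subsetI)
qed

lemma card_level:
  assumes s: "s \<in> M" "s \<noteq> zero_map" and a: "a \<in> carrier F"
  shows "card {g \<in> M. tr (g \<bullet> s) = a} * card (carrier F) = card M"
proof -
  obtain t where t: "t \<in> M" "tr (t \<bullet> s) = \<one>\<^bsub>F\<^esub>"
    using tr_nondegenerate[OF s] by blast
  have level: "card {g \<in> M. tr (g \<bullet> s) = c} = card {g \<in> M. tr (g \<bullet> s) = a}"
    if c: "c \<in> carrier F" for c
  proof (rule card_translate[of "a \<ominus>\<^bsub>F\<^esub> c" t])
    fix g assume g: "g \<in> M"
    let ?z = "tr (g \<bullet> s)"
    have z: "?z \<in> carrier F" using g s by simp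
    have "?z \<oplus>\<^bsub>F\<^esub> (a \<ominus>\<^bsub>F\<^esub> c) = a \<longleftrightarrow> ?z = c"
    proof
      assume e: "?z \<oplus>\<^bsub>F\<^esub> (a \<ominus>\<^bsub>F\<^esub> c) = a"
      have "?z = (?z \<oplus>\<^bsub>F\<^esub> (a \<ominus>\<^bsub>F\<^esub> c)) \<oplus>\<^bsub>F\<^esub> (c \<ominus>\<^bsub>F\<^esub> a)"
        using z a c by algebra
      also have "\<dots> = c" unfolding e using a c by algebra
      finally show "?z = c" .
    next
      assume "?z = c"
      then show "?z \<oplus>\<^bsub>F\<^esub> (a \<ominus>\<^bsub>F\<^esub> c) = a" using a c by simp algebra
    qed
    then show "?z = c \<longleftrightarrow> tr (shift (a \<ominus>\<^bsub>F\<^esub> c) t g \<bullet> s) = a"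
      using g s t a c by (simp add: tr_shift_right)
  qed (use a c t in auto)
  have "card M = (\<Sum>c\<in>carrier F. card {g \<in> M. tr (g \<bullet> s) = c})"
    using sum.group[of M "carrier F" "\<lambda>g. tr (g \<bullet> s)" "\<lambda>_. 1 :: nat"] finite_M finite_field s
    by (auto simp: image_subset_iff)
  also have "\<dots> = card (carrier F) * card {g \<in> M. tr (g \<bullet> s) = a}"
    by (simp add: level)
  finally show ?thesis by simp
qed

text \<open>
  With enough roots of unity, an additive character of the trace would be a form whose matrix is
  inverted by the Fourier transform.  This \<open>\<chi>\<close> and this \<open>Q\<close> do the same with rational values: both are
  functions of the trace whose values over the field sum to \<open>0\<close>, so that in the product of the two
  matrices the contributions of linearly independent pairs cancel.
\<close>
definition \<chi> :: "('v \<Rightarrow> 'v) \<Rightarrow> rat" where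
  "\<chi> f = of_nat (card (carrier F)) * of_bool (tr f = \<one>\<^bsub>F\<^esub>) - 1"

definition Q :: "('v \<Rightarrow> 'v) \<Rightarrow> ('v \<Rightarrow> 'v) \<Rightarrow> rat" where
  "Q f g = (of_bool (tr (g \<bullet> f) = \<one>\<^bsub>F\<^esub>) - of_bool (tr (g \<bullet> f) = \<zero>\<^bsub>F\<^esub>)) / of_nat (card M)"

lemma sum_of_bool_card:
  "(\<Sum>g\<in>M. of_bool (P g) :: rat) = of_nat (card {g \<in> M. P g})"
  using finite_M by (simp add: sum.If_cases Int_def of_bool_def)

text \<open>
  Two linear functionals that are not proportional, here \<open>g \<mapsto> tr (g s)\<close> and \<open>g \<mapsto> tr (g x)\<close>, can be
  given independent values.
\<close>
lemma separating_direction: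
  assumes s: "s \<in> M" "s \<noteq> zero_map" and x: "x \<in> M"
    and nmul: "\<not> (\<exists>l\<in>carrier F. \<forall>g\<in>M. tr (g \<bullet> x) = l \<otimes>\<^bsub>F\<^esub> tr (g \<bullet> s))"
  shows "\<exists>t\<in>M. tr (t \<bullet> s) = \<one>\<^bsub>F\<^esub> \<and> tr (t \<bullet> x) = \<zero>\<^bsub>F\<^esub>"
proof -
  obtain u where u: "u \<in> M" "tr (u \<bullet> s) = \<one>\<^bsub>F\<^esub>"
    using tr_nondegenerate[OF s] by blast
  define l where "l = tr (u \<bullet> x)"
  have l: "l \<in> carrier F" using u x by (simp add: l_def)
  obtain g where g: "g \<in> M" and ne: "tr (g \<bullet> x) \<noteq> l \<otimes>\<^bsub>F\<^esub> tr (g \<bullet> s)"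
    using nmul l by blast
  let ?a = "tr (g \<bullet> s)" and ?b = "tr (g \<bullet> x)"
  have ab: "?a \<in> carrier F" "?b \<in> carrier F" using g s x by auto
  \<comment> \<open>The first functional vanishes at \<open>v\<close>, but the second does not; so a multiple of \<open>v\<close> corrects \<open>u\<close>.\<close>
  define v where "v = shift (\<ominus>\<^bsub>F\<^esub> ?a) u g"
  have v: "v \<in> M" using u g ab by (simp add: v_def)
  have vs: "tr (v \<bullet> s) = \<zero>\<^bsub>F\<^esub>"
    using u g ab s by (simp add: v_def tr_shift_right R.r_neg)
  let ?k = "?b \<ominus>\<^bsub>F\<^esub> l \<otimes>\<^bsub>F\<^esub> ?a"
  have vx: "tr (v \<bullet> x) = ?k"
    using u g ab x l by (simp add: v_def tr_shift_right l_def[symmetric]) algebra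
  have k: "?k \<in> carrier F" "?k \<noteq> \<zero>\<^bsub>F\<^esub>" using ab l ne by auto
  define c where "c = \<ominus>\<^bsub>F\<^esub> (l \<otimes>\<^bsub>F\<^esub> inv\<^bsub>F\<^esub> ?k)"
  have ik: "inv\<^bsub>F\<^esub> ?k \<in> carrier F" "inv\<^bsub>F\<^esub> ?k \<otimes>\<^bsub>F\<^esub> ?k = \<one>\<^bsub>F\<^esub>" using k field_Units by auto
  have c: "c \<in> carrier F" using ik l by (simp add: c_def)
  have ck: "c \<otimes>\<^bsub>F\<^esub> ?k = \<ominus>\<^bsub>F\<^esub> l"
    using ik l k by (simp add: c_def R.l_minus R.m_assoc)
  show ?thesis
  proof (intro bexI[of _ "shift c v u"] conjI)
    show "tr (shift c v u \<bullet> s) = \<one>\<^bsub>F\<^esub>" using u v c s by (simp add: tr_shift_right vs)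
    show "tr (shift c v u \<bullet> x) = \<zero>\<^bsub>F\<^esub>"
      using u v c x l by (simp add: tr_shift_right vx ck l_def[symmetric] R.r_neg)
    show "shift c v u \<in> M" using u v c by simp
  qed
qed


lemma trace_form_determines:
  assumes s: "s \<in> M" and x: "x \<in> M"
    and eq: "\<And>g. g \<in> M \<Longrightarrow> tr (g \<bullet> x) = tr (g \<bullet> s)"
  shows "s = x"
proof -
  let ?d = "shift (\<ominus>\<^bsub>F\<^esub> \<one>\<^bsub>F\<^esub>) s x"
  have d: "?d \<in> M" using s x by simp
  have "tr (t \<bullet> ?d) = \<zero>\<^bsub>F\<^esub>" if t: "t \<in> M" for t
    using t s x by (simp add: tr_shift_left eq R.l_minus R.r_neg)
  then have d0: "?d = zero_map" using tr_nondegenerate[OF d] R.nontrivial_ring by (metis one_not_zero)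
  show ?thesis
  proof (rule End_eqI[OF s x])
    fix v assume v: "v \<in> carrier W"
    then have "x v \<oplus>\<^bsub>W\<^esub> (\<ominus>\<^bsub>F\<^esub> \<one>\<^bsub>F\<^esub>) \<odot>\<^bsub>W\<^esub> s v = \<zero>\<^bsub>W\<^esub>"
      using fun_cong[OF d0, of v] by (simp add: shift_def zero_map_def)
    then have "x v \<ominus>\<^bsub>W\<^esub> s v = \<zero>\<^bsub>W\<^esub>" using s x v by (simp add: smult_minus_1 a_minus_def)
    then show "s v = x v" using s x v by simp
  qed
qed

text \<open>
  Expanding the product leaves the numbers of maps \<open>g\<close> with \<open>tr (g s)\<close> equal to \<open>0\<close> or \<open>1\<close>, with or
  without the condition \<open>tr (g x) = 1\<close>.  Let \<open>s \<noteq> 0\<close>.  All values of \<open>tr (g s)\<close> are equally frequent, so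
  only the two numbers with the condition \<open>tr (g x) = 1\<close> matter.  If \<open>x\<close> is not a multiple of \<open>s\<close>, they
  are equal, by translation along a direction in which \<open>tr (g s)\<close> changes and \<open>tr (g x)\<close> does not.  If
  \<open>x = l s\<close> with \<open>l \<noteq> 1\<close>, both are \<open>0\<close>, since \<open>l\<close> times \<open>0\<close> or \<open>1\<close> is not \<open>1\<close>.
\<close>
lemma \<chi>_Q_dual:
  assumes s: "s \<in> M" and x: "x \<in> M"
  shows "(\<Sum>g\<in>M. Q s g * \<chi> (g \<bullet> x)) = of_bool (s = x)"
proof -
  let ?q = "of_nat (card (carrier F)) :: rat" and ?m = "of_nat (card M) :: rat"
  define n where "n a = card {g \<in> M. tr (g \<bullet> s) = a}" for a
  define n1 where "n1 a = card {g \<in> M. tr (g \<bullet> s) = a \<and> tr (g \<bullet> x) = \<one>\<^bsub>F\<^esub>}" for a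
  have m0: "?m \<noteq> 0" using finite_M zero_map_closed by auto
  have "(\<Sum>g\<in>M. Q s g * \<chi> (g \<bullet> x)) =
      (\<Sum>g\<in>M. (?q * (of_bool (tr (g \<bullet> s) = \<one>\<^bsub>F\<^esub> \<and> tr (g \<bullet> x) = \<one>\<^bsub>F\<^esub>)
         - of_bool (tr (g \<bullet> s) = \<zero>\<^bsub>F\<^esub> \<and> tr (g \<bullet> x) = \<one>\<^bsub>F\<^esub>))
         - of_bool (tr (g \<bullet> s) = \<one>\<^bsub>F\<^esub>) + of_bool (tr (g \<bullet> s) = \<zero>\<^bsub>F\<^esub>)) / ?m)"
    by (intro sum.cong refl) (auto simp: Q_def \<chi>_def field_simps)
  also have "\<dots> = (?q * (of_nat (n1 \<one>\<^bsub>F\<^esub>) - of_nat (n1 \<zero>\<^bsub>F\<^esub>)) - of_nat (n \<one>\<^bsub>F\<^esub>) + of_nat (n \<zero>\<^bsub>F\<^esub>)) / ?m"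
    by (simp only: sum_divide_distrib[symmetric] sum.distrib sum_subtractf sum_distrib_left[symmetric]
        sum_of_bool_card n_def n1_def)
  also have "?q * (of_nat (n1 \<one>\<^bsub>F\<^esub>) - of_nat (n1 \<zero>\<^bsub>F\<^esub>)) - of_nat (n \<one>\<^bsub>F\<^esub>) + of_nat (n \<zero>\<^bsub>F\<^esub>)
      = (of_bool (s = x) * ?m :: rat)"
  proof (cases "s = zero_map")
    case True
    have z: "tr (g \<bullet> s) = \<zero>\<^bsub>F\<^esub>" if "g \<in> M" for g
    proof -
      have "g \<bullet> zero_map = zero_map"
        using that by (intro End_eqI) (auto simp: End_zero)
      then show ?thesis by (simp add: True)
    qed
    have n: "n \<one>\<^bsub>F\<^esub> = 0" "n \<zero>\<^bsub>F\<^esub> = card M" "n1 \<one>\<^bsub>F\<^esub> = 0"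
      "n1 \<zero>\<^bsub>F\<^esub> = card {g \<in> M. tr (g \<bullet> x) = \<one>\<^bsub>F\<^esub>}"
    proof -
      have "{g \<in> M. tr (g \<bullet> s) = \<one>\<^bsub>F\<^esub>} = {}" using z by auto
      moreover from this have "{g \<in> M. tr (g \<bullet> s) = \<one>\<^bsub>F\<^esub> \<and> tr (g \<bullet> x) = \<one>\<^bsub>F\<^esub>} = {}"
        by blast
      ultimately show "n \<one>\<^bsub>F\<^esub> = 0" "n1 \<one>\<^bsub>F\<^esub> = 0" by (simp_all only: n_def n1_def card.empty)
      show "n \<zero>\<^bsub>F\<^esub> = card M" unfolding n_def using z by (intro arg_cong[of _ _ card]) auto
      show "n1 \<zero>\<^bsub>F\<^esub> = card {g \<in> M. tr (g \<bullet> x) = \<one>\<^bsub>F\<^esub>}"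
        unfolding n1_def using z by (intro arg_cong[of _ _ card]) auto
    qed
    show ?thesis
    proof (cases "s = x")
      case True
      then have "n1 \<zero>\<^bsub>F\<^esub> = 0" using n(1,4) by (simp add: n_def)
      then show ?thesis using n True by simp
    next
      case False
      then have "n1 \<zero>\<^bsub>F\<^esub> * card (carrier F) = card M"
        using n(4) card_level[OF x, of "\<one>\<^bsub>F\<^esub>"] True by auto
      then have "?q * of_nat (n1 \<zero>\<^bsub>F\<^esub>) = ?m" by (simp only: of_nat_mult[symmetric] mult.commute)
      then show ?thesis using n False by simp
    qed
  next
    case nz: False
    have q0: "?q \<noteq> 0" using finite_field by auto
    have nq: "of_nat (n a) = ?m / ?q" if "a \<in> carrier F" for a
    proof -
      have "n a * card (carrier F) = card M" unfolding n_def by (rule card_level[OF s nz that])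
      then have "of_nat (n a) * ?q = ?m" by (simp only: of_nat_mult[symmetric])
      then show ?thesis using q0 by (simp add: eq_divide_eq)
    qed
    have "?q * (of_nat (n1 \<one>\<^bsub>F\<^esub>) - of_nat (n1 \<zero>\<^bsub>F\<^esub>)) = (of_bool (s = x) * ?m :: rat)"
    proof (cases "s = x")
      case True
      have "{g \<in> M. tr (g \<bullet> s) = \<zero>\<^bsub>F\<^esub> \<and> tr (g \<bullet> s) = \<one>\<^bsub>F\<^esub>} = {}" by auto
      then have "n1 \<one>\<^bsub>F\<^esub> = n \<one>\<^bsub>F\<^esub>" "n1 \<zero>\<^bsub>F\<^esub> = 0"
        unfolding n1_def n_def True[symmetric] by (simp_all only: conj_absorb card.empty)
      then show ?thesis using True q0 by (simp add: nq)
    next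
      case ne: False
      have "n1 \<one>\<^bsub>F\<^esub> = n1 \<zero>\<^bsub>F\<^esub>"
      proof (cases "\<exists>l\<in>carrier F. \<forall>g\<in>M. tr (g \<bullet> x) = l \<otimes>\<^bsub>F\<^esub> tr (g \<bullet> s)")
        case True
        then obtain l where l: "l \<in> carrier F"
          and lx: "\<And>g. g \<in> M \<Longrightarrow> tr (g \<bullet> x) = l \<otimes>\<^bsub>F\<^esub> tr (g \<bullet> s)" by blast
        have "l \<noteq> \<one>\<^bsub>F\<^esub>" using trace_form_determines[OF s x] lx ne s by auto
        then have "n1 \<one>\<^bsub>F\<^esub> = 0" "n1 \<zero>\<^bsub>F\<^esub> = 0"
          unfolding n1_def using l lx by (auto simp: card_eq_0_iff)
        then show ?thesis by simp
      next
        case False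
        then obtain t where t: "t \<in> M" "tr (t \<bullet> s) = \<one>\<^bsub>F\<^esub>" "tr (t \<bullet> x) = \<zero>\<^bsub>F\<^esub>"
          using separating_direction[OF s nz x] by blast
        have "n1 \<zero>\<^bsub>F\<^esub> = n1 \<one>\<^bsub>F\<^esub>"
          unfolding n1_def
          by (rule card_translate[of "\<one>\<^bsub>F\<^esub>" t]) (use t s x in \<open>auto simp: tr_shift_right\<close>)
        then show ?thesis ..
      qed
      then show ?thesis using ne by simp
    qed
    then show ?thesis by (simp add: nq)
  qed
  finally show ?thesis using m0 by simp
qed

lemma End_symmetrizing: "symmetrizing_form (End F W) \<chi> Q"
proof (unfold_locales, goal_cases)
  case 1
  show ?case by (rule finite_M)
next
  case (2 x y)
  then show ?case by (simp add: \<chi>_def tr_commute[of x])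
next
  case (3 x y)
  then show ?case by (simp add: Q_def tr_commute[of x])
next
  case (4 f x)
  then show ?case by (rule \<chi>_Q_dual)
qed


section \<open>Separability of the endomorphism algebra\<close>

definition proj :: "'v set \<Rightarrow> 'v \<Rightarrow> 'v" where
  "proj S = lin (\<lambda>b. if b \<in> S then b else \<zero>\<^bsub>W\<^esub>)"

lemma proj_closed [simp, intro]: "proj S \<in> M"
  unfolding proj_def by (rule lin_closed) auto

lemma proj_basis: "b \<in> B \<Longrightarrow> proj S b = (if b \<in> S then b else \<zero>\<^bsub>W\<^esub>)"
  unfolding proj_def by (subst lin_basis) auto

lemma proj_mult: "proj S \<bullet> proj T = proj (S \<inter> T)"
  by (rule End_eqI_basis) (auto simp: proj_basis End_zero)

lemma \<xi>_proj:
  assumes x: "x \<in> carrier W" and b: "b \<in> B"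
  shows "\<xi> b (proj S x) = (if b \<in> S then \<xi> b x else \<zero>\<^bsub>F\<^esub>)"
proof -
  have "\<xi> b (proj S x) = (\<Oplus>\<^bsub>F\<^esub>c\<in>B. if b = c then (if c \<in> S then \<xi> c x else \<zero>\<^bsub>F\<^esub>) else \<zero>\<^bsub>F\<^esub>)"
    unfolding \<xi>_End_expand[OF proj_closed x b] using x b
    by (intro R.finsum_cong') (auto simp: proj_basis \<xi>_delta \<xi>_zero)
  also have "\<dots> = (if b \<in> S then \<xi> b x else \<zero>\<^bsub>F\<^esub>)"
    using b x finite_B by (intro R.finsum_singleton) auto
  finally show ?thesis .
qed

lemma fixes_supported:
  assumes f: "f \<in> M" and fixb: "\<And>b. b \<in> S \<Longrightarrow> f b = b" and S: "S \<subseteq> B"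
    and x: "x \<in> carrier W" and supp: "\<And>b. b \<in> B - S \<Longrightarrow> \<xi> b x = \<zero>\<^bsub>F\<^esub>"
  shows "f x = x"
proof -
  have "f x = (\<Oplus>\<^bsub>W\<^esub>b\<in>B. \<xi> b x \<odot>\<^bsub>W\<^esub> b)"
    unfolding End_expand[OF f x]
    using f x fixb supp by (intro M.finsum_cong') (auto, metis DiffI M.r_zero End_closed B_closed lmult_0)
  then show ?thesis using expand[OF x] by simp
qed

abbreviation "corner_at S \<equiv> corner (End F W) (proj S)"

text \<open>
  A map that kills a vector \<open>v\<close> in the span of \<open>insert j S\<close> factors through any hyperplane of that span
  that avoids \<open>v\<close>, in particular through a coordinate hyperplane, and all coordinate hyperplanes are
  exchanged by swaps of basis vectors.
\<close>
lemma noninjective_factors: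
  assumes S: "insert j S \<subseteq> B"
    and x: "x \<in> carrier (corner_at (insert j S))"
    and v: "v \<in> carrier W" "proj (insert j S) v = v" "v \<noteq> \<zero>\<^bsub>W\<^esub>" "x v = \<zero>\<^bsub>W\<^esub>"
  shows "\<exists>u\<in>carrier (corner_at (insert j S)). \<exists>w\<in>carrier (corner_at (insert j S)).
    x = u \<bullet> proj S \<bullet> w"
proof -
  let ?S = "insert j S" and ?p = "proj (insert j S)"
  have xM: "x \<in> M" and px: "?p \<bullet> x = x" and xp: "x \<bullet> ?p = x" using x by auto
  have "\<exists>i\<in>B. \<xi> i v \<noteq> \<zero>\<^bsub>F\<^esub>"
  proof (rule ccontr)
    assume "\<not> ?thesis"
    then have "(\<Oplus>\<^bsub>W\<^esub>b\<in>B. \<xi> b v \<odot>\<^bsub>W\<^esub> b) = (\<Oplus>\<^bsub>W\<^esub>b\<in>B. \<zero>\<^bsub>W\<^esub>)"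
      by (intro M.finsum_cong') auto
    then show False using expand[of v] v by simp
  qed
  then obtain i where i: "i \<in> B" "\<xi> i v \<noteq> \<zero>\<^bsub>F\<^esub>" by blast
  have iS: "i \<in> ?S"
  proof (rule ccontr)
    assume "i \<notin> ?S"
    then have "\<xi> i (?p v) = \<zero>\<^bsub>F\<^esub>" using \<xi>_proj[OF v(1) i(1), of ?S] by simp
    then show False using i v(2) by simp
  qed
  define k where "k = inv\<^bsub>F\<^esub> (\<xi> i v)"
  have k: "k \<in> carrier F" "k \<otimes>\<^bsub>F\<^esub> \<xi> i v = \<one>\<^bsub>F\<^esub>"
    using i v(1) field_Units by (auto simp: k_def)
  \<comment> \<open>The map \<open>\<pi>\<close> projects the span of \<open>insert j S\<close> along \<open>v\<close> onto the hyperplane where coordinate \<open>i\<close> vanishes.\<close>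
  define \<rho> where "\<rho> = lin (\<lambda>b. if b = i then k \<odot>\<^bsub>W\<^esub> v else \<zero>\<^bsub>W\<^esub>)"
  have \<rho>M: "\<rho> \<in> M" unfolding \<rho>_def using k v by (intro lin_closed) auto
  have \<rho>: "\<rho> z = \<xi> i z \<odot>\<^bsub>W\<^esub> (k \<odot>\<^bsub>W\<^esub> v)" if z: "z \<in> carrier W" for z
  proof -
    have "\<rho> z = (\<Oplus>\<^bsub>W\<^esub>b\<in>B. if i = b then \<xi> b z \<odot>\<^bsub>W\<^esub> (k \<odot>\<^bsub>W\<^esub> v) else \<zero>\<^bsub>W\<^esub>)"
      unfolding \<rho>_def lin_def using z k v by (auto intro!: M.finsum_cong')
    also have "\<dots> = \<xi> i z \<odot>\<^bsub>W\<^esub> (k \<odot>\<^bsub>W\<^esub> v)"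
      using i z k v finite_B by (intro M.finsum_singleton) auto
    finally show ?thesis .
  qed
  define \<pi> where "\<pi> = shift (\<ominus>\<^bsub>F\<^esub> \<one>\<^bsub>F\<^esub>) \<rho> ?p"
  have \<pi>M: "\<pi> \<in> M" using \<rho>M by (simp add: \<pi>_def)
  have \<pi>: "\<pi> z = ?p z \<ominus>\<^bsub>W\<^esub> \<xi> i z \<odot>\<^bsub>W\<^esub> (k \<odot>\<^bsub>W\<^esub> v)" if z: "z \<in> carrier W" for z
    using z k v i by (simp add: \<pi>_def shift_def \<rho> smult_minus_1 a_minus_def)
  have pp: "?p (?p z) = ?p z" if "z \<in> carrier W" for z
    using that fun_cong[OF proj_mult[of ?S ?S], of z] by simp
  have x\<pi>: "x (\<pi> z) = x z" if z: "z \<in> carrier W" for z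
  proof -
    have "x (\<pi> z) = x (?p z) \<ominus>\<^bsub>W\<^esub> \<xi> i z \<odot>\<^bsub>W\<^esub> (k \<odot>\<^bsub>W\<^esub> x v)"
      using z k v i xM unfolding \<pi>[OF z] a_minus_def smult_minus_1[symmetric]
      by (subst smult_minus_1[symmetric], simp, subst smult_minus_1[symmetric], simp)
        (simp add: End_add End_smult)
    also have "\<dots> = x z"
      using fun_cong[OF xp, of z] v z k i xM by (simp add: M.minus_eq)
    finally show ?thesis .
  qed
  have \<pi>supp: "\<xi> b (\<pi> z) = \<zero>\<^bsub>F\<^esub>" if z: "z \<in> carrier W" and b: "b \<in> B - (?S - {i})" for z b
  proof -
    have bB: "b \<in> B" using b by simp
    have e: "\<xi> b (\<pi> z) = \<xi> b (?p z) \<oplus>\<^bsub>F\<^esub> (\<ominus>\<^bsub>F\<^esub> \<one>\<^bsub>F\<^esub>) \<otimes>\<^bsub>F\<^esub> (\<xi> i z \<otimes>\<^bsub>F\<^esub> (k \<otimes>\<^bsub>F\<^esub> \<xi> b v))"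
      using z bB k v i \<rho>M by (simp add: \<pi>_def shift_def \<rho> \<xi>_add \<xi>_smult)
    show ?thesis
    proof (cases "b = i")
      case True
      then show ?thesis using e z bB iS k i v by (simp add: \<xi>_proj R.l_minus R.r_neg)
    next
      case False
      then have "b \<notin> ?S" using b by auto
      moreover then have "\<xi> b v = \<zero>\<^bsub>F\<^esub>" using \<xi>_proj[OF v(1) bB, of ?S] v(2) by simp
      ultimately show ?thesis using e z bB k i v by (simp add: \<xi>_proj)
    qed
  qed
  \<comment> \<open>The maps \<open>\<alpha>\<close> and \<open>\<beta>\<close> move this hyperplane onto the span of \<open>S\<close> and back.\<close>
  define \<alpha> where "\<alpha> = lin (\<lambda>b. if b = i then j else if b \<in> ?S then b else \<zero>\<^bsub>W\<^esub>)"
  define \<beta> where "\<beta> = lin (\<lambda>b. if b = j then i else if b \<in> ?S then b else \<zero>\<^bsub>W\<^esub>)"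
  have jB: "j \<in> B" and SB: "S \<subseteq> B" using S by auto
  have \<alpha>b: "\<alpha> b = (if b = i then j else if b \<in> ?S then b else \<zero>\<^bsub>W\<^esub>)"
    and \<beta>b: "\<beta> b = (if b = j then i else if b \<in> ?S then b else \<zero>\<^bsub>W\<^esub>)" if "b \<in> B" for b
    unfolding \<alpha>_def \<beta>_def using that jB i by (subst lin_basis; auto)+
  have \<alpha>M: "\<alpha> \<in> M" and \<beta>M: "\<beta> \<in> M"
    unfolding \<alpha>_def \<beta>_def using jB i by (auto intro!: lin_closed)
  have \<alpha>C: "\<alpha> \<in> carrier (corner_at ?S)"
    unfolding corner_simps
    by (intro conjI \<alpha>M; rule End_eqI_basis)
      (use \<alpha>M iS jB i(1) in \<open>auto simp: \<alpha>b proj_basis End_zero\<close>)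
  have \<beta>C: "\<beta> \<in> carrier (corner_at ?S)"
    unfolding corner_simps
    by (intro conjI \<beta>M; rule End_eqI_basis)
      (use \<beta>M iS jB i(1) in \<open>auto simp: \<beta>b proj_basis End_zero\<close>)
  have \<pi>C: "\<pi> \<in> carrier (corner_at ?S)"
    unfolding corner_simps
  proof (intro conjI \<pi>M; rule End_eqI)
    fix z assume z: "z \<in> carrier W"
    show "(?p \<bullet> \<pi>) z = \<pi> z"
    proof -
      have "?p (\<pi> z) = \<pi> z"
      proof (rule fixes_supported[OF proj_closed _ S])
        show "?p b = b" if "b \<in> ?S" for b using that S proj_basis[of b ?S] by auto
        show "\<pi> z \<in> carrier W" using \<pi>M z by (rule End_closed)
        show "\<xi> b (\<pi> z) = \<zero>\<^bsub>F\<^esub>" if "b \<in> B - ?S" for b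
          using \<pi>supp[OF z, of b] that by blast
      qed
      then show ?thesis using z by simp
    qed
    show "(\<pi> \<bullet> ?p) z = \<pi> z"
      using z i iS by (simp add: \<pi> pp \<xi>_proj)
  qed (use \<pi>M in auto)
  have \<alpha>\<beta>: "\<alpha> (proj S (\<beta> (\<pi> z))) = \<pi> z" if z: "z \<in> carrier W" for z
  proof -
    have "(\<alpha> \<bullet> (proj S \<bullet> \<beta>)) (\<pi> z) = \<pi> z"
    proof (rule fixes_supported[of _ "?S - {i}"])
      show "(\<alpha> \<bullet> (proj S \<bullet> \<beta>)) b = b" if b: "b \<in> ?S - {i}" for b
      proof -
        have bB: "b \<in> B" using b S by auto
        show ?thesis using b bB i(1) iS jB \<alpha>M \<beta>M by (auto simp: \<alpha>b \<beta>b proj_basis)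
      qed
    qed (use \<alpha>M \<beta>M \<pi>M z S \<pi>supp[OF z] in auto)
    then show ?thesis using z \<alpha>M \<beta>M \<pi>M by simp
  qed
  have "x = (x \<bullet> \<alpha>) \<bullet> proj S \<bullet> (\<beta> \<bullet> \<pi>)"
    using xM \<alpha>M \<beta>M \<pi>M by (intro End_eqI) (simp_all add: \<alpha>\<beta> x\<pi>)
  moreover have "x \<bullet> \<alpha> \<in> carrier (corner_at ?S)" "\<beta> \<bullet> \<pi> \<in> carrier (corner_at ?S)"
    using x \<alpha>C \<beta>C \<pi>C by (auto simp: E.m_assoc) (auto simp: E.m_assoc[symmetric])
  ultimately show ?thesis by blast
qed

text \<open>
  An injective element can be cancelled on the left, and in a finite monoid such elements are units.
\<close>
lemma injective_unit:
  assumes x: "x \<in> carrier (corner_at S)"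
    and inj: "\<And>v. v \<in> carrier W \<Longrightarrow> proj S v = v \<Longrightarrow> x v = \<zero>\<^bsub>W\<^esub> \<Longrightarrow> v = \<zero>\<^bsub>W\<^esub>"
  shows "x \<in> Units (corner_at S)"
proof -
  interpret EF: symmetrizing_form "End F W" \<chi> Q by (rule End_symmetrizing)
  let ?C = "carrier (corner_at S)" and ?p = "proj S"
  have pp: "?p \<bullet> ?p = ?p" using proj_mult[of S S] by simp
  interpret C: symmetrizing_form "corner_at S" \<chi> "EF.corner_Q ?p"
    by (rule EF.corner_form[OF proj_closed pp])
  have xM: "x \<in> M" using x by simp
  have canc: "y = z" if y: "y \<in> ?C" and z: "z \<in> ?C" and e: "x \<bullet> y = x \<bullet> z" for y z
  proof (rule End_eqI)
    show yM: "y \<in> M" and zM: "z \<in> M" using y z by auto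
    fix w assume w: "w \<in> carrier W"
    have fixed: "?p (u w) = u w" if "u \<in> ?C" for u
    proof -
      have "?p \<bullet> u = u" using that by simp
      from fun_cong[OF this, of w] show ?thesis using w by simp
    qed
    have py: "?p (y w) = y w" and pz: "?p (z w) = z w" using fixed y z by blast+
    let ?d = "y w \<oplus>\<^bsub>W\<^esub> (\<ominus>\<^bsub>F\<^esub> \<one>\<^bsub>F\<^esub>) \<odot>\<^bsub>W\<^esub> z w"
    have yw: "y w \<in> carrier W" and zw: "z w \<in> carrier W" using yM zM w by auto
    then have dW: "?d \<in> carrier W" by simp
    have "x (y w) = x (z w)" using fun_cong[OF e, of w] w by simp
    then have xd: "x ?d = \<zero>\<^bsub>W\<^esub>"
      using xM yw zw by (simp add: End_add End_smult) (simp add: smult_minus_1 M.r_neg)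
    have pd: "?p ?d = ?d"
      using yw zw py pz by (simp add: End_add[OF proj_closed] End_smult[OF proj_closed])
    have "?d = \<zero>\<^bsub>W\<^esub>" by (rule inj[OF dW pd xd])
    then have "y w \<ominus>\<^bsub>W\<^esub> z w = \<zero>\<^bsub>W\<^esub>" using yM zM w by (simp add: smult_minus_1 a_minus_def)
    then show "y w = z w" using yM zM w by simp
  qed
  have "(\<lambda>y. x \<otimes>\<^bsub>corner_at S\<^esub> y) ` ?C = ?C"
    using C.m_closed[OF x] canc
    by (intro endo_inj_surj C.finite_carrier inj_onI) (auto simp del: corner_simps(3))
  then obtain y where y: "y \<in> ?C" "x \<otimes>\<^bsub>corner_at S\<^esub> y = \<one>\<^bsub>corner_at S\<^esub>"
    using C.one_closed by (metis (no_types, lifting) imageE)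
  have "y \<otimes>\<^bsub>corner_at S\<^esub> x = \<one>\<^bsub>corner_at S\<^esub>"
  proof (rule canc)
    have "x \<otimes>\<^bsub>corner_at S\<^esub> (y \<otimes>\<^bsub>corner_at S\<^esub> x) = x \<otimes>\<^bsub>corner_at S\<^esub> \<one>\<^bsub>corner_at S\<^esub>"
      using x y by (simp only: C.m_assoc[symmetric] C.l_one C.r_one)
    then show "x \<bullet> (y \<otimes>\<^bsub>corner_at S\<^esub> x) = x \<bullet> \<one>\<^bsub>corner_at S\<^esub>" by simp
  qed (use x y(1) C.m_closed C.one_closed in \<open>blast+\<close>)
  then show ?thesis using x y unfolding Units_def by blast
qed

lemma corner_corner:
  "corner (corner_at (insert j S)) (proj S) = corner_at S"
proof -
  have "proj (insert j S) \<bullet> x = x" if "x \<in> M" "proj S \<bullet> x = x" for x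
    using that proj_mult[of "insert j S" S]
    by (metis E.m_assoc proj_closed Int_commute inf.absorb_iff1 subset_insertI)
  moreover have "x \<bullet> proj (insert j S) = x" if "x \<in> M" "x \<bullet> proj S = x" for x
    using that proj_mult[of S "insert j S"]
    by (metis E.m_assoc proj_closed inf.absorb_iff1 subset_insertI)
  ultimately have "carrier (corner (corner_at (insert j S)) (proj S)) = carrier (corner_at S)"
    unfolding set_eq_iff corner_simps by blast
  then show ?thesis by (intro monoid.equality) simp_all
qed

text \<open>
  The corner at \<open>S\<close> is the endomorphism monoid of the span of \<open>S\<close>.  Each step adds one basis vector: a
  map that is not injective on the larger span factors through the smaller one.
\<close>
lemma separable_corner_at:
  assumes "S \<subseteq> B"
  shows "separable (corner_at S) \<chi>"
  using finite_subset[OF assms finite_B] assms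
proof (induction S rule: finite_induct)
  interpret EF: symmetrizing_form "End F W" \<chi> Q by (rule End_symmetrizing)
  {
    case empty
    interpret C: symmetrizing_form "corner_at {}" \<chi> "EF.corner_Q (proj {})"
      by (rule EF.corner_form) (simp_all add: proj_mult)
    have z: "proj {} = zero_map" by (rule End_eqI_basis) (auto simp: proj_basis)
    show ?case
    proof (rule C.separable_group, rule subsetI)
      fix x assume "x \<in> carrier (corner_at {})"
      then show "x \<in> Units (corner_at {})"
        by (rule injective_unit) (simp add: z)
    qed
  next
    case (insert j S)
    interpret C: symmetrizing_form "corner_at (insert j S)" \<chi> "EF.corner_Q (proj (insert j S))"
      by (rule EF.corner_form) (simp_all add: proj_mult)
    show ?case
    proof (rule C.separable_from_corner[of "proj S"])
      show "separable (corner (corner_at (insert j S)) (proj S)) \<chi>"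
        unfolding corner_corner using insert by simp
      show "proj S \<in> carrier (corner_at (insert j S))"
        by (simp add: proj_mult Int_insert_left Int_insert_right) (auto simp: insert_absorb)
      show "proj S \<otimes>\<^bsub>corner_at (insert j S)\<^esub> proj S = proj S" by (simp add: proj_mult)
      fix x assume x: "x \<in> carrier (corner_at (insert j S))"
      show "x \<in> Units (corner_at (insert j S)) \<or> (\<exists>u\<in>carrier (corner_at (insert j S)).
          \<exists>w\<in>carrier (corner_at (insert j S)). x = u \<otimes>\<^bsub>corner_at (insert j S)\<^esub> proj S \<otimes>\<^bsub>corner_at (insert j S)\<^esub> w)"
        using injective_unit[OF x] noninjective_factors[OF insert.prems x] by auto
    qed
  }
qed

theorem separable_End: "separable (End F W) \<chi>"
proof -
  have "proj B = \<one>\<^bsub>End F W\<^esub>"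
    by (rule End_eqI_basis) (auto simp: proj_basis)
  moreover have "corner (End F W) \<one>\<^bsub>End F W\<^esub> = End F W"
    by (rule monoid.equality) (auto simp del: End_one simp: set_eq_iff)
  ultimately show ?thesis using separable_corner_at[of B] by simp
qed

end

section \<open>Averaging over a separable monoid algebra\<close>

lemma common_denominator:
  fixes w :: "'a \<Rightarrow> rat"
  assumes "finite A"
  shows "\<exists>D::int. D > 0 \<and> (\<forall>a\<in>A. of_int D * w a \<in> \<int>)"
  using assms
proof (induction A rule: finite_induct)
  case empty
  show ?case by (intro exI[of _ 1]) auto
next
  case (insert x A)
  then obtain D where D: "D > 0" "\<forall>a\<in>A. of_int D * w a \<in> \<int>" by blast
  obtain n d where nd: "quotient_of (w x) = (n, d)" by (cases "quotient_of (w x)")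
  then have d: "d > 0" and wx: "of_int d * w x = of_int n"
    using quotient_of_denom_pos[OF nd] quotient_of_div[OF nd] by auto
  have "of_int (D * d) * w a \<in> \<int>" if a: "a \<in> insert x A" for a
  proof (cases "a = x")
    case True
    have "of_int (D * d) * w x = of_int (D * n)" using wx by (simp add: mult.assoc)
    then show ?thesis using True by (metis Ints_of_int)
  next
    case False
    then have "of_int D * w a \<in> \<int>" using D(2) a by auto
    then have "of_int d * (of_int D * w a) \<in> \<int>" by (rule Ints_mult[OF Ints_of_int])
    then show ?thesis by (simp add: ac_simps)
  qed
  then show ?case using D d by (intro exI[of _ "D * d"]) auto
qed

text \<open>
  Up to the factor \<open>D\<close>, the separability idempotent is integral, so it makes sense over every ring.
\<close>
lemma separable_integral:
  fixes G :: "('a, 'm) monoid_scheme" (structure)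
  assumes "separable G \<chi>"
  shows "\<exists>(w :: 'a \<times> 'a \<Rightarrow> int) D. D > 0 \<and>
    (\<forall>y\<in>carrier G. \<forall>b. (\<Sum>a | a \<in> carrier G \<times> carrier G \<and> (y \<otimes> fst a, snd a) = b. w a) =
        (\<Sum>a | a \<in> carrier G \<times> carrier G \<and> (fst a, snd a \<otimes> y) = b. w a)) \<and>
    (\<forall>h. (\<Sum>a | a \<in> carrier G \<times> carrier G \<and> fst a \<otimes> snd a = h. w a) = (if h = \<one> then D else 0))"
proof -
  obtain Q b where "symmetrizing_form G \<chi> Q"
    and b: "\<And>\<phi>. symmetrizing_form.higman G Q b \<phi> = \<phi> \<one>"
    using assms by (auto simp: separable_def)
  then interpret symmetrizing_form G \<chi> Q by simp
  let ?A = "carrier G \<times> carrier G"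
  have finA: "finite ?A" using finite_carrier by simp
  obtain w :: "'a \<Rightarrow> 'a \<Rightarrow> rat" where w: "(\<forall>y\<in>carrier G. \<forall>\<Phi>. (\<Sum>f\<in>carrier G. \<Sum>g\<in>carrier G. w f g * \<Phi> (y \<otimes> f) g) =
       (\<Sum>f\<in>carrier G. \<Sum>g\<in>carrier G. w f g * \<Phi> f (g \<otimes> y))) \<and>
    (\<forall>\<phi>. (\<Sum>f\<in>carrier G. \<Sum>g\<in>carrier G. w f g * \<phi> (f \<otimes> g)) = \<phi> \<one>)"
    using higman_casimir_idempotent[OF b] by (elim exE) (rule that)
  then have w1: "\<And>y \<Phi>. y \<in> carrier G \<Longrightarrow> (\<Sum>f\<in>carrier G. \<Sum>g\<in>carrier G. w f g * \<Phi> (y \<otimes> f) g) =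
       (\<Sum>f\<in>carrier G. \<Sum>g\<in>carrier G. w f g * \<Phi> f (g \<otimes> y))"
    and w2: "\<And>\<phi>. (\<Sum>f\<in>carrier G. \<Sum>g\<in>carrier G. w f g * \<phi> (f \<otimes> g)) = \<phi> \<one>"
    by simp_all
  obtain D :: int where D: "D > 0" "\<forall>a\<in>?A. of_int D * (case a of (f, g) \<Rightarrow> w f g) \<in> \<int>"
    using common_denominator[OF finA, of "\<lambda>(f, g). w f g"] by blast
  define v where "v a = \<lfloor>of_int D * w (fst a) (snd a)\<rfloor>" for a
  have v: "of_int (v a) = of_int D * w (fst a) (snd a)" if "a \<in> ?A" for a
  proof -
    have "of_int D * w (fst a) (snd a) \<in> \<int>" using D(2) that by (auto split: prod.splits)
    then obtain k where "of_int D * w (fst a) (snd a) = of_int k" by (rule Ints_cases)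
    then show ?thesis by (simp add: v_def)
  qed
  have vsum: "of_int (\<Sum>a | a \<in> ?A \<and> \<pi> a = c. v a) =
      of_int D * (\<Sum>f\<in>carrier G. \<Sum>g\<in>carrier G. w f g * of_bool (\<pi> (f, g) = c))" for \<pi> and c :: 'c
  proof -
    have "rat_of_int (\<Sum>a | a \<in> ?A \<and> \<pi> a = c. v a) = (\<Sum>a | a \<in> ?A \<and> \<pi> a = c. of_int D * w (fst a) (snd a))"
      by (simp add: v)
    also have "\<dots> = (\<Sum>a\<in>?A. of_int D * w (fst a) (snd a) * of_bool (\<pi> a = c))"
      using finA by (intro sum.mono_neutral_cong_left) auto
    also have "\<dots> = of_int D * (\<Sum>f\<in>carrier G. \<Sum>g\<in>carrier G. w f g * of_bool (\<pi> (f, g) = c))"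
      by (simp add: sum.cartesian_product sum_distrib_left mult.assoc case_prod_beta)
    finally show ?thesis .
  qed
  show ?thesis
  proof (intro exI[of _ v] exI[of _ D] conjI ballI allI)
    fix y c assume y: "y \<in> carrier G"
    have "rat_of_int (\<Sum>a | a \<in> ?A \<and> (y \<otimes> fst a, snd a) = c. v a) =
        of_int (\<Sum>a | a \<in> ?A \<and> (fst a, snd a \<otimes> y) = c. v a)"
      unfolding vsum using w1[OF y, of "\<lambda>f g. of_bool ((f, g) = c)"] by simp
    then show "(\<Sum>a | a \<in> ?A \<and> (y \<otimes> fst a, snd a) = c. v a) =
        (\<Sum>a | a \<in> ?A \<and> (fst a, snd a \<otimes> y) = c. v a)" by (simp only: of_int_eq_iff)
  next
    fix h
    have "rat_of_int (\<Sum>a | a \<in> ?A \<and> fst a \<otimes> snd a = h. v a) = of_int (if h = \<one> then D else 0)"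
      unfolding vsum using w2[of "\<lambda>x. of_bool (x = h)"] by simp
    then show "(\<Sum>a | a \<in> ?A \<and> fst a \<otimes> snd a = h. v a) = (if h = \<one> then D else 0)"
      by (simp only: of_int_eq_iff)
  qed (rule D(1))
qed

context module
begin

abbreviation int_emb :: "int \<Rightarrow> 'a" where "int_emb n \<equiv> [n] \<cdot>\<^bsub>R\<^esub> \<one>\<^bsub>R\<^esub>"

lemma int_emb_closed [simp]: "int_emb n \<in> carrier R"
  by (simp add: R.add.int_pow_closed)

lemma int_emb_add: "int_emb (m + n) = int_emb m \<oplus>\<^bsub>R\<^esub> int_emb n"
  by (simp add: R.add.int_pow_mult)

lemma int_emb_zero [simp]: "int_emb 0 = \<zero>\<^bsub>R\<^esub>"
  by (simp add: add_pow_def)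

lemma finsum_fibres:
  assumes "finite A" and B: "finite B" and "\<pi> ` A \<subseteq> B" and \<Theta>: "\<And>b. b \<in> B \<Longrightarrow> \<Theta> b \<in> carrier M"
  shows "(\<Oplus>\<^bsub>M\<^esub>a\<in>A. int_emb (w a) \<odot>\<^bsub>M\<^esub> \<Theta> (\<pi> a)) =
    (\<Oplus>\<^bsub>M\<^esub>b\<in>B. int_emb (\<Sum>a | a \<in> A \<and> \<pi> a = b. w a) \<odot>\<^bsub>M\<^esub> \<Theta> b)"
  using assms(1,3)
proof (induction A rule: finite_induct)
  case empty
  have "(\<Oplus>\<^bsub>M\<^esub>b\<in>B. int_emb (\<Sum>a | a \<in> {} \<and> \<pi> a = b. w a) \<odot>\<^bsub>M\<^esub> \<Theta> b) = (\<Oplus>\<^bsub>M\<^esub>b\<in>B. \<zero>\<^bsub>M\<^esub>)"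
    by (rule M.finsum_cong') (use \<Theta> in auto)
  then show ?case by simp
next
  case (insert x A)
  let ?s = "\<lambda>b. \<Sum>a | a \<in> A \<and> \<pi> a = b. w a"
  have step: "(\<Sum>a | a \<in> insert x A \<and> \<pi> a = b. w a) = (if \<pi> x = b then w x else 0) + ?s b" for b
  proof (cases "\<pi> x = b")
    case True
    then have "{a. a \<in> insert x A \<and> \<pi> a = b} = insert x {a. a \<in> A \<and> \<pi> a = b}" by auto
    then show ?thesis using insert.hyps True by simp
  next
    case False
    then have "{a. a \<in> insert x A \<and> \<pi> a = b} = {a. a \<in> A \<and> \<pi> a = b}" by auto
    then show ?thesis using False by simp
  qed
  have "(\<Oplus>\<^bsub>M\<^esub>b\<in>B. int_emb (\<Sum>a | a \<in> insert x A \<and> \<pi> a = b. w a) \<odot>\<^bsub>M\<^esub> \<Theta> b) =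
      (\<Oplus>\<^bsub>M\<^esub>b\<in>B. (if \<pi> x = b then int_emb (w x) \<odot>\<^bsub>M\<^esub> \<Theta> b else \<zero>\<^bsub>M\<^esub>) \<oplus>\<^bsub>M\<^esub> int_emb (?s b) \<odot>\<^bsub>M\<^esub> \<Theta> b)"
  proof (rule M.finsum_cong'[OF refl])
    fix b assume "b \<in> B"
    then show "int_emb (\<Sum>a | a \<in> insert x A \<and> \<pi> a = b. w a) \<odot>\<^bsub>M\<^esub> \<Theta> b =
        (if \<pi> x = b then int_emb (w x) \<odot>\<^bsub>M\<^esub> \<Theta> b else \<zero>\<^bsub>M\<^esub>) \<oplus>\<^bsub>M\<^esub> int_emb (?s b) \<odot>\<^bsub>M\<^esub> \<Theta> b"
      unfolding step using \<Theta> by (simp add: int_emb_add smult_l_distr)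
  qed (use \<Theta> in auto)
  also have "\<dots> = (\<Oplus>\<^bsub>M\<^esub>b\<in>B. if \<pi> x = b then int_emb (w x) \<odot>\<^bsub>M\<^esub> \<Theta> b else \<zero>\<^bsub>M\<^esub>) \<oplus>\<^bsub>M\<^esub>
      (\<Oplus>\<^bsub>M\<^esub>b\<in>B. int_emb (?s b) \<odot>\<^bsub>M\<^esub> \<Theta> b)"
    by (rule M.finsum_addf) (use \<Theta> in auto)
  also have "(\<Oplus>\<^bsub>M\<^esub>b\<in>B. if \<pi> x = b then int_emb (w x) \<odot>\<^bsub>M\<^esub> \<Theta> b else \<zero>\<^bsub>M\<^esub>) = int_emb (w x) \<odot>\<^bsub>M\<^esub> \<Theta> (\<pi> x)"
    by (rule M.finsum_singleton) (use \<Theta> B insert.prems in auto)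
  also have "(\<Oplus>\<^bsub>M\<^esub>b\<in>B. int_emb (?s b) \<odot>\<^bsub>M\<^esub> \<Theta> b) = (\<Oplus>\<^bsub>M\<^esub>a\<in>A. int_emb (w a) \<odot>\<^bsub>M\<^esub> \<Theta> (\<pi> a))"
    using insert by simp
  finally have "(\<Oplus>\<^bsub>M\<^esub>b\<in>B. int_emb (\<Sum>a | a \<in> insert x A \<and> \<pi> a = b. w a) \<odot>\<^bsub>M\<^esub> \<Theta> b) =
      int_emb (w x) \<odot>\<^bsub>M\<^esub> \<Theta> (\<pi> x) \<oplus>\<^bsub>M\<^esub> (\<Oplus>\<^bsub>M\<^esub>a\<in>A. int_emb (w a) \<odot>\<^bsub>M\<^esub> \<Theta> (\<pi> a))" .
  moreover have "(\<Oplus>\<^bsub>M\<^esub>a\<in>insert x A. int_emb (w a) \<odot>\<^bsub>M\<^esub> \<Theta> (\<pi> a)) =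
      int_emb (w x) \<odot>\<^bsub>M\<^esub> \<Theta> (\<pi> x) \<oplus>\<^bsub>M\<^esub> (\<Oplus>\<^bsub>M\<^esub>a\<in>A. int_emb (w a) \<odot>\<^bsub>M\<^esub> \<Theta> (\<pi> a))"
    by (rule M.finsum_insert) (use insert.hyps insert.prems \<Theta> in auto)
  ultimately show ?case by simp
qed

lemma submoduleD:
  assumes "submodule R N M"
  shows "N \<subseteq> carrier M" "\<zero>\<^bsub>M\<^esub> \<in> N"
    and "\<And>x y. x \<in> N \<Longrightarrow> y \<in> N \<Longrightarrow> x \<oplus>\<^bsub>M\<^esub> y \<in> N"
    and "\<And>r x. r \<in> carrier R \<Longrightarrow> x \<in> N \<Longrightarrow> r \<odot>\<^bsub>M\<^esub> x \<in> N"
    and "\<And>x y. x \<in> N \<Longrightarrow> y \<in> N \<Longrightarrow> x \<ominus>\<^bsub>M\<^esub> y \<in> N"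
proof -
  interpret N: submodule R N M by fact
  show sub: "N \<subseteq> carrier M" "\<zero>\<^bsub>M\<^esub> \<in> N" by (auto simp: N.subset)
  show add: "\<And>x y. x \<in> N \<Longrightarrow> y \<in> N \<Longrightarrow> x \<oplus>\<^bsub>M\<^esub> y \<in> N"
    and sm: "\<And>r x. r \<in> carrier R \<Longrightarrow> x \<in> N \<Longrightarrow> r \<odot>\<^bsub>M\<^esub> x \<in> N" by auto
  fix x y assume x: "x \<in> N" and y: "y \<in> N"
  have "x \<oplus>\<^bsub>M\<^esub> (\<ominus>\<^bsub>R\<^esub> \<one>\<^bsub>R\<^esub>) \<odot>\<^bsub>M\<^esub> y \<in> N" using x y add sm by simp
  then show "x \<ominus>\<^bsub>M\<^esub> y \<in> N" using y sub by (simp add: smult_minus_1 a_minus_def subset_iff)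
qed

lemma submodule_chain_Union:
  assumes ne: "\<C> \<noteq> {}" and chain: "subset.chain \<A> \<C>" and sub: "\<And>N. N \<in> \<C> \<Longrightarrow> submodule R N M"
  shows "submodule R (\<Union>\<C>) M"
proof (rule submodule.intro)
  show "module R M" by (rule module_axioms)
  show "\<Union>\<C> \<subseteq> carrier M" using sub submoduleD(1) by blast
  show "\<zero>\<^bsub>M\<^esub> \<in> \<Union>\<C>" using sub submoduleD(2) ne by blast
  show "v \<oplus>\<^bsub>M\<^esub> w \<in> \<Union>\<C>" if v: "v \<in> \<Union>\<C>" and w: "w \<in> \<Union>\<C>" for v w
  proof -
    obtain N1 N2 where N: "N1 \<in> \<C>" "N2 \<in> \<C>" "v \<in> N1" "w \<in> N2" using v w by blast
    then have "N1 \<subseteq> N2 \<or> N2 \<subseteq> N1" using chain by (auto simp: subset.chain_def)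
    then show ?thesis using N submoduleD(3)[OF sub[OF N(1)]] submoduleD(3)[OF sub[OF N(2)]] by blast
  qed
  show "r \<odot>\<^bsub>M\<^esub> v \<in> \<Union>\<C>" if r: "r \<in> carrier R" and v: "v \<in> \<Union>\<C>" for r v
    using submoduleD(4)[OF sub] r v by blast
qed

definition complementary :: "'c set \<Rightarrow> 'c set \<Rightarrow> bool" where
  "complementary N C \<longleftrightarrow> submodule R N M \<and> submodule R C M \<and> N \<inter> C = {\<zero>\<^bsub>M\<^esub>} \<and>
    (\<forall>x\<in>carrier M. \<exists>n\<in>N. \<exists>c\<in>C. x = n \<oplus>\<^bsub>M\<^esub> c)"

lemma sum_decomposition_unique:
  assumes N: "submodule R N M" and C: "submodule R C M" and I: "N \<inter> C = {\<zero>\<^bsub>M\<^esub>}"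
    and "n \<in> N" "n' \<in> N" "c \<in> C" "c' \<in> C"
    and e: "n \<oplus>\<^bsub>M\<^esub> c = n' \<oplus>\<^bsub>M\<^esub> c'"
  shows "n = n'" "c = c'"
proof -
  have cl: "n \<in> carrier M" "n' \<in> carrier M" "c \<in> carrier M" "c' \<in> carrier M"
    using assms submoduleD(1)[OF N] submoduleD(1)[OF C] by auto
  have "(n \<ominus>\<^bsub>M\<^esub> n') \<oplus>\<^bsub>M\<^esub> (n' \<oplus>\<^bsub>M\<^esub> c) = n \<oplus>\<^bsub>M\<^esub> c"
    using cl by (simp add: a_minus_def M.a_assoc M.r_neg1)
  moreover have "(c' \<ominus>\<^bsub>M\<^esub> c) \<oplus>\<^bsub>M\<^esub> (c \<oplus>\<^bsub>M\<^esub> n') = c' \<oplus>\<^bsub>M\<^esub> n'"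
    using cl by (simp add: a_minus_def M.a_assoc M.r_neg1)
  ultimately have "(n \<ominus>\<^bsub>M\<^esub> n') \<oplus>\<^bsub>M\<^esub> (n' \<oplus>\<^bsub>M\<^esub> c) = (c' \<ominus>\<^bsub>M\<^esub> c) \<oplus>\<^bsub>M\<^esub> (n' \<oplus>\<^bsub>M\<^esub> c)"
    using cl e by (simp add: M.a_comm)
  then have d: "n \<ominus>\<^bsub>M\<^esub> n' = c' \<ominus>\<^bsub>M\<^esub> c"
    using cl by (simp add: M.add.right_cancel)
  have "n \<ominus>\<^bsub>M\<^esub> n' \<in> N" "c' \<ominus>\<^bsub>M\<^esub> c \<in> C"
    using assms submoduleD(5)[OF N] submoduleD(5)[OF C] by auto
  then have "n \<ominus>\<^bsub>M\<^esub> n' = \<zero>\<^bsub>M\<^esub>" "c' \<ominus>\<^bsub>M\<^esub> c = \<zero>\<^bsub>M\<^esub>" using I d by auto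
  then show "n = n'" "c = c'" using cl by auto
qed

lemma complementary_unique:
  assumes "complementary N C" "n \<in> N" "n' \<in> N" "c \<in> C" "c' \<in> C" "n \<oplus>\<^bsub>M\<^esub> c = n' \<oplus>\<^bsub>M\<^esub> c'"
  shows "n = n'" "c = c'"
  using assms(1) unfolding complementary_def
  by (auto intro: sum_decomposition_unique[OF _ _ _ assms(2-6)])

end

text \<open>
  Let \<open>C\<close> be maximal among the submodules that meet \<open>N\<close> only in \<open>0\<close>.  If \<open>x\<close> were not in \<open>N + C\<close>, then
  \<open>C + K x\<close> would be larger: from \<open>n = c + r x\<close> with \<open>r \<noteq> 0\<close> one could solve for \<open>x\<close>.
\<close>
lemma (in vectorspace) complement_exists:
  assumes N: "submodule K N V"
  shows "\<exists>C. complementary N C"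
proof -
  define \<A> where "\<A> = {C. submodule K C V \<and> N \<inter> C = {\<zero>\<^bsub>V\<^esub>}}"
  have "{\<zero>\<^bsub>V\<^esub>} \<in> \<A>"
    using submoduleD(2)[OF N] by (auto simp: \<A>_def intro!: submodule.intro module_axioms)
  moreover have "\<Union>\<C> \<in> \<A>" if ne: "\<C> \<noteq> {}" and ch: "subset.chain \<A> \<C>" for \<C>
  proof -
    have "\<C> \<subseteq> \<A>" using ch by (simp add: subset.chain_def)
    then have "submodule K (\<Union>\<C>) V" "\<And>C. C \<in> \<C> \<Longrightarrow> N \<inter> C = {\<zero>\<^bsub>V\<^esub>}"
      using submodule_chain_Union[OF ne ch] by (auto simp: \<A>_def)
    then show ?thesis unfolding \<A>_def using ne by auto
  qed
  ultimately obtain C where CA: "C \<in> \<A>" and max: "\<And>X. X \<in> \<A> \<Longrightarrow> C \<subseteq> X \<Longrightarrow> X = C"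
    using subset_Zorn_nonempty[of \<A>] by blast
  then have C: "submodule K C V" and NC: "N \<inter> C = {\<zero>\<^bsub>V\<^esub>}" by (auto simp: \<A>_def)
  note Nc = submoduleD[OF N] and Cc = submoduleD[OF C]
  have "\<exists>n\<in>N. \<exists>c\<in>C. x = n \<oplus>\<^bsub>V\<^esub> c" if x: "x \<in> carrier V" for x
  proof (rule ccontr)
    assume no: "\<not> ?thesis"
    define X where "X = {c \<oplus>\<^bsub>V\<^esub> r \<odot>\<^bsub>V\<^esub> x | c r. c \<in> C \<and> r \<in> carrier K}"
    have CV: "\<And>c. c \<in> C \<Longrightarrow> c \<in> carrier V" and NV: "\<And>n. n \<in> N \<Longrightarrow> n \<in> carrier V"
      using Cc(1) Nc(1) by auto
    have XS: "submodule K X V"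
    proof (rule submodule.intro)
      show "module K V" by (rule module_axioms)
      show "X \<subseteq> carrier V" using x CV by (auto simp: X_def)
      have "\<zero>\<^bsub>V\<^esub> = \<zero>\<^bsub>V\<^esub> \<oplus>\<^bsub>V\<^esub> \<zero>\<^bsub>K\<^esub> \<odot>\<^bsub>V\<^esub> x" using x by simp
      then show "\<zero>\<^bsub>V\<^esub> \<in> X" unfolding X_def using Cc(2) R.zero_closed by blast
    next
      fix u v assume "u \<in> X" "v \<in> X"
      then obtain c r d s where cr: "c \<in> C" "r \<in> carrier K" "u = c \<oplus>\<^bsub>V\<^esub> r \<odot>\<^bsub>V\<^esub> x"
        and ds: "d \<in> C" "s \<in> carrier K" "v = d \<oplus>\<^bsub>V\<^esub> s \<odot>\<^bsub>V\<^esub> x" by (auto simp: X_def)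
      have "u \<oplus>\<^bsub>V\<^esub> v = (c \<oplus>\<^bsub>V\<^esub> d) \<oplus>\<^bsub>V\<^esub> (r \<oplus>\<^bsub>K\<^esub> s) \<odot>\<^bsub>V\<^esub> x"
        using cr ds CV x by (simp add: smult_l_distr M.a_ac)
      then show "u \<oplus>\<^bsub>V\<^esub> v \<in> X" unfolding X_def using cr ds Cc(3) by blast
    next
      fix a u assume a: "a \<in> carrier K" and "u \<in> X"
      then obtain c r where cr: "c \<in> C" "r \<in> carrier K" "u = c \<oplus>\<^bsub>V\<^esub> r \<odot>\<^bsub>V\<^esub> x" by (auto simp: X_def)
      have "a \<odot>\<^bsub>V\<^esub> u = a \<odot>\<^bsub>V\<^esub> c \<oplus>\<^bsub>V\<^esub> (a \<otimes>\<^bsub>K\<^esub> r) \<odot>\<^bsub>V\<^esub> x"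
        using a cr CV x by (simp add: smult_r_distr smult_assoc1)
      then show "a \<odot>\<^bsub>V\<^esub> u \<in> X" unfolding X_def using a cr Cc(4) by blast
    qed
    have NX: "n = \<zero>\<^bsub>V\<^esub>" if n: "n \<in> N" and nX: "n \<in> X" for n
    proof -
      obtain c r where c: "c \<in> C" and r: "r \<in> carrier K" and e: "n = c \<oplus>\<^bsub>V\<^esub> r \<odot>\<^bsub>V\<^esub> x"
        using nX by (auto simp: X_def)
      show ?thesis
      proof (cases "r = \<zero>\<^bsub>K\<^esub>")
        case True
        then have "n = c" using e c CV x by simp
        then show ?thesis using NC n c by auto
      next
        case False
        then have ir: "inv\<^bsub>K\<^esub> r \<in> carrier K" "inv\<^bsub>K\<^esub> r \<otimes>\<^bsub>K\<^esub> r = \<one>\<^bsub>K\<^esub>" using r field_Units by auto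
        let ?c = "(\<ominus>\<^bsub>K\<^esub> \<one>\<^bsub>K\<^esub>) \<odot>\<^bsub>V\<^esub> (inv\<^bsub>K\<^esub> r \<odot>\<^bsub>V\<^esub> c)"
        have "inv\<^bsub>K\<^esub> r \<odot>\<^bsub>V\<^esub> n = inv\<^bsub>K\<^esub> r \<odot>\<^bsub>V\<^esub> c \<oplus>\<^bsub>V\<^esub> x"
          unfolding e using ir r c CV x by (simp add: smult_r_distr smult_assoc1[symmetric])
        moreover have y: "inv\<^bsub>K\<^esub> r \<odot>\<^bsub>V\<^esub> c \<in> carrier V" using ir c CV by simp
        ultimately have "x = inv\<^bsub>K\<^esub> r \<odot>\<^bsub>V\<^esub> n \<oplus>\<^bsub>V\<^esub> ?c"
          using M.r_neg2[OF y x] y x unfolding smult_minus_1[OF y] by (simp add: M.a_comm M.a_lcomm)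
        moreover have "inv\<^bsub>K\<^esub> r \<odot>\<^bsub>V\<^esub> n \<in> N" "?c \<in> C" using ir n c Nc Cc by simp_all
        ultimately show ?thesis using no by blast
      qed
    qed
    have "N \<inter> X = {\<zero>\<^bsub>V\<^esub>}" using NX Nc(2) submoduleD(2)[OF XS] by blast
    then have "X \<in> \<A>" using XS unfolding \<A>_def by blast
    moreover have "C \<subseteq> X"
    proof
      fix c assume c: "c \<in> C"
      then have "c = c \<oplus>\<^bsub>V\<^esub> \<zero>\<^bsub>K\<^esub> \<odot>\<^bsub>V\<^esub> x" using x CV by simp
      then show "c \<in> X" unfolding X_def using c R.zero_closed by blast
    qed
    ultimately have "X = C" by (rule max)
    moreover have "x = \<zero>\<^bsub>V\<^esub> \<oplus>\<^bsub>V\<^esub> \<one>\<^bsub>K\<^esub> \<odot>\<^bsub>V\<^esub> x" using x by simp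
    ultimately have "x \<in> C" unfolding X_def using Cc(2) R.one_closed by blast
    then have "x = \<zero>\<^bsub>V\<^esub> \<oplus>\<^bsub>V\<^esub> x" "x \<in> C" using x by simp_all
    then show False using no Nc(2) by blast
  qed
  then show ?thesis using N C NC unfolding complementary_def by blast
qed

locale monoid_representation = vectorspace K T
  for K :: "('k, 'n) ring_scheme" and T :: "('k, 'w, 'z) module_scheme" +
  fixes G :: "('a, 'm) monoid_scheme" and act :: "'a \<Rightarrow> 'w \<Rightarrow> 'w"
  assumes monoid_G: "monoid G"
    and act_hom: "f \<in> carrier G \<Longrightarrow> act f \<in> module_hom K T T"
    and act_mult: "\<lbrakk>f \<in> carrier G; g \<in> carrier G; x \<in> carrier T\<rbrakk> \<Longrightarrow> act (f \<otimes>\<^bsub>G\<^esub> g) x = act f (act g x)"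
    and act_one: "x \<in> carrier T \<Longrightarrow> act \<one>\<^bsub>G\<^esub> x = x"
begin

definition stable :: "'w set \<Rightarrow> bool" where
  "stable N \<longleftrightarrow> submodule K N T \<and> (\<forall>f\<in>carrier G. \<forall>x\<in>N. act f x \<in> N)"

lemma act_closed [simp, intro]: "f \<in> carrier G \<Longrightarrow> x \<in> carrier T \<Longrightarrow> act f x \<in> carrier T"
  using module_hom_closed[OF act_hom] by blast

lemma act_add: "f \<in> carrier G \<Longrightarrow> x \<in> carrier T \<Longrightarrow> y \<in> carrier T \<Longrightarrow> act f (x \<oplus>\<^bsub>T\<^esub> y) = act f x \<oplus>\<^bsub>T\<^esub> act f y"
  by (rule module_hom_add[OF act_hom])

lemma act_smult: "f \<in> carrier G \<Longrightarrow> r \<in> carrier K \<Longrightarrow> x \<in> carrier T \<Longrightarrow> act f (r \<odot>\<^bsub>T\<^esub> x) = r \<odot>\<^bsub>T\<^esub> act f x"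
  by (rule module_hom_smult[OF act_hom])

lemma act_zero: "f \<in> carrier G \<Longrightarrow> act f \<zero>\<^bsub>T\<^esub> = \<zero>\<^bsub>T\<^esub>"
  using act_smult[of f "\<zero>\<^bsub>K\<^esub>" "\<zero>\<^bsub>T\<^esub>"] by simp

text \<open>
  Let \<open>w\<close> be the integral separability idempotent, with product \<open>D\<close>, and \<open>p\<close> a linear projection onto
  \<open>N\<close>.  The average \<open>\<rho> = \<Sum> w(f, g) f p g\<close> maps into \<open>N\<close>.  It commutes with the action because \<open>w\<close>
  commutes with each \<open>y\<close>, and it is multiplication by \<open>D\<close> on \<open>N\<close> because \<open>p\<close> is the identity there and
  \<open>w\<close> has product \<open>D\<close>.  As \<open>D\<close> is invertible in \<open>K\<close>, the kernel of \<open>\<rho>\<close> is a complement.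
\<close>
theorem stable_complement:
  assumes sep: "separable G \<chi>" and char0: "\<And>n::nat. n > 0 \<Longrightarrow> [n] \<cdot>\<^bsub>K\<^esub> \<one>\<^bsub>K\<^esub> \<noteq> \<zero>\<^bsub>K\<^esub>"
    and N: "stable N"
  shows "\<exists>C. stable C \<and> complementary N C"
proof -
  interpret G: monoid G by (rule monoid_G)
  have finG: "finite (carrier G)"
    using sep by (auto simp: separable_def dest: symmetrizing_form.finite_carrier)
  let ?A = "carrier G \<times> carrier G"
  have finA: "finite ?A" using finG by simp
  obtain w :: "'a \<times> 'a \<Rightarrow> int" and D where D: "D > 0"
    and w: "\<And>y b. y \<in> carrier G \<Longrightarrow> (\<Sum>a | a \<in> ?A \<and> (y \<otimes>\<^bsub>G\<^esub> fst a, snd a) = b. w a) =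
        (\<Sum>a | a \<in> ?A \<and> (fst a, snd a \<otimes>\<^bsub>G\<^esub> y) = b. w a)"
    and w1: "\<And>h. (\<Sum>a | a \<in> ?A \<and> fst a \<otimes>\<^bsub>G\<^esub> snd a = h. w a) = (if h = \<one>\<^bsub>G\<^esub> then D else 0)"
    using separable_integral[OF sep] by blast
  have NS: "submodule K N T" and Nact: "\<And>f x. f \<in> carrier G \<Longrightarrow> x \<in> N \<Longrightarrow> act f x \<in> N"
    using N by (auto simp: stable_def)
  note Ns = submoduleD[OF NS]
  have NT: "\<And>x. x \<in> N \<Longrightarrow> x \<in> carrier T" using Ns(1) by blast
  obtain L where L: "complementary N L" using complement_exists[OF NS] by blast
  have LS: "submodule K L T" using L by (simp add: complementary_def)
  note Ls = submoduleD[OF LS]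
  have LT: "\<And>x. x \<in> L \<Longrightarrow> x \<in> carrier T" using Ls(1) by blast
  define p where "p x = (THE n. n \<in> N \<and> (\<exists>l\<in>L. x = n \<oplus>\<^bsub>T\<^esub> l))" for x
  have p: "p x = n" if "n \<in> N" "l \<in> L" "x = n \<oplus>\<^bsub>T\<^esub> l" for x n l
    unfolding p_def
  proof (rule the_equality)
    show "n \<in> N \<and> (\<exists>l\<in>L. x = n \<oplus>\<^bsub>T\<^esub> l)" using that by blast
    fix n' assume "n' \<in> N \<and> (\<exists>l\<in>L. x = n' \<oplus>\<^bsub>T\<^esub> l)"
    then obtain l' where n': "n' \<in> N" "l' \<in> L" and e: "x = n' \<oplus>\<^bsub>T\<^esub> l'" by blast
    have "n' \<oplus>\<^bsub>T\<^esub> l' = n \<oplus>\<^bsub>T\<^esub> l" using e that(3) by (rule trans[OF sym])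
    then show "n' = n" by (rule complementary_unique(1)[OF L n'(1) that(1) n'(2) that(2)])
  qed
  have split: "\<exists>n\<in>N. \<exists>l\<in>L. x = n \<oplus>\<^bsub>T\<^esub> l" if "x \<in> carrier T" for x
    using L that unfolding complementary_def by blast
  have pN: "p x \<in> N" if x: "x \<in> carrier T" for x
  proof -
    obtain n l where nl: "n \<in> N" "l \<in> L" "x = n \<oplus>\<^bsub>T\<^esub> l" using split[OF x] by blast
    show ?thesis unfolding p[OF nl] by (rule nl(1))
  qed
  have pT: "p x \<in> carrier T" if "x \<in> carrier T" for x using NT pN that by blast
  have p_id: "p n = n" if "n \<in> N" for n
    by (rule p[OF that Ls(2)]) (simp add: NT that)
  have p_add: "p (x \<oplus>\<^bsub>T\<^esub> y) = p x \<oplus>\<^bsub>T\<^esub> p y" if x: "x \<in> carrier T" and y: "y \<in> carrier T" for x y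
  proof -
    obtain n l m k where nl: "n \<in> N" "l \<in> L" "x = n \<oplus>\<^bsub>T\<^esub> l" and mk: "m \<in> N" "k \<in> L" "y = m \<oplus>\<^bsub>T\<^esub> k"
      using split[OF x] split[OF y] by blast
    have "x \<oplus>\<^bsub>T\<^esub> y = (n \<oplus>\<^bsub>T\<^esub> m) \<oplus>\<^bsub>T\<^esub> (l \<oplus>\<^bsub>T\<^esub> k)"
      using nl mk NT LT by (simp add: M.a_ac)
    then have "p (x \<oplus>\<^bsub>T\<^esub> y) = n \<oplus>\<^bsub>T\<^esub> m" by (rule p[OF Ns(3)[OF nl(1) mk(1)] Ls(3)[OF nl(2) mk(2)]])
    then show ?thesis unfolding p[OF nl] p[OF mk] .
  qed
  have p_smult: "p (r \<odot>\<^bsub>T\<^esub> x) = r \<odot>\<^bsub>T\<^esub> p x" if r: "r \<in> carrier K" and x: "x \<in> carrier T" for r x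
  proof -
    obtain n l where nl: "n \<in> N" "l \<in> L" "x = n \<oplus>\<^bsub>T\<^esub> l" using split[OF x] by blast
    have "r \<odot>\<^bsub>T\<^esub> x = r \<odot>\<^bsub>T\<^esub> n \<oplus>\<^bsub>T\<^esub> r \<odot>\<^bsub>T\<^esub> l" using nl NT LT r by (simp add: smult_r_distr)
    then have "p (r \<odot>\<^bsub>T\<^esub> x) = r \<odot>\<^bsub>T\<^esub> n" by (rule p[OF Ns(4)[OF r nl(1)] Ls(4)[OF r nl(2)]])
    then show ?thesis unfolding p[OF nl] .
  qed
  define \<rho> where "\<rho> x = (\<Oplus>\<^bsub>T\<^esub>a\<in>?A. int_emb (w a) \<odot>\<^bsub>T\<^esub> act (fst a) (p (act (snd a) x)))" for x
  have term_closed: "act (fst a) (p (act (snd a) x)) \<in> carrier T" if "a \<in> ?A" "x \<in> carrier T" for a x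
    using that pT by auto
  have \<rho>T: "\<rho> x \<in> carrier T" if "x \<in> carrier T" for x
    unfolding \<rho>_def using that term_closed by (intro M.finsum_closed) auto
  have \<rho>N: "\<rho> x \<in> N" if x: "x \<in> carrier T" for x
  proof -
    have "(\<Oplus>\<^bsub>T\<^esub>a\<in>S. int_emb (w a) \<odot>\<^bsub>T\<^esub> act (fst a) (p (act (snd a) x))) \<in> N" if "S \<subseteq> ?A" for S
      using finite_subset[OF that finA] that
    proof (induction S rule: finite_induct)
      case empty
      then show ?case using Ns(2) by simp
    next
      case (insert a S)
      have "int_emb (w a) \<odot>\<^bsub>T\<^esub> act (fst a) (p (act (snd a) x)) \<in> N"
        using insert.prems x pN Nact by (intro Ns(4)) auto
      moreover have "(\<Oplus>\<^bsub>T\<^esub>a\<in>insert a S. int_emb (w a) \<odot>\<^bsub>T\<^esub> act (fst a) (p (act (snd a) x))) =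
          int_emb (w a) \<odot>\<^bsub>T\<^esub> act (fst a) (p (act (snd a) x)) \<oplus>\<^bsub>T\<^esub>
          (\<Oplus>\<^bsub>T\<^esub>a\<in>S. int_emb (w a) \<odot>\<^bsub>T\<^esub> act (fst a) (p (act (snd a) x)))"
        using insert.hyps insert.prems term_closed[OF _ x] by (intro M.finsum_insert) auto
      ultimately show ?case using insert Ns(3) by simp
    qed
    then show ?thesis unfolding \<rho>_def by blast
  qed
  have \<rho>_add: "\<rho> (x \<oplus>\<^bsub>T\<^esub> y) = \<rho> x \<oplus>\<^bsub>T\<^esub> \<rho> y" if x: "x \<in> carrier T" and y: "y \<in> carrier T" for x y
  proof -
    have "\<rho> (x \<oplus>\<^bsub>T\<^esub> y) = (\<Oplus>\<^bsub>T\<^esub>a\<in>?A. int_emb (w a) \<odot>\<^bsub>T\<^esub> act (fst a) (p (act (snd a) x)) \<oplus>\<^bsub>T\<^esub>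
        int_emb (w a) \<odot>\<^bsub>T\<^esub> act (fst a) (p (act (snd a) y)))"
      unfolding \<rho>_def using x y term_closed pT
      by (intro M.finsum_cong') (auto simp: act_add p_add smult_r_distr)
    also have "\<dots> = \<rho> x \<oplus>\<^bsub>T\<^esub> \<rho> y"
      unfolding \<rho>_def using x y term_closed by (intro M.finsum_addf) auto
    finally show ?thesis .
  qed
  have \<rho>_smult: "\<rho> (r \<odot>\<^bsub>T\<^esub> x) = r \<odot>\<^bsub>T\<^esub> \<rho> x" if r: "r \<in> carrier K" and x: "x \<in> carrier T" for r x
  proof -
    have "\<rho> (r \<odot>\<^bsub>T\<^esub> x) = (\<Oplus>\<^bsub>T\<^esub>a\<in>?A. r \<odot>\<^bsub>T\<^esub> (int_emb (w a) \<odot>\<^bsub>T\<^esub> act (fst a) (p (act (snd a) x))))"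
      unfolding \<rho>_def
    proof (rule M.finsum_cong'[OF refl])
      fix a assume a: "a \<in> ?A"
      then have "act (fst a) (p (act (snd a) (r \<odot>\<^bsub>T\<^esub> x))) = r \<odot>\<^bsub>T\<^esub> act (fst a) (p (act (snd a) x))"
        using r x pT by (auto simp: act_smult p_smult)
      moreover have "int_emb (w a) \<odot>\<^bsub>T\<^esub> (r \<odot>\<^bsub>T\<^esub> z) = r \<odot>\<^bsub>T\<^esub> (int_emb (w a) \<odot>\<^bsub>T\<^esub> z)" if "z \<in> carrier T" for z
        using r that by (simp add: smult_assoc1[symmetric] R.m_comm)
      ultimately show "int_emb (w a) \<odot>\<^bsub>T\<^esub> act (fst a) (p (act (snd a) (r \<odot>\<^bsub>T\<^esub> x))) =
          r \<odot>\<^bsub>T\<^esub> (int_emb (w a) \<odot>\<^bsub>T\<^esub> act (fst a) (p (act (snd a) x)))"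
        using term_closed[OF a x] by simp
    qed (use r x term_closed in auto)
    also have "\<dots> = r \<odot>\<^bsub>T\<^esub> \<rho> x"
      unfolding \<rho>_def using r x term_closed finA by (intro finsum_smult_ldistr[symmetric]) auto
    finally show ?thesis .
  qed
  have \<rho>_act: "\<rho> (act y x) = act y (\<rho> x)" if y: "y \<in> carrier G" and x: "x \<in> carrier T" for y x
  proof -
    let ?\<Theta> = "\<lambda>b. act (fst b) (p (act (snd b) x))"
    have "act y (\<rho> x) = (\<Oplus>\<^bsub>T\<^esub>a\<in>?A. int_emb (w a) \<odot>\<^bsub>T\<^esub> ?\<Theta> (y \<otimes>\<^bsub>G\<^esub> fst a, snd a))"
    proof -
      interpret h: mod_hom K T T "act y"
        by unfold_locales (rule act_hom[OF y])
      have "act y (\<Oplus>\<^bsub>T\<^esub>a\<in>S. int_emb (w a) \<odot>\<^bsub>T\<^esub> ?\<Theta> a) = (\<Oplus>\<^bsub>T\<^esub>a\<in>S. int_emb (w a) \<odot>\<^bsub>T\<^esub> ?\<Theta> (y \<otimes>\<^bsub>G\<^esub> fst a, snd a))"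
        if "S \<subseteq> ?A" for S
        using finite_subset[OF that finA] that
      proof (induction S rule: finite_induct)
        case empty
        then show ?case by simp
      next
        case (insert a S)
        have a: "a \<in> ?A" "fst a \<in> carrier G" "snd a \<in> carrier G" and S: "S \<subseteq> ?A" using insert.prems by auto
        have t: "?\<Theta> b \<in> carrier T" if "b \<in> ?A" for b using term_closed[OF that x] .
        have t': "?\<Theta> (y \<otimes>\<^bsub>G\<^esub> fst b, snd b) \<in> carrier T" if "b \<in> ?A" for b
          using that y x pT by auto
        have "act y (\<Oplus>\<^bsub>T\<^esub>a\<in>insert a S. int_emb (w a) \<odot>\<^bsub>T\<^esub> ?\<Theta> a) =
            act y (int_emb (w a) \<odot>\<^bsub>T\<^esub> ?\<Theta> a \<oplus>\<^bsub>T\<^esub> (\<Oplus>\<^bsub>T\<^esub>a\<in>S. int_emb (w a) \<odot>\<^bsub>T\<^esub> ?\<Theta> a))"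
          using insert.hyps t a S by (subst M.finsum_insert) auto
        also have "\<dots> = int_emb (w a) \<odot>\<^bsub>T\<^esub> act y (?\<Theta> a) \<oplus>\<^bsub>T\<^esub> act y (\<Oplus>\<^bsub>T\<^esub>a\<in>S. int_emb (w a) \<odot>\<^bsub>T\<^esub> ?\<Theta> a)"
        proof -
          have "(\<Oplus>\<^bsub>T\<^esub>a\<in>S. int_emb (w a) \<odot>\<^bsub>T\<^esub> ?\<Theta> a) \<in> carrier T"
            using t S by (intro M.finsum_closed) auto
          then show ?thesis using t[OF a(1)] y by (simp add: act_add act_smult)
        qed
        also have "act y (?\<Theta> a) = ?\<Theta> (y \<otimes>\<^bsub>G\<^esub> fst a, snd a)"
          using y a x pT by (simp add: act_mult)
        also have "act y (\<Oplus>\<^bsub>T\<^esub>a\<in>S. int_emb (w a) \<odot>\<^bsub>T\<^esub> ?\<Theta> a) =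
            (\<Oplus>\<^bsub>T\<^esub>a\<in>S. int_emb (w a) \<odot>\<^bsub>T\<^esub> ?\<Theta> (y \<otimes>\<^bsub>G\<^esub> fst a, snd a))"
          by (rule insert.IH[OF S])
        also have "int_emb (w a) \<odot>\<^bsub>T\<^esub> ?\<Theta> (y \<otimes>\<^bsub>G\<^esub> fst a, snd a) \<oplus>\<^bsub>T\<^esub>
            (\<Oplus>\<^bsub>T\<^esub>a\<in>S. int_emb (w a) \<odot>\<^bsub>T\<^esub> ?\<Theta> (y \<otimes>\<^bsub>G\<^esub> fst a, snd a)) =
            (\<Oplus>\<^bsub>T\<^esub>a\<in>insert a S. int_emb (w a) \<odot>\<^bsub>T\<^esub> ?\<Theta> (y \<otimes>\<^bsub>G\<^esub> fst a, snd a))"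
          using insert.hyps t' a S by (intro M.finsum_insert[symmetric]) auto
        finally show ?case .
      qed
      from this[OF subset_refl] show ?thesis unfolding \<rho>_def .
    qed
    also have "\<dots> = (\<Oplus>\<^bsub>T\<^esub>b\<in>?A. int_emb (\<Sum>a | a \<in> ?A \<and> (y \<otimes>\<^bsub>G\<^esub> fst a, snd a) = b. w a) \<odot>\<^bsub>T\<^esub> ?\<Theta> b)"
      by (rule finsum_fibres[OF finA finA]) (use y term_closed[OF _ x] in auto)
    also have "\<dots> = (\<Oplus>\<^bsub>T\<^esub>b\<in>?A. int_emb (\<Sum>a | a \<in> ?A \<and> (fst a, snd a \<otimes>\<^bsub>G\<^esub> y) = b. w a) \<odot>\<^bsub>T\<^esub> ?\<Theta> b)"
      by (simp only: w[OF y])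
    also have "\<dots> = (\<Oplus>\<^bsub>T\<^esub>a\<in>?A. int_emb (w a) \<odot>\<^bsub>T\<^esub> ?\<Theta> (fst a, snd a \<otimes>\<^bsub>G\<^esub> y))"
      by (rule finsum_fibres[OF finA finA, symmetric]) (use y term_closed[OF _ x] in auto)
    also have "\<dots> = \<rho> (act y x)"
      unfolding \<rho>_def using y x term_closed pT by (intro M.finsum_cong') (auto simp: act_mult)
    finally show ?thesis ..
  qed
  have \<rho>_on_N: "\<rho> n = int_emb D \<odot>\<^bsub>T\<^esub> n" if n: "n \<in> N" for n
  proof -
    have nT: "n \<in> carrier T" using NT n by blast
    have "\<rho> n = (\<Oplus>\<^bsub>T\<^esub>a\<in>?A. int_emb (w a) \<odot>\<^bsub>T\<^esub> act (fst a \<otimes>\<^bsub>G\<^esub> snd a) n)"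
      unfolding \<rho>_def using nT n p_id Nact by (intro M.finsum_cong') (auto simp: act_mult)
    also have "\<dots> = (\<Oplus>\<^bsub>T\<^esub>h\<in>carrier G. int_emb (\<Sum>a | a \<in> ?A \<and> fst a \<otimes>\<^bsub>G\<^esub> snd a = h. w a) \<odot>\<^bsub>T\<^esub> act h n)"
      by (rule finsum_fibres[OF finA finG]) (use nT in auto)
    also have "\<dots> = (\<Oplus>\<^bsub>T\<^esub>h\<in>carrier G. if \<one>\<^bsub>G\<^esub> = h then int_emb D \<odot>\<^bsub>T\<^esub> act h n else \<zero>\<^bsub>T\<^esub>)"
      unfolding w1 by (rule M.finsum_cong'[OF refl]) (use nT in simp_all)
    also have "\<dots> = int_emb D \<odot>\<^bsub>T\<^esub> act \<one>\<^bsub>G\<^esub> n"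
      using nT finG by (intro M.finsum_singleton) auto
    finally show ?thesis using act_one nT by simp
  qed
  have D0: "int_emb D \<noteq> \<zero>\<^bsub>K\<^esub>"
    using char0[of "nat D"] D by (simp add: add_pow_int_ge)
  define d where "d = inv\<^bsub>K\<^esub> (int_emb D)"
  have d: "d \<in> carrier K" "d \<otimes>\<^bsub>K\<^esub> int_emb D = \<one>\<^bsub>K\<^esub>"
    using D0 field_Units by (auto simp: d_def)
  define C where "C = {x \<in> carrier T. \<rho> x = \<zero>\<^bsub>T\<^esub>}"
  have \<rho>0: "\<rho> \<zero>\<^bsub>T\<^esub> = \<zero>\<^bsub>T\<^esub>" using \<rho>_on_N[OF Ns(2)] by simp
  have CS: "submodule K C T"
    by (rule submodule.intro) (auto simp: C_def \<rho>0 \<rho>_add \<rho>_smult module_axioms)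
  have "stable C"
    unfolding stable_def by (intro conjI ballI CS) (simp add: C_def \<rho>_act act_zero)
  moreover have "complementary N C"
    unfolding complementary_def
  proof (intro conjI ballI NS CS)
    show "N \<inter> C = {\<zero>\<^bsub>T\<^esub>}"
    proof (intro equalityI subsetI)
      fix n assume "n \<in> N \<inter> C"
      then have n: "n \<in> N" "n \<in> carrier T" "int_emb D \<odot>\<^bsub>T\<^esub> n = \<zero>\<^bsub>T\<^esub>"
        using \<rho>_on_N by (auto simp: C_def)
      have "n = (d \<otimes>\<^bsub>K\<^esub> int_emb D) \<odot>\<^bsub>T\<^esub> n" using d n by simp
      also have "\<dots> = d \<odot>\<^bsub>T\<^esub> (int_emb D \<odot>\<^bsub>T\<^esub> n)"
        by (rule smult_assoc1[OF d(1) int_emb_closed n(2)])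
      also have "\<dots> = \<zero>\<^bsub>T\<^esub>" unfolding n(3) by (rule rmult_0[OF d(1)])
      finally show "n \<in> {\<zero>\<^bsub>T\<^esub>}" by simp
    qed (use Ns(2) submoduleD(2)[OF CS] in auto)
  next
    fix x assume x: "x \<in> carrier T"
    let ?n = "d \<odot>\<^bsub>T\<^esub> \<rho> x"
    have n: "?n \<in> N" using \<rho>N[OF x] d Ns(4) by simp
    have nT: "?n \<in> carrier T" using NT n by blast
    let ?c = "x \<oplus>\<^bsub>T\<^esub> (\<ominus>\<^bsub>K\<^esub> \<one>\<^bsub>K\<^esub>) \<odot>\<^bsub>T\<^esub> ?n"
    have "\<rho> ?n = (int_emb D \<otimes>\<^bsub>K\<^esub> d) \<odot>\<^bsub>T\<^esub> \<rho> x"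
      using \<rho>_on_N[OF n] d \<rho>T[OF x] by (simp only: smult_assoc1 int_emb_closed)
    also have "\<dots> = \<rho> x" using d \<rho>T[OF x] by (subst R.m_comm) auto
    finally have "\<rho> ?n = \<rho> x" .
    moreover have m1: "\<ominus>\<^bsub>K\<^esub> \<one>\<^bsub>K\<^esub> \<in> carrier K" by simp
    have "\<rho> ?c = \<rho> x \<oplus>\<^bsub>T\<^esub> (\<ominus>\<^bsub>K\<^esub> \<one>\<^bsub>K\<^esub>) \<odot>\<^bsub>T\<^esub> \<rho> ?n"
      using \<rho>_add[OF x smult_closed[OF m1 nT]] \<rho>_smult[OF m1 nT] by (simp only:)
    ultimately have "\<rho> ?c = \<rho> x \<oplus>\<^bsub>T\<^esub> \<ominus>\<^bsub>T\<^esub> \<rho> x"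
      using smult_minus_1[OF \<rho>T[OF x]] by (simp only:)
    then have "\<rho> ?c = \<zero>\<^bsub>T\<^esub>" using M.r_neg[OF \<rho>T[OF x]] by (simp only:)
    then have "?c \<in> C" using x nT by (simp add: C_def)
    moreover have "x = ?n \<oplus>\<^bsub>T\<^esub> ?c"
      using x nT unfolding smult_minus_1[OF nT] by (simp add: M.a_lcomm[of ?n] M.r_neg)
    ultimately show "\<exists>n\<in>N. \<exists>c\<in>C. x = n \<oplus>\<^bsub>T\<^esub> c" using n by blast
  qed
  ultimately show ?thesis by blast
qed

lemma stable_submodule: "stable N \<Longrightarrow> submodule K N T"
  by (simp add: stable_def)

lemma stable_act: "stable N \<Longrightarrow> f \<in> carrier G \<Longrightarrow> x \<in> N \<Longrightarrow> act f x \<in> N"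
  by (simp add: stable_def)

lemma stable_Int:
  assumes N: "stable N" and C: "stable C"
  shows "stable (N \<inter> C)"
proof -
  note n = submoduleD[OF stable_submodule[OF N]] and c = submoduleD[OF stable_submodule[OF C]]
  have "submodule K (N \<inter> C) T"
    by (rule submodule.intro) (use n c module_axioms in auto)
  then show ?thesis using stable_act[OF N] stable_act[OF C] by (simp add: stable_def)
qed

lemma stable_sum:
  assumes N: "stable N" and C: "stable C"
  shows "stable {n \<oplus>\<^bsub>T\<^esub> c | n c. n \<in> N \<and> c \<in> C}" (is "stable ?S")
proof -
  note n = submoduleD[OF stable_submodule[OF N]] and c = submoduleD[OF stable_submodule[OF C]]
  have NT: "\<And>x. x \<in> N \<Longrightarrow> x \<in> carrier T" and CT: "\<And>x. x \<in> C \<Longrightarrow> x \<in> carrier T"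
    using n(1) c(1) by auto
  have "submodule K ?S T"
  proof (rule submodule.intro)
    show "module K T" by (rule module_axioms)
    show "?S \<subseteq> carrier T" using NT CT by auto
    have "\<zero>\<^bsub>T\<^esub> = \<zero>\<^bsub>T\<^esub> \<oplus>\<^bsub>T\<^esub> \<zero>\<^bsub>T\<^esub>" by simp
    then show "\<zero>\<^bsub>T\<^esub> \<in> ?S" using n(2) c(2) by blast
  next
    fix u v assume "u \<in> ?S" "v \<in> ?S"
    then obtain a b a' b' where ab: "a \<in> N" "b \<in> C" "u = a \<oplus>\<^bsub>T\<^esub> b" "a' \<in> N" "b' \<in> C" "v = a' \<oplus>\<^bsub>T\<^esub> b'"
      by blast
    have "u \<oplus>\<^bsub>T\<^esub> v = (a \<oplus>\<^bsub>T\<^esub> a') \<oplus>\<^bsub>T\<^esub> (b \<oplus>\<^bsub>T\<^esub> b')" using ab NT CT by (simp add: M.a_ac)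
    then show "u \<oplus>\<^bsub>T\<^esub> v \<in> ?S" using n(3)[OF ab(1,4)] c(3)[OF ab(2,5)] by blast
  next
    fix r u assume r: "r \<in> carrier K" and "u \<in> ?S"
    then obtain a b where ab: "a \<in> N" "b \<in> C" "u = a \<oplus>\<^bsub>T\<^esub> b" by blast
    have "r \<odot>\<^bsub>T\<^esub> u = r \<odot>\<^bsub>T\<^esub> a \<oplus>\<^bsub>T\<^esub> r \<odot>\<^bsub>T\<^esub> b" using ab NT CT r by (simp add: smult_r_distr)
    then show "r \<odot>\<^bsub>T\<^esub> u \<in> ?S" using n(4)[OF r ab(1)] c(4)[OF r ab(2)] by blast
  qed
  moreover have "act f u \<in> ?S" if f: "f \<in> carrier G" and u: "u \<in> ?S" for f u
  proof -
    obtain a b where ab: "a \<in> N" "b \<in> C" "u = a \<oplus>\<^bsub>T\<^esub> b" using u by blast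
    have "act f u = act f a \<oplus>\<^bsub>T\<^esub> act f b" using ab NT CT f by (simp add: act_add)
    then show ?thesis using stable_act[OF N f ab(1)] stable_act[OF C f ab(2)] by blast
  qed
  ultimately show ?thesis by (simp add: stable_def)
qed

definition simple_stable :: "'w set \<Rightarrow> bool" where
  "simple_stable C \<longleftrightarrow> stable C \<and> C \<noteq> {\<zero>\<^bsub>T\<^esub>} \<and> (\<forall>D. stable D \<and> D \<subseteq> C \<longrightarrow> D = {\<zero>\<^bsub>T\<^esub>} \<or> D = C)"

text \<open>
  Let \<open>P\<close> be maximal among the stable submodules that contain \<open>P0\<close> but not \<open>x\<close>, and let \<open>C\<close> be a stable
  complement of \<open>P\<close>.  If \<open>D\<close> were a stable submodule of \<open>C\<close> other than \<open>0\<close> and \<open>C\<close>, it would have a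
  nonzero stable complement \<open>E\<close> in \<open>C\<close>.  By maximality both \<open>P + D\<close> and \<open>P + E\<close> contain \<open>x\<close>; but these
  meet in \<open>P\<close>.
\<close>
theorem simple_stable_outside:
  assumes compl: "\<And>N. stable N \<Longrightarrow> \<exists>C. stable C \<and> complementary N C"
    and P0: "stable P0" and x: "x \<in> carrier T" "x \<notin> P0"
  shows "\<exists>C. simple_stable C \<and> P0 \<inter> C = {\<zero>\<^bsub>T\<^esub>}"
proof -
  define \<A> where "\<A> = {P. stable P \<and> P0 \<subseteq> P \<and> x \<notin> P}"
  have "P0 \<in> \<A>" using P0 x by (simp add: \<A>_def)
  moreover have "\<Union>\<C> \<in> \<A>" if ne: "\<C> \<noteq> {}" and ch: "subset.chain \<A> \<C>" for \<C>
  proof -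
    have sub: "stable P" "P0 \<subseteq> P" "x \<notin> P" if "P \<in> \<C>" for P
      using ch that by (auto simp: subset.chain_def \<A>_def)
    have "submodule K (\<Union>\<C>) T"
      by (rule submodule_chain_Union[OF ne ch]) (rule stable_submodule[OF sub(1)])
    moreover have "\<forall>f\<in>carrier G. \<forall>x\<in>\<Union>\<C>. act f x \<in> \<Union>\<C>"
      using stable_act[OF sub(1)] by blast
    ultimately have "stable (\<Union>\<C>)" unfolding stable_def by blast
    moreover have "P0 \<subseteq> \<Union>\<C>" "x \<notin> \<Union>\<C>" using ne sub(2,3) by blast+
    ultimately show ?thesis by (simp add: \<A>_def)
  qed
  ultimately obtain P where PA: "P \<in> \<A>" and max: "\<And>X. X \<in> \<A> \<Longrightarrow> P \<subseteq> X \<Longrightarrow> X = P"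
    using subset_Zorn_nonempty[of \<A>] by blast
  then have P: "stable P" "P0 \<subseteq> P" "x \<notin> P" by (auto simp: \<A>_def)
  note p = submoduleD[OF stable_submodule[OF P(1)]]
  obtain C where C: "stable C" and PC: "complementary P C" using compl[OF P(1)] by blast
  note c = submoduleD[OF stable_submodule[OF C]]
  have PC0: "P \<inter> C = {\<zero>\<^bsub>T\<^esub>}" using PC by (simp add: complementary_def)
  have xsum: "\<exists>q\<in>P. \<exists>d\<in>D. x = q \<oplus>\<^bsub>T\<^esub> d" if D: "stable D" "D \<subseteq> C" "D \<noteq> {\<zero>\<^bsub>T\<^esub>}" for D
  proof (rule ccontr)
    assume no: "\<not> ?thesis"
    note d = submoduleD[OF stable_submodule[OF D(1)]]
    let ?S = "{n \<oplus>\<^bsub>T\<^esub> c | n c. n \<in> P \<and> c \<in> D}"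
    have S: "stable ?S" by (rule stable_sum[OF P(1) D(1)])
    have PS: "P \<subseteq> ?S"
    proof
      fix q assume q: "q \<in> P"
      then have "q = q \<oplus>\<^bsub>T\<^esub> \<zero>\<^bsub>T\<^esub>" using p(1) by auto
      then show "q \<in> ?S" using q d(2) by blast
    qed
    have "x \<notin> ?S" using no by blast
    then have "?S \<in> \<A>" using S PS P(2) unfolding \<A>_def by blast
    then have SP: "?S = P" using PS by (rule max)
    have "D \<subseteq> P"
    proof
      fix y assume y: "y \<in> D"
      then have "y = \<zero>\<^bsub>T\<^esub> \<oplus>\<^bsub>T\<^esub> y" using d(1) by auto
      then show "y \<in> P" using y p(2) SP by blast
    qed
    then have "D \<subseteq> {\<zero>\<^bsub>T\<^esub>}" using D(2) PC0 by blast
    then show False using D(3) d(2) by blast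
  qed
  have "C \<noteq> {\<zero>\<^bsub>T\<^esub>}"
  proof
    assume C0: "C = {\<zero>\<^bsub>T\<^esub>}"
    obtain q d where "q \<in> P" "d \<in> C" "x = q \<oplus>\<^bsub>T\<^esub> d" using PC x(1) unfolding complementary_def by blast
    then have "x \<in> P" using C0 p(1) by auto
    then show False using P(3) by blast
  qed
  moreover have "D = {\<zero>\<^bsub>T\<^esub>} \<or> D = C" if D: "stable D" "D \<subseteq> C" for D
  proof (rule ccontr)
    assume no: "\<not> ?thesis"
    note d = submoduleD[OF stable_submodule[OF D(1)]]
    obtain D' where D': "stable D'" and DD': "complementary D D'" using compl[OF D(1)] by blast
    define E where "E = D' \<inter> C"
    have E: "stable E" "E \<subseteq> C" unfolding E_def using stable_Int[OF D' C] by auto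
    note d' = submoduleD[OF stable_submodule[OF D']]
    have "E \<noteq> {\<zero>\<^bsub>T\<^esub>}"
    proof
      assume E0: "E = {\<zero>\<^bsub>T\<^esub>}"
      have "C \<subseteq> D"
      proof
        fix y assume y: "y \<in> C"
        then obtain a b where ab: "a \<in> D" "b \<in> D'" "y = a \<oplus>\<^bsub>T\<^esub> b"
          using DD' c(1) unfolding complementary_def by blast
        have aT: "a \<in> carrier T" and bT: "b \<in> carrier T" using ab d(1) d'(1) by auto
        have "b = y \<ominus>\<^bsub>T\<^esub> a" unfolding ab(3) a_minus_def
          using aT bT by (simp add: M.a_comm[of a] M.a_assoc M.r_neg)
        moreover have "y \<ominus>\<^bsub>T\<^esub> a \<in> C" using c(5)[OF y] ab(1) D(2) by blast
        ultimately have "b \<in> E" unfolding E_def using ab(2) by blast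
        then have "b = \<zero>\<^bsub>T\<^esub>" using E0 by blast
        then have "y = a" using ab(3) aT by simp
        then show "y \<in> D" using ab(1) by simp
      qed
      then show False using D(2) no by blast
    qed
    then obtain q e where qe: "q \<in> P" "e \<in> E" "x = q \<oplus>\<^bsub>T\<^esub> e" using xsum[OF E] by blast
    obtain q' y where qy: "q' \<in> P" "y \<in> D" "x = q' \<oplus>\<^bsub>T\<^esub> y" using xsum[OF D] no by blast
    have eC: "e \<in> C" "y \<in> C" using qe qy E(2) D(2) by auto
    have "q \<oplus>\<^bsub>T\<^esub> e = q' \<oplus>\<^bsub>T\<^esub> y" using qe(3) qy(3) by (rule trans[OF sym])
    then have "e = y" by (rule complementary_unique(2)[OF PC qe(1) qy(1) eC])
    then have "e \<in> D \<inter> D'" using qy(2) qe(2) unfolding E_def by blast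
    then have "e = \<zero>\<^bsub>T\<^esub>" using DD' unfolding complementary_def by blast
    moreover have "q \<in> carrier T" using qe(1) p(1) by blast
    ultimately have "x = q" using qe(3) by simp
    then show False using qe(1) P(3) by blast
  qed
  ultimately have "simple_stable C" unfolding simple_stable_def using C by blast
  moreover have "P0 \<inter> C = {\<zero>\<^bsub>T\<^esub>}"
    using P(2) PC0 submoduleD(2)[OF stable_submodule[OF P0]] c(2) by blast
  ultimately show ?thesis by blast
qed

end

section \<open>Subfunctors\<close>

abbreviation vec :: "('f, 'm) ring_scheme \<Rightarrow> ('f, 'v) module set" where
  "vec F \<equiv> Ob (fin_dim_category F)"

abbreviation Lin :: "('f, 'm) ring_scheme \<Rightarrow> ('f, 'v) module \<Rightarrow> ('f, 'v) module \<Rightarrow> ('v \<Rightarrow> 'v) set" where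
  "Lin F \<equiv> Mor (fin_dim_category F)"

lemma vec_iff: "V \<in> vec F \<longleftrightarrow> vectorspace F V \<and> vectorspace.fin_dim F V"
  by (simp add: fin_dim_category_def)

lemma hom_iff: "f \<in> Lin F V W \<longleftrightarrow> f \<in> module_hom F V W \<and> f \<in> extensional (carrier V)"
  by (simp add: fin_dim_category_def module_category_def)

lemma Cmp_vec: "Cmp (fin_dim_category F) U V W g f = compose (carrier U) g f"
  by (simp add: fin_dim_category_def module_category_def)

lemma Idn_vec: "Idn (fin_dim_category F) V = (\<lambda>x\<in>carrier V. x)"
  by (simp add: fin_dim_category_def module_category_def)

lemma hom_closed: "f \<in> Lin F V W \<Longrightarrow> x \<in> carrier V \<Longrightarrow> f x \<in> carrier W"
  unfolding hom_iff by (blast dest: module_hom_closed)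

lemma hom_compose:
  assumes "f \<in> Lin F U V" "g \<in> Lin F V W" "U \<in> vec F"
  shows "compose (carrier U) g f \<in> Lin F U W"
proof -
  interpret U: vectorspace F U using assms(3) by (simp add: vec_iff)
  show ?thesis
    unfolding hom_iff module_hom_def
    using assms(1,2) by (auto simp: compose_def hom_iff module_hom_closed[THEN funcset_mem] module_hom_add module_hom_smult)
qed

lemma End_hom: "carrier (End F V) = Lin F V V" "mult (End F V) = compose (carrier V)"
  "one (End F V) = (\<lambda>x\<in>carrier V. x)"
  by (auto simp: End_def hom_iff)

lemma retract_of_card_le:
  assumes "coordinates F V B \<xi>" "coordinates F W B' \<xi>'" and le: "card B \<le> card B'"
  shows "\<exists>i\<in>Lin F V W. \<exists>r\<in>Lin F W V. \<forall>x\<in>carrier V. r (i x) = x"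
proof -
  interpret V: coordinates F V B \<xi> by fact
  interpret W: coordinates F W B' \<xi>' by fact
  obtain \<sigma> where inj: "inj_on \<sigma> B" and \<sigma>: "\<sigma> ` B \<subseteq> B'"
    using card_le_inj[OF V.finite_B W.finite_B le] by blast
  have \<sigma>B: "\<sigma> b \<in> B'" if "b \<in> B" for b using \<sigma> that by blast
  define i where "i = (\<lambda>x\<in>carrier V. \<Oplus>\<^bsub>W\<^esub>b\<in>B. \<xi> b x \<odot>\<^bsub>W\<^esub> \<sigma> b)"
  define r where "r = (\<lambda>y\<in>carrier W. \<Oplus>\<^bsub>V\<^esub>b\<in>B. \<xi>' (\<sigma> b) y \<odot>\<^bsub>V\<^esub> b)"
  have i: "i \<in> Lin F V W"
    unfolding hom_iff i_def
    by (intro conjI W.coordinate_map_hom V.finite_B V.module_axioms)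
      (use \<sigma>B in \<open>auto simp: V.\<xi>_add V.\<xi>_smult\<close>)
  have r: "r \<in> Lin F W V"
    unfolding hom_iff r_def
    by (intro conjI V.coordinate_map_hom V.finite_B W.module_axioms)
      (use \<sigma>B in \<open>auto simp: W.\<xi>_add W.\<xi>_smult\<close>)
  have "r (i x) = x" if x: "x \<in> carrier V" for x
  proof -
    have co: "\<xi>' (\<sigma> b) (i x) = \<xi> b x" if b: "b \<in> B" for b
    proof -
      have "\<xi>' (\<sigma> b) (i x) = (\<Oplus>\<^bsub>F\<^esub>c\<in>B. \<xi> c x \<otimes>\<^bsub>F\<^esub> \<xi>' (\<sigma> b) (\<sigma> c))"
        unfolding i_def using x b \<sigma>B V.finite_B
        by (simp, intro W.functional_finsum) (auto simp: W.\<xi>_add W.\<xi>_smult)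
      also have "\<dots> = (\<Oplus>\<^bsub>F\<^esub>c\<in>B. if b = c then \<xi> c x else \<zero>\<^bsub>F\<^esub>)"
        using x b \<sigma>B inj by (intro V.R.finsum_cong') (auto simp: W.\<xi>_delta inj_on_eq_iff)
      also have "\<dots> = \<xi> b x"
        using x b V.finite_B by (intro V.R.finsum_singleton) auto
      finally show ?thesis .
    qed
    have "r (i x) = (\<Oplus>\<^bsub>V\<^esub>b\<in>B. \<xi>' (\<sigma> b) (i x) \<odot>\<^bsub>V\<^esub> b)"
      unfolding r_def using hom_closed[OF i x] by simp
    also have "\<dots> = (\<Oplus>\<^bsub>V\<^esub>b\<in>B. \<xi> b x \<odot>\<^bsub>V\<^esub> b)"
      using x co by (intro V.M.finsum_cong') auto
    also have "\<dots> = x" using V.expand[OF x] by simp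
    finally show ?thesis .
  qed
  then show ?thesis using i r by blast
qed

lemma retract_dichotomy:
  assumes "finite (carrier F)" "V \<in> vec F" "W \<in> vec F"
  shows "(\<exists>i\<in>Lin F V W. \<exists>r\<in>Lin F W V. \<forall>x\<in>carrier V. r (i x) = x) \<or>
    (\<exists>i\<in>Lin F W V. \<exists>r\<in>Lin F V W. \<forall>x\<in>carrier W. r (i x) = x)"
proof -
  obtain B \<xi> where V: "coordinates F V B \<xi>"
    using vectorspace.coordinates_exist assms unfolding vec_iff by blast
  obtain B' \<xi>' where W: "coordinates F W B' \<xi>'"
    using vectorspace.coordinates_exist assms unfolding vec_iff by blast
  show ?thesis
    using retract_of_card_le[OF V W] retract_of_card_le[OF W V] linear[of "card B" "card B'"] by blast
qed

locale functor_rep =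
  fixes F :: "('f, 'm) ring_scheme" and K :: "('k, 'n) ring_scheme" and T :: "('f, 'v, 'k, 'w) rep"
  assumes field_K: "field K"
    and T: "T \<in> functors (fin_dim_category F) (module_category K)"
begin

abbreviation "Tc V \<equiv> carrier (omap T V)"

lemma T_module: "V \<in> vec F \<Longrightarrow> module K (omap T V)"
  using T by (simp add: functors_def module_category_def)

lemma T_vectorspace: "V \<in> vec F \<Longrightarrow> vectorspace K (omap T V)"
  by (intro vectorspace.intro T_module field_K)

lemma T_hom:
  "V \<in> vec F \<Longrightarrow> W \<in> vec F \<Longrightarrow> f \<in> Lin F V W \<Longrightarrow>
    amap T V W f \<in> module_hom K (omap T V) (omap T W) \<inter> extensional (Tc V)"
  using T by (simp add: functors_def module_category_def)

lemma T_closed: "V \<in> vec F \<Longrightarrow> W \<in> vec F \<Longrightarrow> f \<in> Lin F V W \<Longrightarrow> x \<in> Tc V \<Longrightarrow> amap T V W f x \<in> Tc W"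
  using T_hom[of V W f] by (auto dest: module_hom_closed)

lemma T_mod_hom: "V \<in> vec F \<Longrightarrow> W \<in> vec F \<Longrightarrow> f \<in> Lin F V W \<Longrightarrow> mod_hom K (omap T V) (omap T W) (amap T V W f)"
  using T_hom[of V W f] T_module[of V] T_module[of W] by (simp add: mod_hom_def mod_hom_axioms_def)

lemma T_id: "V \<in> vec F \<Longrightarrow> x \<in> Tc V \<Longrightarrow> amap T V V (\<lambda>x\<in>carrier V. x) x = x"
  using T by (simp add: functors_def module_category_def Idn_vec)

lemma T_cmp:
  assumes "U \<in> vec F" "V \<in> vec F" "W \<in> vec F" "f \<in> Lin F U V" "g \<in> Lin F V W" "x \<in> Tc U"
  shows "amap T U W (compose (carrier U) g f) x = amap T V W g (amap T U V f x)"
proof -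
  have "amap T U W (Cmp (fin_dim_category F) U V W g f) =
      Cmp (module_category K) (omap T U) (omap T V) (omap T W) (amap T V W g) (amap T U V f)"
    using T assms unfolding functors_def by blast
  then show ?thesis using assms(6) by (simp add: Cmp_vec module_category_def compose_eq)
qed

lemma End_representation:
  assumes V: "V \<in> vec F"
  shows "monoid_representation K (omap T V) (End F V) (amap T V V)"
proof -
  interpret TV: vectorspace K "omap T V" by (rule T_vectorspace[OF V])
  interpret V: vectorspace F V using V by (simp add: vec_iff)
  show ?thesis
  proof (intro monoid_representation.intro monoid_representation_axioms.intro)
    show "vectorspace K (omap T V)" by (rule TV.vectorspace_axioms)
    show "monoid (End F V)" by (rule V.End_monoid)
  next
    fix f assume "f \<in> carrier (End F V)"
    then show "amap T V V f \<in> module_hom K (omap T V) (omap T V)"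
      using T_hom[OF V V, of f] by (simp add: End_hom)
  next
    fix f g x assume "f \<in> carrier (End F V)" "g \<in> carrier (End F V)" "x \<in> Tc V"
    then show "amap T V V (f \<otimes>\<^bsub>End F V\<^esub> g) x = amap T V V f (amap T V V g x)"
      using T_cmp[OF V V V] by (simp add: End_hom)
  next
    fix x assume "x \<in> Tc V"
    then show "amap T V V \<one>\<^bsub>End F V\<^esub> x = x" using T_id[OF V] by (simp add: End_hom)
  qed
qed

text \<open>
  Only the values of such a family at finite dimensional spaces matter.
\<close>
definition subfun :: "(('f, 'v) module \<Rightarrow> 'w set) \<Rightarrow> bool" where
  "subfun P \<longleftrightarrow> (\<forall>V\<in>vec F. submodule K (P V) (omap T V)) \<and>
    (\<forall>V\<in>vec F. \<forall>W\<in>vec F. \<forall>f\<in>Lin F V W. \<forall>x\<in>P V. amap T V W f x \<in> P W)"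

lemma subfun_submodule: "subfun P \<Longrightarrow> V \<in> vec F \<Longrightarrow> submodule K (P V) (omap T V)"
  by (simp add: subfun_def)

lemma subfun_closed: "subfun P \<Longrightarrow> V \<in> vec F \<Longrightarrow> W \<in> vec F \<Longrightarrow> f \<in> Lin F V W \<Longrightarrow> x \<in> P V \<Longrightarrow> amap T V W f x \<in> P W"
  by (simp add: subfun_def)

lemma subfun_sub: "subfun P \<Longrightarrow> V \<in> vec F \<Longrightarrow> P V \<subseteq> Tc V"
  using module.submoduleD(1)[OF T_module subfun_submodule] by blast

lemma subfun_zero: "subfun P \<Longrightarrow> V \<in> vec F \<Longrightarrow> \<zero>\<^bsub>omap T V\<^esub> \<in> P V"
  using module.submoduleD(2)[OF T_module subfun_submodule] by blast

lemma subfun_stable: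
  assumes P: "subfun P" and V: "V \<in> vec F"
  shows "monoid_representation.stable K (omap T V) (End F V) (amap T V V) (P V)"
  unfolding monoid_representation.stable_def[OF End_representation[OF V]]
  using subfun_submodule[OF P V] subfun_closed[OF P V V] by (simp add: End_hom)

text \<open>
  When the sets \<open>X V\<close> are closed under all maps, this is the subfunctor generated by them.
\<close>
definition spanned :: "(('f, 'v) module \<Rightarrow> 'w set) \<Rightarrow> ('f, 'v) module \<Rightarrow> 'w set" where
  "spanned X V = module.span K (omap T V) (X V)"

lemma spanned_least:
  assumes "V \<in> vec F" "submodule K N (omap T V)" "X V \<subseteq> N"
  shows "spanned X V \<subseteq> N"
  unfolding spanned_def
  by (rule module.span_is_subset[OF T_module[OF assms(1)] assms(3,2)])

lemma spanned_supset: "V \<in> vec F \<Longrightarrow> X V \<subseteq> Tc V \<Longrightarrow> X V \<subseteq> spanned X V"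
  unfolding spanned_def by (rule module.in_own_span[OF T_module])

lemma submodule_vimage:
  assumes V: "V \<in> vec F" and W: "W \<in> vec F" and f: "f \<in> Lin F V W" and N: "submodule K N (omap T W)"
  shows "submodule K {x \<in> Tc V. amap T V W f x \<in> N} (omap T V)"
proof -
  interpret h: mod_hom K "omap T V" "omap T W" "amap T V W f" by (rule T_mod_hom[OF V W f])
  note n = h.N.submoduleD[OF N]
  show ?thesis
    by (rule submodule.intro) (use n h.M.module_axioms in auto)
qed

lemma spanned_subfun:
  assumes X: "\<And>V. V \<in> vec F \<Longrightarrow> X V \<subseteq> Tc V"
    and cl: "\<And>V W f x. V \<in> vec F \<Longrightarrow> W \<in> vec F \<Longrightarrow> f \<in> Lin F V W \<Longrightarrow> x \<in> X V \<Longrightarrow> amap T V W f x \<in> X W"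
  shows "subfun (spanned X)"
  unfolding subfun_def
proof (intro conjI ballI)
  show sub: "submodule K (spanned X V) (omap T V)" if V: "V \<in> vec F" for V
    unfolding spanned_def by (rule module.span_is_submodule[OF T_module[OF V] X[OF V]])
  fix V W f x assume V: "V \<in> vec F" and W: "W \<in> vec F" and f: "f \<in> Lin F V W" and x: "x \<in> spanned X V"
  have "spanned X V \<subseteq> {x \<in> Tc V. amap T V W f x \<in> spanned X W}"
    using X[OF V] cl[OF V W f] spanned_supset[of W X, OF W X[OF W]]
    by (intro spanned_least[OF V] submodule_vimage[OF V W f sub[OF W]]) auto
  then show "amap T V W f x \<in> spanned X W" using x by blast
qed


definition orbit :: "('f, 'v) module \<Rightarrow> 'w set \<Rightarrow> ('f, 'v) module \<Rightarrow> 'w set" where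
  "orbit V C W = {amap T V W f c | f c. f \<in> Lin F V W \<and> c \<in> C}"

lemma id_Lin: "V \<in> vec F \<Longrightarrow> (\<lambda>x\<in>carrier V. x) \<in> Lin F V V"
  using vectorspace.axioms(1)[of F V] monoid.one_closed[OF module.End_monoid, of F V]
  by (simp add: vec_iff End_hom)

lemma compose_id:
  assumes "i \<in> Lin F W V" "\<And>x. x \<in> carrier W \<Longrightarrow> r (i x) = x"
  shows "compose (carrier W) r i = (\<lambda>x\<in>carrier W. x)"
  using assms by (auto simp: compose_def fun_eq_iff)

lemma T_retract:
  assumes "W \<in> vec F" "V \<in> vec F" "i \<in> Lin F W V" "r \<in> Lin F V W"
    and "\<And>x. x \<in> carrier W \<Longrightarrow> r (i x) = x" and x: "x \<in> Tc W"
  shows "amap T V W r (amap T W V i x) = x"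
  using T_cmp[OF assms(1,2,1,3,4) x] compose_id[OF assms(3,5)] T_id[OF assms(1) x] by simp

context
  fixes V :: "('f, 'v) module" and C :: "'w set"
  assumes V: "V \<in> vec F" and C: "monoid_representation.stable K (omap T V) (End F V) (amap T V V) C"
begin

lemma C_submodule: "submodule K C (omap T V)"
  by (rule monoid_representation.stable_submodule[OF End_representation[OF V] C])

lemma C_sub: "C \<subseteq> Tc V"
  by (rule module.submoduleD(1)[OF T_module[OF V] C_submodule])

lemma orbit_sub: "W \<in> vec F \<Longrightarrow> orbit V C W \<subseteq> Tc W"
  using T_closed[OF V] C_sub by (auto simp: orbit_def)

lemma generated_subfun: "subfun (spanned (orbit V C))"
proof (rule spanned_subfun)
  fix W U f x assume W: "W \<in> vec F" and U: "U \<in> vec F" and f: "f \<in> Lin F W U" and "x \<in> orbit V C W"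
  then obtain g c where g: "g \<in> Lin F V W" "c \<in> C" "x = amap T V W g c" by (auto simp: orbit_def)
  have "amap T W U f x = amap T V U (compose (carrier V) f g) c"
    using T_cmp[OF V W U g(1) f] g C_sub by auto
  then show "amap T W U f x \<in> orbit V C U"
    using hom_compose[OF g(1) f V] g(2) by (auto simp: orbit_def)
qed (rule orbit_sub)

lemma generated_at: "spanned (orbit V C) V = C"
proof
  have "orbit V C V \<subseteq> C"
    using monoid_representation.stable_act[OF End_representation[OF V] C] by (auto simp: orbit_def End_hom)
  then show "spanned (orbit V C) V \<subseteq> C" by (rule spanned_least[OF V C_submodule])
  have "C \<subseteq> orbit V C V"
  proof
    fix c assume c: "c \<in> C"
    then have "c = amap T V V (\<lambda>x\<in>carrier V. x) c" using T_id[OF V] C_sub by auto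
    then show "c \<in> orbit V C V" unfolding orbit_def using c id_Lin[OF V] by blast
  qed
  then show "C \<subseteq> spanned (orbit V C) V" using spanned_supset[of V "orbit V C", OF V orbit_sub[OF V]] by blast
qed

lemma generated_least:
  assumes N: "subfun N" and CN: "C \<subseteq> N V" and W: "W \<in> vec F"
  shows "spanned (orbit V C) W \<subseteq> N W"
proof (rule spanned_least[OF W subfun_submodule[OF N W]])
  show "orbit V C W \<subseteq> N W" using subfun_closed[OF N V W] CN by (auto simp: orbit_def)
qed

end

definition simple_sub :: "(('f, 'v) module \<Rightarrow> 'w set) \<Rightarrow> bool" where
  "simple_sub P \<longleftrightarrow> subfun P \<and> (\<exists>V\<in>vec F. P V \<noteq> {\<zero>\<^bsub>omap T V\<^esub>}) \<and>
    (\<forall>N. subfun N \<and> (\<forall>V\<in>vec F. N V \<subseteq> P V) \<longrightarrow>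
      (\<forall>V\<in>vec F. N V = {\<zero>\<^bsub>omap T V\<^esub>}) \<or> (\<forall>V\<in>vec F. N V = P V))"

end

section \<open>Simple subfunctors\<close>

locale semisimple_setting = functor_rep F K T
  for F :: "('f, 'm) ring_scheme" and K :: "('k, 'n) ring_scheme" and T :: "('f, 'v, 'k, 'w) rep" +
  assumes finite_F: "finite (carrier F)"
    and char0: "\<And>n::nat. n > 0 \<Longrightarrow> [n] \<cdot>\<^bsub>K\<^esub> \<one>\<^bsub>K\<^esub> \<noteq> \<zero>\<^bsub>K\<^esub>"
begin

lemma complement_at:
  assumes V: "V \<in> vec F" and N: "monoid_representation.stable K (omap T V) (End F V) (amap T V V) N"
  shows "\<exists>C. monoid_representation.stable K (omap T V) (End F V) (amap T V V) C \<and>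
    module.complementary K (omap T V) N C"
proof -
  have vs: "vectorspace F V" "vectorspace.fin_dim F V" using V by (auto simp: vec_iff)
  obtain B \<xi> where "coordinates F V B \<xi>"
    using vectorspace.coordinates_exist[OF vs finite_F] by blast
  then show ?thesis
    by (rule monoid_representation.stable_complement[OF End_representation[OF V]
        coordinates.separable_End char0 N])
qed

text \<open>
  Let \<open>N\<close> be a subfunctor of the one generated by \<open>C\<close>.  If \<open>N(V) = C\<close>, it is everything.  Otherwise
  \<open>N(V) = 0\<close>.  If \<open>W\<close> is a retract of \<open>V\<close>, then \<open>N(W)\<close> embeds into \<open>N(V)\<close>.  If \<open>V\<close> is a retract of \<open>W\<close>, by
  \<open>r i = 1\<close>, let \<open>N'\<close> be a stable complement of \<open>N(W)\<close> in \<open>T(W)\<close>.  As \<open>T(r)\<close> kills \<open>N(W)\<close>, the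
  idempotent \<open>T(i r)\<close> maps \<open>T(W)\<close> into \<open>N'\<close>; it fixes \<open>T(i) c\<close> for \<open>c \<in> C\<close>, so \<open>N'\<close> contains
  \<open>T(f) c = T(f r) T(i) c\<close> for every \<open>f : V \<rightarrow> W\<close>.  Hence \<open>N(W)\<close> lies in \<open>N'\<close> and is \<open>0\<close>.
\<close>
lemma generated_simple:
  assumes V: "V \<in> vec F"
    and C: "monoid_representation.simple_stable K (omap T V) (End F V) (amap T V V) C"
  shows "simple_sub (spanned (orbit V C))"
proof -
  interpret R: monoid_representation K "omap T V" "End F V" "amap T V V" by (rule End_representation[OF V])
  have Cst: "R.stable C" and C0: "C \<noteq> {\<zero>\<^bsub>omap T V\<^esub>}"
    and Cmin: "\<And>D. R.stable D \<Longrightarrow> D \<subseteq> C \<Longrightarrow> D = {\<zero>\<^bsub>omap T V\<^esub>} \<or> D = C"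
    using C by (auto simp: R.simple_stable_def)
  let ?P = "spanned (orbit V C)"
  note at = generated_at[OF V Cst]
  have "(\<forall>W\<in>vec F. N W = {\<zero>\<^bsub>omap T W\<^esub>}) \<or> (\<forall>W\<in>vec F. N W = ?P W)"
    if N: "subfun N" and NP: "\<And>W. W \<in> vec F \<Longrightarrow> N W \<subseteq> ?P W" for N
  proof -
    have "N V = {\<zero>\<^bsub>omap T V\<^esub>} \<or> N V = C"
      using subfun_stable[OF N V] NP[OF V] unfolding at by (rule Cmin)
    then show ?thesis
    proof
      assume "N V = C"
      then have "N W = ?P W" if "W \<in> vec F" for W
        using generated_least[OF V Cst N _ that] NP[OF that] by blast
      then show ?thesis by blast
    next
      assume NV: "N V = {\<zero>\<^bsub>omap T V\<^esub>}"
      have "x = \<zero>\<^bsub>omap T W\<^esub>" if W: "W \<in> vec F" and x: "x \<in> N W" for W x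
      proof -
        have xT: "x \<in> Tc W" using subfun_sub[OF N W] x by blast
        consider i r where "i \<in> Lin F W V" "r \<in> Lin F V W" "\<And>x. x \<in> carrier W \<Longrightarrow> r (i x) = x"
          | i r where "i \<in> Lin F V W" "r \<in> Lin F W V" "\<And>x. x \<in> carrier V \<Longrightarrow> r (i x) = x"
          using retract_dichotomy[OF finite_F V W] by blast
        then show ?thesis
        proof cases
          case 1
          interpret r: mod_hom K "omap T V" "omap T W" "amap T V W r" by (rule T_mod_hom[OF V W 1(2)])
          have "amap T W V i x = \<zero>\<^bsub>omap T V\<^esub>" using subfun_closed[OF N W V 1(1) x] NV by blast
          then show ?thesis using T_retract[OF W V 1 xT] by simp
        next
          case 2
          interpret RW: monoid_representation K "omap T W" "End F W" "amap T W W"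
            by (rule End_representation[OF W])
          interpret i: mod_hom K "omap T V" "omap T W" "amap T V W i" by (rule T_mod_hom[OF V W 2(1)])
          obtain N' where N': "RW.stable N'" and NN': "RW.complementary (N W) N'"
            using complement_at[OF W subfun_stable[OF N W]] by blast
          note n' = RW.submoduleD[OF RW.stable_submodule[OF N']]
          let ?e = "compose (carrier W) i r"
          have e: "?e \<in> Lin F W W" by (rule hom_compose[OF 2(2,1) W])
          have "orbit V C W \<subseteq> N'"
          proof
            fix y assume "y \<in> orbit V C W"
            then obtain f c where f: "f \<in> Lin F V W" and c: "c \<in> C" and y: "y = amap T V W f c"
              by (auto simp: orbit_def)
            have cT: "c \<in> Tc V" using c C_sub[OF V Cst] by blast
            let ?z = "amap T V W i c"
            have zT: "?z \<in> Tc W" by (rule T_closed[OF V W 2(1) cT])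
            have rz: "amap T W V r ?z = c" by (rule T_retract[OF V W 2 cT])
            have ez: "amap T W W ?e ?z = ?z" using T_cmp[OF W V W 2(2,1) zT] rz by simp
            obtain n k where n: "n \<in> N W" and k: "k \<in> N'" and z: "?z = n \<oplus>\<^bsub>omap T W\<^esub> k"
              using NN' zT unfolding RW.complementary_def by blast
            have nT: "n \<in> Tc W" and kT: "k \<in> Tc W" using n k subfun_sub[OF N W] n'(1) by auto
            have "amap T W V r n = \<zero>\<^bsub>omap T V\<^esub>" using subfun_closed[OF N W V 2(2) n] NV by blast
            then have en: "amap T W W ?e n = \<zero>\<^bsub>omap T W\<^esub>" using T_cmp[OF W V W 2(2,1) nT] by simp
            interpret e: mod_hom K "omap T W" "omap T W" "amap T W W ?e" by (rule T_mod_hom[OF W W e])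
            have "?z = amap T W W ?e n \<oplus>\<^bsub>omap T W\<^esub> amap T W W ?e k"
              using ez e.f_add[OF nT kT] unfolding z by simp
            then have "?z = amap T W W ?e k" using en T_closed[OF W W e kT] by simp
            then have zN: "?z \<in> N'" using RW.stable_act[OF N' _ k, of ?e] e by (simp add: End_hom)
            let ?h = "compose (carrier W) f r"
            have h: "?h \<in> Lin F W W" by (rule hom_compose[OF 2(2) f W])
            have "amap T W W ?h ?z = y" using T_cmp[OF W V W 2(2) f zT] rz y by simp
            then show "y \<in> N'" using RW.stable_act[OF N' _ zN, of ?h] h by (simp add: End_hom)
          qed
          then have "?P W \<subseteq> N'" by (rule spanned_least[OF W RW.stable_submodule[OF N']])
          then have "x \<in> N W \<inter> N'" using NP[OF W] x by blast
          then show ?thesis using NN' unfolding RW.complementary_def by blast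
        qed
      qed
      then have "N W = {\<zero>\<^bsub>omap T W\<^esub>}" if "W \<in> vec F" for W
        using that subfun_zero[OF N that] by blast
      then show ?thesis by blast
    qed
  qed
  then show ?thesis
    unfolding simple_sub_def using generated_subfun[OF V Cst] V at C0 by blast
qed

definition total :: "(('f, 'v) module \<Rightarrow> 'w set) set \<Rightarrow> ('f, 'v) module \<Rightarrow> 'w set" where
  "total \<I> = spanned (\<lambda>V. \<Union>P\<in>\<I>. P V)"

lemma total_supset:
  assumes "\<And>P. P \<in> \<I> \<Longrightarrow> subfun P" "V \<in> vec F" "P \<in> \<I>"
  shows "P V \<subseteq> total \<I> V"
proof -
  have "(\<Union>P\<in>\<I>. P V) \<subseteq> total \<I> V"
    unfolding total_def using spanned_supset[OF assms(2), of "\<lambda>V. \<Union>P\<in>\<I>. P V"] subfun_sub[OF assms(1) assms(2)] by blast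
  then show ?thesis using assms(3) by blast
qed

lemma total_subfun:
  assumes "\<And>P. P \<in> \<I> \<Longrightarrow> subfun P"
  shows "subfun (total \<I>)"
  unfolding total_def
proof (rule spanned_subfun)
  show "(\<Union>P\<in>\<I>. P V) \<subseteq> Tc V" if "V \<in> vec F" for V using subfun_sub[OF assms that] by blast
  show "amap T V W f x \<in> (\<Union>P\<in>\<I>. P W)"
    if "V \<in> vec F" "W \<in> vec F" "f \<in> Lin F V W" "x \<in> (\<Union>P\<in>\<I>. P V)" for V W f x
    using subfun_closed[OF assms that(1-3)] that(4) by blast
qed

lemma total_least:
  assumes "V \<in> vec F" "submodule K N (omap T V)" "\<And>P. P \<in> \<I> \<Longrightarrow> P V \<subseteq> N"
  shows "total \<I> V \<subseteq> N"
  unfolding total_def using assms by (intro spanned_least) auto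

text \<open>
  Otherwise some value of the sum is a proper submodule, and there is a simple submodule outside of
  it, which generates a further simple subfunctor.
\<close>
theorem total_simple:
  assumes V: "V \<in> vec F"
  shows "total {P. simple_sub P} V = Tc V"
proof (rule ccontr)
  let ?\<Sigma> = "total {P. simple_sub P}"
  have sf: "subfun P" if "P \<in> {P. simple_sub P}" for P using that by (simp add: simple_sub_def)
  have S: "subfun ?\<Sigma>" by (rule total_subfun[OF sf])
  assume "?\<Sigma> V \<noteq> Tc V"
  then obtain x where x: "x \<in> Tc V" "x \<notin> ?\<Sigma> V" using subfun_sub[OF S V] by blast
  interpret R: monoid_representation K "omap T V" "End F V" "amap T V V" by (rule End_representation[OF V])
  obtain C where C: "R.simple_stable C" and SC: "?\<Sigma> V \<inter> C = {\<zero>\<^bsub>omap T V\<^esub>}"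
    using R.simple_stable_outside[OF complement_at[OF V] subfun_stable[OF S V] x] by blast
  then have Cst: "R.stable C" and C0: "C \<noteq> {\<zero>\<^bsub>omap T V\<^esub>}" by (auto simp: R.simple_stable_def)
  have "spanned (orbit V C) V \<subseteq> ?\<Sigma> V"
    using generated_simple[OF V C] by (intro total_supset[OF sf V]) auto
  then have "C \<subseteq> ?\<Sigma> V" unfolding generated_at[OF V Cst] .
  then show False using SC C0 by blast
qed

end

section \<open>Direct sums of simple subfunctors\<close>

lemma sub_hom_iff:
  "h \<in> module_hom K (M\<lparr>carrier := A\<rparr>) N \<longleftrightarrow> (\<forall>x\<in>A. h x \<in> carrier N) \<and>
    (\<forall>x\<in>A. \<forall>y\<in>A. h (x \<oplus>\<^bsub>M\<^esub> y) = h x \<oplus>\<^bsub>N\<^esub> h y) \<and>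
    (\<forall>r\<in>carrier K. \<forall>x\<in>A. h (r \<odot>\<^bsub>M\<^esub> x) = r \<odot>\<^bsub>N\<^esub> h x)"
  by (auto simp: module_hom_def)

lemma (in module) sub_hom_agree:
  assumes N: "module R N" and A: "submodule R A M"
    and h: "h \<in> module_hom R (M\<lparr>carrier := A\<rparr>) N" and h': "h' \<in> module_hom R (M\<lparr>carrier := A\<rparr>) N"
  shows "submodule R {x \<in> A. h x = h' x} M"
proof -
  interpret N: module R N by fact
  note a = submoduleD[OF A]
  have zero: "k \<zero>\<^bsub>M\<^esub> = \<zero>\<^bsub>N\<^esub>" if k: "k \<in> module_hom R (M\<lparr>carrier := A\<rparr>) N" for k
  proof -
    have "k (\<zero>\<^bsub>R\<^esub> \<odot>\<^bsub>M\<^esub> \<zero>\<^bsub>M\<^esub>) = \<zero>\<^bsub>R\<^esub> \<odot>\<^bsub>N\<^esub> k \<zero>\<^bsub>M\<^esub>" "k \<zero>\<^bsub>M\<^esub> \<in> carrier N"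
      using k a(2) R.zero_closed unfolding sub_hom_iff by blast+
    then show ?thesis by (simp only: lmult_0 rmult_0 N.lmult_0 M.zero_closed R.zero_closed)
  qed
  show ?thesis
    by (rule submodule.intro) (use a module_axioms h h' zero[OF h] zero[OF h'] in \<open>auto simp: sub_hom_iff\<close>)
qed

context semisimple_setting
begin

text \<open>
  The sum of the family is direct.  Directness is expressed by extension of homomorphisms from the
  summands to the sum: this is the property that a coproduct needs, and it can be glued along chains
  without writing elements as finite sums.
\<close>
definition free :: "(('f, 'v) module \<Rightarrow> 'w set) set \<Rightarrow> bool" where
  "free \<I> \<longleftrightarrow> (\<forall>V\<in>vec F. \<forall>(N :: ('k, 'w) module) \<phi>. module K N \<longrightarrow>
    (\<forall>P\<in>\<I>. \<phi> P \<in> module_hom K ((omap T V)\<lparr>carrier := P V\<rparr>) N) \<longrightarrow>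
    (\<exists>h\<in>module_hom K ((omap T V)\<lparr>carrier := total \<I> V\<rparr>) N. \<forall>P\<in>\<I>. \<forall>x\<in>P V. h x = \<phi> P x))"

lemma freeD:
  fixes N :: "('k, 'w) module"
  assumes "free \<I>" "V \<in> vec F" "module K N"
    and "\<And>P. P \<in> \<I> \<Longrightarrow> \<phi> P \<in> module_hom K ((omap T V)\<lparr>carrier := P V\<rparr>) N"
  shows "\<exists>h\<in>module_hom K ((omap T V)\<lparr>carrier := total \<I> V\<rparr>) N. \<forall>P\<in>\<I>. \<forall>x\<in>P V. h x = \<phi> P x"
  using assms(1)[unfolded free_def, rule_format, OF assms(2,3), of \<phi>] assms(4) by blast

lemma total_hom_unique:
  assumes V: "V \<in> vec F" and N: "module K N" and \<I>: "\<And>P. P \<in> \<I> \<Longrightarrow> subfun P"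
    and h: "h \<in> module_hom K ((omap T V)\<lparr>carrier := total \<I> V\<rparr>) N"
    and h': "h' \<in> module_hom K ((omap T V)\<lparr>carrier := total \<I> V\<rparr>) N"
    and eq: "\<And>P x. P \<in> \<I> \<Longrightarrow> x \<in> P V \<Longrightarrow> h x = h' x" and x: "x \<in> total \<I> V"
  shows "h x = h' x"
proof -
  have "submodule K {x \<in> total \<I> V. h x = h' x} (omap T V)"
    by (rule module.sub_hom_agree[OF T_module[OF V] N subfun_submodule[OF total_subfun[OF \<I>] V] h h'])
  then have "total \<I> V \<subseteq> {x \<in> total \<I> V. h x = h' x}"
    using total_supset[OF \<I> V] eq by (intro total_least[OF V]) auto
  then show ?thesis using x by blast
qed

lemma total_mono:
  assumes V: "V \<in> vec F" and \<J>: "\<And>P. P \<in> \<J> \<Longrightarrow> subfun P" and "\<I> \<subseteq> \<J>"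
  shows "total \<I> V \<subseteq> total \<J> V"
  using total_supset[OF \<J> V] assms(3)
  by (intro total_least[OF V subfun_submodule[OF total_subfun[OF \<J>] V]]) blast+

text \<open>
  The sum over the union of the chain is the union of the sums, and the extensions to these agree
  because homomorphisms on a sum are determined on the summands.
\<close>
lemma free_Union_chain:
  assumes ne: "\<C> \<noteq> {}" and chain: "subset.chain \<A> \<C>"
    and sub: "\<And>\<I> P. \<I> \<in> \<C> \<Longrightarrow> P \<in> \<I> \<Longrightarrow> subfun P" and free: "\<And>\<I>. \<I> \<in> \<C> \<Longrightarrow> free \<I>"
  shows "free (\<Union>\<C>)"
  unfolding free_def
proof (intro ballI allI impI)
  fix V :: "('f, 'v) module" and N :: "('k, 'w) module" and \<phi>
  assume V: "V \<in> vec F" and N: "module K N"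
    and \<phi>: "\<forall>P\<in>\<Union>\<C>. \<phi> P \<in> module_hom K ((omap T V)\<lparr>carrier := P V\<rparr>) N"
  interpret TV: module K "omap T V" by (rule T_module[OF V])
  interpret N: module K N by fact
  have "\<forall>\<I>\<in>\<C>. \<exists>h. h \<in> module_hom K ((omap T V)\<lparr>carrier := total \<I> V\<rparr>) N \<and> (\<forall>P\<in>\<I>. \<forall>x\<in>P V. h x = \<phi> P x)"
  proof
    fix \<I> assume \<I>: "\<I> \<in> \<C>"
    then have "\<forall>P\<in>\<I>. \<phi> P \<in> module_hom K ((omap T V)\<lparr>carrier := P V\<rparr>) N" using \<phi> by blast
    then show "\<exists>h. h \<in> module_hom K ((omap T V)\<lparr>carrier := total \<I> V\<rparr>) N \<and> (\<forall>P\<in>\<I>. \<forall>x\<in>P V. h x = \<phi> P x)"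
      using free[OF \<I>] V N unfolding free_def by blast
  qed
  from bchoice[OF this] obtain H where "\<forall>\<I>\<in>\<C>. H \<I> \<in> module_hom K ((omap T V)\<lparr>carrier := total \<I> V\<rparr>) N \<and>
      (\<forall>P\<in>\<I>. \<forall>x\<in>P V. H \<I> x = \<phi> P x)" ..
  then have H: "\<And>\<I>. \<I> \<in> \<C> \<Longrightarrow> H \<I> \<in> module_hom K ((omap T V)\<lparr>carrier := total \<I> V\<rparr>) N"
    and H\<phi>: "\<And>\<I> P x. \<I> \<in> \<C> \<Longrightarrow> P \<in> \<I> \<Longrightarrow> x \<in> P V \<Longrightarrow> H \<I> x = \<phi> P x"
    by blast+
  have cmp: "\<I> \<subseteq> \<J> \<or> \<J> \<subseteq> \<I>" if "\<I> \<in> \<C>" "\<J> \<in> \<C>" for \<I> \<J>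
    using chain that by (auto simp: subset.chain_def)
  have mono: "total \<I> V \<subseteq> total \<J> V" if "\<J> \<in> \<C>" "\<I> \<subseteq> \<J>" for \<I> \<J>
    by (rule total_mono[OF V sub[OF that(1)] that(2)])
  have agree_sub: "H \<I> x = H \<J> x" if \<I>: "\<I> \<in> \<C>" and \<J>: "\<J> \<in> \<C>" and s: "\<I> \<subseteq> \<J>" and x: "x \<in> total \<I> V" for \<I> \<J> x
  proof (rule total_hom_unique[OF V N sub[OF \<I>] H[OF \<I>] _ _ x])
    show "H \<J> \<in> module_hom K ((omap T V)\<lparr>carrier := total \<I> V\<rparr>) N"
      using H[OF \<J>] mono[OF \<J> s] unfolding sub_hom_iff by blast
    show "H \<I> y = H \<J> y" if "P \<in> \<I>" "y \<in> P V" for P y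
      using H\<phi>[of \<I> P y, OF \<I> that] H\<phi>[of \<J> P y, OF \<J> _ that(2)] that(1) s by auto
  qed
  have agree: "H \<I> x = H \<J> x" if "\<I> \<in> \<C>" "\<J> \<in> \<C>" "x \<in> total \<I> V" "x \<in> total \<J> V" for \<I> \<J> x
    using cmp[OF that(1,2)] agree_sub[OF that(1,2) _ that(3)] agree_sub[OF that(2,1) _ that(4)] by metis
  define h where "h x = H (SOME \<I>. \<I> \<in> \<C> \<and> x \<in> total \<I> V) x" for x
  have h: "h x = H \<I> x" if "\<I> \<in> \<C>" "x \<in> total \<I> V" for \<I> x
  proof -
    have "(SOME \<I>. \<I> \<in> \<C> \<and> x \<in> total \<I> V) \<in> \<C> \<and> x \<in> total (SOME \<I>. \<I> \<in> \<C> \<and> x \<in> total \<I> V) V"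
      using that by (intro someI[of "\<lambda>\<I>. \<I> \<in> \<C> \<and> x \<in> total \<I> V"]) blast
    then show ?thesis unfolding h_def using agree that by blast
  qed
  have tot: "\<exists>\<I>\<in>\<C>. x \<in> total \<I> V" if x: "x \<in> total (\<Union>\<C>) V" for x
  proof -
    let ?\<D> = "(\<lambda>\<I>. total \<I> V) ` \<C>"
    have "submodule K (\<Union>?\<D>) (omap T V)"
    proof (rule TV.submodule_chain_Union)
      show "?\<D> \<noteq> {}" using ne by blast
      have "total \<I> V \<subseteq> total \<J> V \<or> total \<J> V \<subseteq> total \<I> V" if IJ: "\<I> \<in> \<C>" "\<J> \<in> \<C>" for \<I> \<J>
        using cmp[OF IJ] mono[OF IJ(2), of \<I>] mono[OF IJ(1), of \<J>] by blast
      then show "subset.chain UNIV ?\<D>" unfolding subset_chain_def by auto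
      show "submodule K A (omap T V)" if A: "A \<in> ?\<D>" for A
      proof -
        obtain \<I> where \<I>: "\<I> \<in> \<C>" and A: "A = total \<I> V" using A by blast
        show ?thesis unfolding A by (rule subfun_submodule[OF total_subfun[OF sub[OF \<I>]] V])
      qed
    qed
    then have "total (\<Union>\<C>) V \<subseteq> \<Union>?\<D>"
    proof (rule total_least[OF V])
      fix P assume "P \<in> \<Union>\<C>"
      then obtain \<I> where \<I>: "\<I> \<in> \<C>" "P \<in> \<I>" by blast
      have "P V \<subseteq> total \<I> V" by (rule total_supset[OF sub[OF \<I>(1)] V \<I>(2)])
      then show "P V \<subseteq> \<Union>?\<D>" using \<I>(1) by blast
    qed
    then show ?thesis using x by blast
  qed
  have tot2: "\<exists>\<I>\<in>\<C>. x \<in> total \<I> V \<and> y \<in> total \<I> V" if x: "x \<in> total (\<Union>\<C>) V" and y: "y \<in> total (\<Union>\<C>) V" for x y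
  proof -
    obtain \<I> \<J> where IJ: "\<I> \<in> \<C>" "x \<in> total \<I> V" "\<J> \<in> \<C>" "y \<in> total \<J> V" using tot[OF x] tot[OF y] by blast
    then show ?thesis using cmp[OF IJ(1,3)] mono[OF IJ(3), of \<I>] mono[OF IJ(1), of \<J>] by blast
  qed
  show "\<exists>h\<in>module_hom K ((omap T V)\<lparr>carrier := total (\<Union>\<C>) V\<rparr>) N. \<forall>P\<in>\<Union>\<C>. \<forall>x\<in>P V. h x = \<phi> P x"
  proof (intro bexI[of _ h] ballI)
    show "h \<in> module_hom K ((omap T V)\<lparr>carrier := total (\<Union>\<C>) V\<rparr>) N"
      unfolding sub_hom_iff
    proof (intro conjI ballI)
      fix x y assume x: "x \<in> total (\<Union>\<C>) V" and y: "y \<in> total (\<Union>\<C>) V"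
      obtain \<I> where \<I>: "\<I> \<in> \<C>" and xy: "x \<in> total \<I> V" "y \<in> total \<I> V" using tot2[OF x y] by blast
      have tS: "submodule K (total \<I> V) (omap T V)"
        by (rule subfun_submodule[OF total_subfun V]) (rule sub[OF \<I>])
      note t = TV.submoduleD[OF tS]
      note HI = H[OF \<I>, unfolded sub_hom_iff]
      show "h x \<in> carrier N" using h[OF \<I> xy(1)] HI xy by auto
      show "h (x \<oplus>\<^bsub>omap T V\<^esub> y) = h x \<oplus>\<^bsub>N\<^esub> h y"
        using h[OF \<I> xy(1)] h[OF \<I> xy(2)] h[OF \<I> t(3)[OF xy]] HI xy by auto
    next
      fix r x assume r: "r \<in> carrier K" and x: "x \<in> total (\<Union>\<C>) V"
      obtain \<I> where \<I>: "\<I> \<in> \<C>" and xI: "x \<in> total \<I> V" using tot[OF x] by blast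
      have tS: "submodule K (total \<I> V) (omap T V)"
        by (rule subfun_submodule[OF total_subfun V]) (rule sub[OF \<I>])
      note t = TV.submoduleD[OF tS]
      show "h (r \<odot>\<^bsub>omap T V\<^esub> x) = r \<odot>\<^bsub>N\<^esub> h x"
        using h[OF \<I> xI] h[OF \<I> t(4)[OF r xI]] H[OF \<I>, unfolded sub_hom_iff] r xI by auto
    qed
  next
    fix P x assume "P \<in> \<Union>\<C>" and x: "x \<in> P V"
    then obtain \<I> where \<I>: "\<I> \<in> \<C>" "P \<in> \<I>" by blast
    have "x \<in> total \<I> V" using total_supset[OF sub[OF \<I>(1)] V \<I>(2)] x by blast
    then show "h x = \<phi> P x" using h[OF \<I>(1)] H\<phi>[OF \<I> x] by simp
  qed
qed

text \<open>
  Elements of the larger sum decompose uniquely into an element of \<open>P\<close> and one of the smaller sum.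
\<close>
lemma free_insert:
  assumes \<I>: "\<And>P. P \<in> \<I> \<Longrightarrow> subfun P" and free: "free \<I>" and P: "subfun P"
    and disj: "\<And>V. V \<in> vec F \<Longrightarrow> P V \<inter> total \<I> V = {\<zero>\<^bsub>omap T V\<^esub>}"
  shows "free (insert P \<I>)"
  unfolding free_def
proof (intro ballI allI impI)
  fix V :: "('f, 'v) module" and N :: "('k, 'w) module" and \<phi>
  assume V: "V \<in> vec F" and N: "module K N"
    and \<phi>: "\<forall>P\<in>insert P \<I>. \<phi> P \<in> module_hom K ((omap T V)\<lparr>carrier := P V\<rparr>) N"
  interpret TV: module K "omap T V" by (rule T_module[OF V])
  interpret N: module K N by fact
  have "\<forall>Q\<in>\<I>. \<phi> Q \<in> module_hom K ((omap T V)\<lparr>carrier := Q V\<rparr>) N" using \<phi> by blast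
  then have "\<exists>h\<in>module_hom K ((omap T V)\<lparr>carrier := total \<I> V\<rparr>) N. \<forall>Q\<in>\<I>. \<forall>x\<in>Q V. h x = \<phi> Q x"
    using free V N unfolding free_def by blast
  then obtain h where h: "h \<in> module_hom K ((omap T V)\<lparr>carrier := total \<I> V\<rparr>) N"
    and h\<phi>: "\<And>Q x. Q \<in> \<I> \<Longrightarrow> x \<in> Q V \<Longrightarrow> h x = \<phi> Q x" by blast
  note h' = h[unfolded sub_hom_iff]
  have \<phi>': "(\<forall>x\<in>P V. \<phi> P x \<in> carrier N) \<and>
    (\<forall>x\<in>P V. \<forall>y\<in>P V. \<phi> P (x \<oplus>\<^bsub>omap T V\<^esub> y) = \<phi> P x \<oplus>\<^bsub>N\<^esub> \<phi> P y) \<and>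
    (\<forall>r\<in>carrier K. \<forall>x\<in>P V. \<phi> P (r \<odot>\<^bsub>omap T V\<^esub> x) = r \<odot>\<^bsub>N\<^esub> \<phi> P x)"
    using \<phi> unfolding sub_hom_iff by blast
  have PS: "submodule K (P V) (omap T V)" and tS: "submodule K (total \<I> V) (omap T V)"
    using subfun_submodule[OF P V] subfun_submodule[OF total_subfun[OF \<I>] V] by auto
  note p = TV.submoduleD[OF PS] and t = TV.submoduleD[OF tS]
  define k where "k x = (THE z. \<exists>a\<in>P V. \<exists>b\<in>total \<I> V. x = a \<oplus>\<^bsub>omap T V\<^esub> b \<and> z = \<phi> P a \<oplus>\<^bsub>N\<^esub> h b)" for x
  have k: "k (a \<oplus>\<^bsub>omap T V\<^esub> b) = \<phi> P a \<oplus>\<^bsub>N\<^esub> h b" if ab: "a \<in> P V" "b \<in> total \<I> V" for a b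
    unfolding k_def
  proof (rule the_equality)
    show "\<exists>a'\<in>P V. \<exists>b'\<in>total \<I> V. a \<oplus>\<^bsub>omap T V\<^esub> b = a' \<oplus>\<^bsub>omap T V\<^esub> b' \<and> \<phi> P a \<oplus>\<^bsub>N\<^esub> h b = \<phi> P a' \<oplus>\<^bsub>N\<^esub> h b'"
      using ab by blast
    fix z assume "\<exists>a'\<in>P V. \<exists>b'\<in>total \<I> V. a \<oplus>\<^bsub>omap T V\<^esub> b = a' \<oplus>\<^bsub>omap T V\<^esub> b' \<and> z = \<phi> P a' \<oplus>\<^bsub>N\<^esub> h b'"
    then obtain a' b' where ab': "a' \<in> P V" "b' \<in> total \<I> V"
      and e: "a \<oplus>\<^bsub>omap T V\<^esub> b = a' \<oplus>\<^bsub>omap T V\<^esub> b'" and z: "z = \<phi> P a' \<oplus>\<^bsub>N\<^esub> h b'" by blast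
    have "a = a'" "b = b'"
      using TV.sum_decomposition_unique[OF PS tS disj[OF V] ab(1) ab'(1) ab(2) ab'(2) e] by auto
    then show "z = \<phi> P a \<oplus>\<^bsub>N\<^esub> h b" using z by simp
  qed
  have decomp: "\<exists>a\<in>P V. \<exists>b\<in>total \<I> V. x = a \<oplus>\<^bsub>omap T V\<^esub> b" if x: "x \<in> total (insert P \<I>) V" for x
  proof -
    have S: "submodule K (TV.submodule_sum (P V) (total \<I> V)) (omap T V)"
      by (rule TV.sum_is_submodule[OF PS tS])
    have mem: "a \<oplus>\<^bsub>omap T V\<^esub> b \<in> TV.submodule_sum (P V) (total \<I> V)" if "a \<in> P V" "b \<in> total \<I> V" for a b
      using that by (auto simp: TV.submodule_sum_def image_iff)
    have PV: "P V \<subseteq> TV.submodule_sum (P V) (total \<I> V)"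
    proof
      fix a assume a: "a \<in> P V"
      then have "a \<oplus>\<^bsub>omap T V\<^esub> \<zero>\<^bsub>omap T V\<^esub> = a" using p(1) by auto
      then show "a \<in> TV.submodule_sum (P V) (total \<I> V)" using mem[OF a t(2)] by simp
    qed
    have tV: "total \<I> V \<subseteq> TV.submodule_sum (P V) (total \<I> V)"
    proof
      fix b assume b: "b \<in> total \<I> V"
      then have "\<zero>\<^bsub>omap T V\<^esub> \<oplus>\<^bsub>omap T V\<^esub> b = b" using t(1) by auto
      then show "b \<in> TV.submodule_sum (P V) (total \<I> V)" using mem[OF p(2) b] by simp
    qed
    have "total (insert P \<I>) V \<subseteq> TV.submodule_sum (P V) (total \<I> V)"
      using PV tV total_supset[OF \<I> V] by (intro total_least[OF V S]) blast
    then have "x \<in> TV.submodule_sum (P V) (total \<I> V)" using x by blast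
    then show ?thesis by (auto simp: TV.submodule_sum_def)
  qed
  have k_hom: "k \<in> module_hom K ((omap T V)\<lparr>carrier := total (insert P \<I>) V\<rparr>) N"
    unfolding sub_hom_iff
  proof (intro conjI ballI)
    fix x y assume x: "x \<in> total (insert P \<I>) V" and y: "y \<in> total (insert P \<I>) V"
    obtain a b where ab: "a \<in> P V" "b \<in> total \<I> V" "x = a \<oplus>\<^bsub>omap T V\<^esub> b" using decomp[OF x] by blast
    obtain c d where cd: "c \<in> P V" "d \<in> total \<I> V" "y = c \<oplus>\<^bsub>omap T V\<^esub> d" using decomp[OF y] by blast
    have cl: "a \<in> Tc V" "b \<in> Tc V" "c \<in> Tc V" "d \<in> Tc V" using ab cd p(1) t(1) by auto
    have cl': "\<phi> P a \<in> carrier N" "\<phi> P c \<in> carrier N" "h b \<in> carrier N" "h d \<in> carrier N"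
      using ab cd h' \<phi>' by auto
    show "k x \<in> carrier N" using k[OF ab(1,2)] ab(3) cl' by simp
    have e: "x \<oplus>\<^bsub>omap T V\<^esub> y = (a \<oplus>\<^bsub>omap T V\<^esub> c) \<oplus>\<^bsub>omap T V\<^esub> (b \<oplus>\<^bsub>omap T V\<^esub> d)"
      using cl ab(3) cd(3) by (simp add: TV.M.a_ac)
    have "k (x \<oplus>\<^bsub>omap T V\<^esub> y) = (\<phi> P a \<oplus>\<^bsub>N\<^esub> \<phi> P c) \<oplus>\<^bsub>N\<^esub> (h b \<oplus>\<^bsub>N\<^esub> h d)"
      unfolding e using k[OF p(3)[OF ab(1) cd(1)] t(3)[OF ab(2) cd(2)]] ab cd h' \<phi>' by simp
    also have "\<dots> = k x \<oplus>\<^bsub>N\<^esub> k y"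
      unfolding ab(3) cd(3) k[OF ab(1,2)] k[OF cd(1,2)] using cl' by (simp add: N.M.a_ac)
    finally show "k (x \<oplus>\<^bsub>omap T V\<^esub> y) = k x \<oplus>\<^bsub>N\<^esub> k y" .
  next
    fix r x assume r: "r \<in> carrier K" and x: "x \<in> total (insert P \<I>) V"
    obtain a b where ab: "a \<in> P V" "b \<in> total \<I> V" "x = a \<oplus>\<^bsub>omap T V\<^esub> b" using decomp[OF x] by blast
    have cl: "a \<in> Tc V" "b \<in> Tc V" using ab p(1) t(1) by auto
    have cl': "\<phi> P a \<in> carrier N" "h b \<in> carrier N" using ab h' \<phi>' by auto
    have e: "r \<odot>\<^bsub>omap T V\<^esub> x = r \<odot>\<^bsub>omap T V\<^esub> a \<oplus>\<^bsub>omap T V\<^esub> r \<odot>\<^bsub>omap T V\<^esub> b"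
      using cl ab(3) r by (simp add: TV.smult_r_distr)
    have "k (r \<odot>\<^bsub>omap T V\<^esub> x) = r \<odot>\<^bsub>N\<^esub> \<phi> P a \<oplus>\<^bsub>N\<^esub> r \<odot>\<^bsub>N\<^esub> h b"
      unfolding e using k[OF p(4)[OF r ab(1)] t(4)[OF r ab(2)]] ab h' \<phi>' r by simp
    also have "\<dots> = r \<odot>\<^bsub>N\<^esub> k x"
      unfolding ab(3) k[OF ab(1,2)] using cl' r by (simp add: N.smult_r_distr)
    finally show "k (r \<odot>\<^bsub>omap T V\<^esub> x) = r \<odot>\<^bsub>N\<^esub> k x" .
  qed
  have at0: "\<phi> P \<zero>\<^bsub>omap T V\<^esub> = \<zero>\<^bsub>N\<^esub>" "h \<zero>\<^bsub>omap T V\<^esub> = \<zero>\<^bsub>N\<^esub>"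
  proof -
    have z: "\<zero>\<^bsub>K\<^esub> \<odot>\<^bsub>omap T V\<^esub> \<zero>\<^bsub>omap T V\<^esub> = \<zero>\<^bsub>omap T V\<^esub>" by simp
    have zK: "\<zero>\<^bsub>K\<^esub> \<in> carrier K" by simp
    have "\<phi> P (\<zero>\<^bsub>K\<^esub> \<odot>\<^bsub>omap T V\<^esub> \<zero>\<^bsub>omap T V\<^esub>) = \<zero>\<^bsub>K\<^esub> \<odot>\<^bsub>N\<^esub> \<phi> P \<zero>\<^bsub>omap T V\<^esub>"
      using \<phi>' p(2) zK by blast
    moreover have "h (\<zero>\<^bsub>K\<^esub> \<odot>\<^bsub>omap T V\<^esub> \<zero>\<^bsub>omap T V\<^esub>) = \<zero>\<^bsub>K\<^esub> \<odot>\<^bsub>N\<^esub> h \<zero>\<^bsub>omap T V\<^esub>"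
      using h' t(2) zK by blast
    ultimately show "\<phi> P \<zero>\<^bsub>omap T V\<^esub> = \<zero>\<^bsub>N\<^esub>" "h \<zero>\<^bsub>omap T V\<^esub> = \<zero>\<^bsub>N\<^esub>"
      unfolding z using \<phi>' h' p(2) t(2) by simp_all
  qed
  have "k x = \<phi> Q x" if Q: "Q \<in> insert P \<I>" and x: "x \<in> Q V" for Q x
  proof (cases "Q = P")
    case True
    then have "x \<in> P V" "x \<oplus>\<^bsub>omap T V\<^esub> \<zero>\<^bsub>omap T V\<^esub> = x" using x p(1) by auto
    moreover then have "\<phi> P x \<in> carrier N" using \<phi>' by blast
    ultimately show ?thesis using k[OF _ t(2), of x] at0 True by simp
  next
    case False
    then have QI: "Q \<in> \<I>" using Q by blast
    then have xt: "x \<in> total \<I> V" using total_supset[OF \<I> V] x by blast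
    then have "\<zero>\<^bsub>omap T V\<^esub> \<oplus>\<^bsub>omap T V\<^esub> x = x" "h x \<in> carrier N" using t(1) h' by auto
    then show ?thesis using k[OF p(2) xt] at0 h\<phi>[OF QI x] by simp
  qed
  then show "\<exists>h\<in>module_hom K ((omap T V)\<lparr>carrier := total (insert P \<I>) V\<rparr>) N. \<forall>Q\<in>insert P \<I>. \<forall>x\<in>Q V. h x = \<phi> Q x"
    using k_hom by blast
qed

lemma subfun_Int:
  assumes P: "subfun P" and N: "subfun N"
  shows "subfun (\<lambda>V. P V \<inter> N V)"
  unfolding subfun_def
proof (intro conjI ballI)
  fix V :: "('f, 'v) module" assume V: "V \<in> vec F"
  note p = module.submoduleD[OF T_module[OF V] subfun_submodule[OF P V]]
    and n = module.submoduleD[OF T_module[OF V] subfun_submodule[OF N V]]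
  show "submodule K (P V \<inter> N V) (omap T V)"
    by (rule submodule.intro) (use p n T_module[OF V] in auto)
next
  fix V W :: "('f, 'v) module" and f x assume "V \<in> vec F" "W \<in> vec F" "f \<in> Lin F V W" "x \<in> P V \<inter> N V"
  then show "amap T V W f x \<in> P W \<inter> N W" using subfun_closed[OF P] subfun_closed[OF N] by blast
qed

text \<open>
  Take a maximal free family of simple subfunctors.  A simple subfunctor that is not contained in its
  sum meets this sum in a proper subfunctor of itself, hence in \<open>0\<close>, and could be added to the family.
\<close>
theorem free_simple_decomposition:
  "\<exists>\<I>. (\<forall>P\<in>\<I>. simple_sub P) \<and> free \<I> \<and> (\<forall>V\<in>vec F. total \<I> V = Tc V)"
proof -
  define \<A> where "\<A> = {\<I>. (\<forall>P\<in>\<I>. simple_sub P) \<and> free \<I>}"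
  have "{} \<in> \<A>"
  proof -
    have "free {}"
      unfolding free_def
    proof (intro ballI allI impI)
      fix V :: "('f, 'v) module" and N :: "('k, 'w) module" and \<phi> :: "(('f, 'v) module \<Rightarrow> 'w set) \<Rightarrow> 'w \<Rightarrow> 'w"
      assume V: "V \<in> vec F" and N: "module K N"
      interpret N: module K N by fact
      show "\<exists>h\<in>module_hom K ((omap T V)\<lparr>carrier := total {} V\<rparr>) N. \<forall>P\<in>{}. \<forall>x\<in>P V. h x = \<phi> P x"
        by (intro bexI[of _ "\<lambda>_. \<zero>\<^bsub>N\<^esub>"]) (auto simp: sub_hom_iff)
    qed
    then show ?thesis by (simp add: \<A>_def)
  qed
  moreover have "\<Union>\<C> \<in> \<A>" if ne: "\<C> \<noteq> {}" and ch: "subset.chain \<A> \<C>" for \<C>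
  proof -
    have "\<C> \<subseteq> \<A>" using ch by (simp add: subset.chain_def)
    then have simple: "\<And>\<I> P. \<I> \<in> \<C> \<Longrightarrow> P \<in> \<I> \<Longrightarrow> simple_sub P"
      and free: "\<And>\<I>. \<I> \<in> \<C> \<Longrightarrow> free \<I>"
      by (auto simp: \<A>_def)
    have "free (\<Union>\<C>)"
      by (rule free_Union_chain[OF ne ch _ free]) (use simple in \<open>auto simp: simple_sub_def\<close>)
    then show ?thesis using simple by (auto simp: \<A>_def)
  qed
  ultimately obtain \<I> where \<I>: "\<I> \<in> \<A>" and max: "\<And>\<J>. \<J> \<in> \<A> \<Longrightarrow> \<I> \<subseteq> \<J> \<Longrightarrow> \<J> = \<I>"
    using subset_Zorn_nonempty[of \<A>] by blast
  then have simple: "\<And>P. P \<in> \<I> \<Longrightarrow> simple_sub P" and free: "free \<I>" by (auto simp: \<A>_def)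
  then have sf: "\<And>P. P \<in> \<I> \<Longrightarrow> subfun P" by (simp add: simple_sub_def)
  have tot: "subfun (total \<I>)" by (rule total_subfun[OF sf])
  have contains: "P V \<subseteq> total \<I> V" if P: "simple_sub P" and V: "V \<in> vec F" for P V
  proof -
    have Ps: "subfun P" using P by (simp add: simple_sub_def)
    have "(\<forall>V\<in>vec F. P V \<inter> total \<I> V = {\<zero>\<^bsub>omap T V\<^esub>}) \<or> (\<forall>V\<in>vec F. P V \<inter> total \<I> V = P V)"
      using P subfun_Int[OF Ps tot] unfolding simple_sub_def by blast
    then show ?thesis
    proof
      assume "\<forall>V\<in>vec F. P V \<inter> total \<I> V = P V"
      then show ?thesis using V by blast
    next
      assume "\<forall>V\<in>vec F. P V \<inter> total \<I> V = {\<zero>\<^bsub>omap T V\<^esub>}"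
      then have "free (insert P \<I>)" using free_insert[OF sf free Ps] by blast
      then have "insert P \<I> \<in> \<A>" using simple P by (auto simp: \<A>_def)
      then have "P \<in> \<I>" using max[of "insert P \<I>"] by blast
      then show ?thesis using total_supset[OF sf V] by blast
    qed
  qed
  have "total \<I> V = Tc V" if V: "V \<in> vec F" for V
  proof -
    have "total {P. simple_sub P} V \<subseteq> total \<I> V"
      by (rule total_least[OF V subfun_submodule[OF tot V]]) (use contains V in blast)
    then show ?thesis using total_simple[OF V] subfun_sub[OF tot V] by blast
  qed
  then show ?thesis using simple free by blast
qed

end

section \<open>The category of generic representations\<close>

lemma Ob_Rep: "Ob (Rep F K) = functors (fin_dim_category F) (module_category K)"
  by (simp add: Rep_def functor_category_def)

lemma Mor_Rep_iff:
  "\<eta> \<in> Mor (Rep F K) S U \<longleftrightarrow> \<eta> \<in> extensional (vec F) \<and>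
    (\<forall>V\<in>vec F. \<eta> V \<in> module_hom K (omap S V) (omap U V) \<and> \<eta> V \<in> extensional (carrier (omap S V))) \<and>
    (\<forall>V\<in>vec F. \<forall>W\<in>vec F. \<forall>f\<in>Lin F V W. \<forall>x\<in>carrier (omap S V). \<eta> W (amap S V W f x) = amap U V W f (\<eta> V x))"
  by (auto simp: Rep_def functor_category_def nat_trans_def module_category_def PiE_iff compose_def
      restrict_def fun_eq_iff)

lemma Cmp_Rep: "Cmp (Rep F K) S U Y \<theta> \<eta> = (\<lambda>V\<in>vec F. compose (carrier (omap S V)) (\<theta> V) (\<eta> V))"
  by (simp add: Rep_def functor_category_def module_category_def)

lemma Idn_Rep: "Idn (Rep F K) S = (\<lambda>V\<in>vec F. \<lambda>x\<in>carrier (omap S V). x)"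
  by (simp add: Rep_def functor_category_def module_category_def)

lemma Mor_Rep_eqI:
  fixes S U :: "('f, 'v, 'k, 'w) rep"
  assumes "\<eta> \<in> Mor (Rep F K) S U" "\<theta> \<in> Mor (Rep F K) S U"
    and "\<And>V x. V \<in> vec F \<Longrightarrow> x \<in> carrier (omap S V) \<Longrightarrow> \<eta> V x = \<theta> V x"
  shows "\<eta> = \<theta>"
proof (rule extensionalityI[of _ "vec F"])
  show "\<eta> \<in> extensional (vec F)" "\<theta> \<in> extensional (vec F)" using assms(1,2) by (auto simp: Mor_Rep_iff)
  fix V :: "('f, 'v) module" assume V: "V \<in> vec F"
  show "\<eta> V = \<theta> V"
    by (rule extensionalityI[of _ "carrier (omap S V)"]) (use assms V in \<open>auto simp: Mor_Rep_iff\<close>)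
qed

lemma functor_repI: "field K \<Longrightarrow> S \<in> Ob (Rep F K) \<Longrightarrow> functor_rep F K S"
  by (simp add: functor_rep_def Ob_Rep)

lemma zero_Mor:
  fixes S U :: "('f, 'v, 'k, 'w) rep"
  assumes K: "field K" and S: "S \<in> Ob (Rep F K)" and U: "U \<in> Ob (Rep F K)"
  shows "(\<lambda>V\<in>vec F. \<lambda>x\<in>carrier (omap S V). \<zero>\<^bsub>omap U V\<^esub>) \<in> Mor (Rep F K) S U"
proof -
  interpret S: functor_rep F K S by (rule functor_repI[OF K S])
  interpret U: functor_rep F K U by (rule functor_repI[OF K U])
  have "amap U V W f \<zero>\<^bsub>omap U V\<^esub> = \<zero>\<^bsub>omap U W\<^esub>" if "V \<in> vec F" "W \<in> vec F" "f \<in> Lin F V W" for V W f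
    using mod_hom.f0_is_0[OF U.T_mod_hom[OF that]] .
  moreover have "(\<lambda>x\<in>carrier (omap S V). \<zero>\<^bsub>omap U V\<^esub>) \<in> module_hom K (omap S V) (omap U V)"
    if V: "V \<in> vec F" for V
  proof -
    interpret SV: module K "omap S V" by (rule S.T_module[OF V])
    interpret UV: module K "omap U V" by (rule U.T_module[OF V])
    show ?thesis by (simp add: module_hom_def)
  qed
  ultimately show ?thesis using S.T_closed by (simp add: Mor_Rep_iff)
qed

lemma zero_functor:
  fixes Z :: "('f, 'v, 'k, 'w) rep"
  assumes K: "field K" and Z: "Z \<in> Ob (Rep F K)"
    and zero: "\<And>V. V \<in> vec F \<Longrightarrow> carrier (omap Z V) = {\<zero>\<^bsub>omap Z V\<^esub>}"
  shows "zero_object (Rep F K) Z"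
  unfolding zero_object_def
proof (intro conjI ballI Z)
  interpret Z: functor_rep F K Z by (rule functor_repI[OF K Z])
  fix X :: "('f, 'v, 'k, 'w) rep" assume X: "X \<in> Ob (Rep F K)"
  interpret X: functor_rep F K X by (rule functor_repI[OF K X])
  show "\<exists>!f. f \<in> Mor (Rep F K) Z X"
  proof (rule ex1I, rule zero_Mor[OF K Z X])
    fix f assume f: "f \<in> Mor (Rep F K) Z X"
    show "f = (\<lambda>V\<in>vec F. \<lambda>x\<in>carrier (omap Z V). \<zero>\<^bsub>omap X V\<^esub>)"
    proof (rule Mor_Rep_eqI[OF f zero_Mor[OF K Z X]])
      fix V :: "('f, 'v) module" and x assume V: "V \<in> vec F" and x: "x \<in> carrier (omap Z V)"
      have "mod_hom K (omap Z V) (omap X V) (f V)"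
        using f V Z.T_module[OF V] X.T_module[OF V] by (simp add: mod_hom_def mod_hom_axioms_def Mor_Rep_iff)
      then show "f V x = (\<lambda>V\<in>vec F. \<lambda>x\<in>carrier (omap Z V). \<zero>\<^bsub>omap X V\<^esub>) V x"
        using V x zero[OF V] mod_hom.f0_is_0 by fastforce
    qed
  qed
  show "\<exists>!f. f \<in> Mor (Rep F K) X Z"
  proof (rule ex1I, rule zero_Mor[OF K X Z])
    fix f assume f: "f \<in> Mor (Rep F K) X Z"
    show "f = (\<lambda>V\<in>vec F. \<lambda>x\<in>carrier (omap X V). \<zero>\<^bsub>omap Z V\<^esub>)"
    proof (rule Mor_Rep_eqI[OF f zero_Mor[OF K X Z]])
      fix V :: "('f, 'v) module" and x assume V: "V \<in> vec F" and x: "x \<in> carrier (omap X V)"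
      have "f V x \<in> carrier (omap Z V)"
        using f V x module_hom_closed[of "f V" K "omap X V" "omap Z V"] by (auto simp: Mor_Rep_iff)
      then show "f V x = (\<lambda>V\<in>vec F. \<lambda>x\<in>carrier (omap X V). \<zero>\<^bsub>omap Z V\<^esub>) V x"
        using V x zero[OF V] by simp
    qed
  qed
qed

context functor_rep
begin

definition sub_rep :: "(('f, 'v) module \<Rightarrow> 'w set) \<Rightarrow> ('f, 'v, 'k, 'w) rep" where
  "sub_rep P = \<lparr>omap = \<lambda>V. (omap T V)\<lparr>carrier := P V\<rparr>, amap = \<lambda>V W f. restrict (amap T V W f) (P V)\<rparr>"

definition inclusion :: "(('f, 'v) module \<Rightarrow> 'w set) \<Rightarrow> ('f, 'v) module \<Rightarrow> 'w \<Rightarrow> 'w" where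
  "inclusion P = (\<lambda>V\<in>vec F. \<lambda>x\<in>P V. x)"

lemma sub_rep_simps [simp]:
  "omap (sub_rep P) V = (omap T V)\<lparr>carrier := P V\<rparr>"
  "amap (sub_rep P) V W f = restrict (amap T V W f) (P V)"
  by (simp_all add: sub_rep_def)

lemma sub_rep_functor:
  assumes P: "subfun P"
  shows "sub_rep P \<in> Ob (Rep F K)"
proof -
  have mod: "module K ((omap T V)\<lparr>carrier := P V\<rparr>)" if "V \<in> vec F" for V
    by (rule module.submodule_is_module[OF T_module[OF that] subfun_submodule[OF P that]])
  have sub: "x \<in> P V \<Longrightarrow> x \<in> Tc V" if "V \<in> vec F" for V x
    using subfun_sub[OF P that] by blast
  show ?thesis
    unfolding Ob_Rep functors_def mem_Collect_eq
  proof (intro conjI ballI)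
    fix V :: "('f, 'v) module" assume V: "V \<in> vec F"
    show "omap (sub_rep P) V \<in> Ob (module_category K)" using mod[OF V] by (simp add: module_category_def)
    show "amap (sub_rep P) V V (Idn (fin_dim_category F) V) = Idn (module_category K) (omap (sub_rep P) V)"
      using T_id[OF V] sub[OF V] by (auto simp: Idn_vec module_category_def)
  next
    fix V W :: "('f, 'v) module" and f assume V: "V \<in> vec F" and W: "W \<in> vec F" and f: "f \<in> Lin F V W"
    interpret h: mod_hom K "omap T V" "omap T W" "amap T V W f" by (rule T_mod_hom[OF V W f])
    note p = h.M.submoduleD[OF subfun_submodule[OF P V]]
    show "amap (sub_rep P) V W f \<in> Mor (module_category K) (omap (sub_rep P) V) (omap (sub_rep P) W)"
      using p subfun_closed[OF P V W f] sub[OF V]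
      by (auto simp: module_category_def sub_hom_iff)
  next
    fix U V W :: "('f, 'v) module" and f g assume "U \<in> vec F" "V \<in> vec F" "W \<in> vec F" "f \<in> Lin F U V" "g \<in> Lin F V W"
    then show "amap (sub_rep P) U W (Cmp (fin_dim_category F) U V W g f) =
        Cmp (module_category K) (omap (sub_rep P) U) (omap (sub_rep P) V) (omap (sub_rep P) W) (amap (sub_rep P) V W g) (amap (sub_rep P) U V f)"
      using T_cmp[of U V W f g] sub subfun_closed[OF P, of U V f]
      by (auto simp: Cmp_vec module_category_def compose_def)
  qed
qed

lemma inclusion_Mor:
  assumes P: "subfun P"
  shows "inclusion P \<in> Mor (Rep F K) (sub_rep P) T"
proof -
  have sub: "x \<in> Tc V" if "V \<in> vec F" "x \<in> P V" for V x
    using subfun_sub[OF P that(1)] that(2) by blast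
  have cl: "x \<oplus>\<^bsub>omap T V\<^esub> y \<in> P V" "r \<in> carrier K \<Longrightarrow> r \<odot>\<^bsub>omap T V\<^esub> x \<in> P V"
    if V: "V \<in> vec F" and xy: "x \<in> P V" "y \<in> P V" for V x y r
    using module.submoduleD(3,4)[OF T_module[OF V] subfun_submodule[OF P V]] xy by blast+
  show ?thesis
    using sub cl subfun_closed[OF P] by (simp add: Mor_Rep_iff inclusion_def sub_hom_iff)
qed

end

text \<open>
  The kernel is an object of the category, and its inclusion has the same composite with \<open>m\<close> as the
  zero morphism.
\<close>
lemma monic_injective:
  fixes X Y :: "('f, 'v, 'k, 'w) rep"
  assumes K: "field K" and X: "X \<in> Ob (Rep F K)" and Y: "Y \<in> Ob (Rep F K)"
    and m: "monic (Rep F K) X Y m" and V: "V \<in> vec F"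
  shows "inj_on (m V) (carrier (omap X V))"
proof -
  interpret X: functor_rep F K X by (rule functor_repI[OF K X])
  interpret Y: functor_rep F K Y by (rule functor_repI[OF K Y])
  have mM: "m \<in> Mor (Rep F K) X Y" using m by (simp add: monic_def)
  have mh: "mod_hom K (omap X V) (omap Y V) (m V)" if "V \<in> vec F" for V
    using mM that X.T_module[OF that] Y.T_module[OF that] by (simp add: mod_hom_def mod_hom_axioms_def Mor_Rep_iff)
  define Ker where "Ker V = {x \<in> X.Tc V. m V x = \<zero>\<^bsub>omap Y V\<^esub>}" for V
  have Ker: "X.subfun Ker"
    unfolding X.subfun_def
  proof (intro conjI ballI)
    fix V :: "('f, 'v) module" assume V: "V \<in> vec F"
    show "submodule K (Ker V) (omap X V)"
      using mod_hom.ker_is_submodule[OF mh[OF V]] mod_hom.ker_def[OF mh[OF V]] by (simp add: Ker_def)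
  next
    fix V W :: "('f, 'v) module" and f x
    assume V: "V \<in> vec F" and W: "W \<in> vec F" and f: "f \<in> Lin F V W" and x: "x \<in> Ker V"
    have "m W (amap X V W f x) = amap Y V W f (m V x)"
      using mM V W f x by (simp add: Mor_Rep_iff Ker_def)
    also have "\<dots> = \<zero>\<^bsub>omap Y W\<^esub>"
      using x mod_hom.f0_is_0[OF Y.T_mod_hom[OF V W f]] by (simp add: Ker_def)
    finally show "amap X V W f x \<in> Ker W" using X.T_closed[OF V W f] x by (simp add: Ker_def)
  qed
  let ?O = "\<lambda>V\<in>vec F. \<lambda>x\<in>Ker V. \<zero>\<^bsub>omap X V\<^esub>"
  have FK: "X.sub_rep Ker \<in> Ob (Rep F K)" by (rule X.sub_rep_functor[OF Ker])
  have O: "?O \<in> Mor (Rep F K) (X.sub_rep Ker) X"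
    using zero_Mor[OF K FK X] by simp
  have "Cmp (Rep F K) (X.sub_rep Ker) X Y m (X.inclusion Ker) = Cmp (Rep F K) (X.sub_rep Ker) X Y m ?O"
    using mod_hom.f0_is_0[OF mh] by (auto simp: Cmp_Rep X.inclusion_def compose_def Ker_def fun_eq_iff)
  then have eq: "X.inclusion Ker = ?O"
    using m FK X.inclusion_Mor[OF Ker] O unfolding monic_def by blast
  have zero: "x = \<zero>\<^bsub>omap X V\<^esub>" if "x \<in> Ker V" for x
    using fun_cong[OF fun_cong[OF eq, of V], of x] V that by (simp add: X.inclusion_def)
  interpret m: mod_hom K "omap X V" "omap Y V" "m V" by (rule mh[OF V])
  show ?thesis
  proof (rule inj_onI)
    fix x y assume x: "x \<in> X.Tc V" and y: "y \<in> X.Tc V" and e: "m V x = m V y"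
    have "x \<ominus>\<^bsub>omap X V\<^esub> y \<in> Ker V" using x y e by (simp add: Ker_def)
    then have "x \<ominus>\<^bsub>omap X V\<^esub> y = \<zero>\<^bsub>omap X V\<^esub>" by (rule zero)
    then show "x = y" using x y by simp
  qed
qed

lemma bijective_isomorphism:
  fixes X Y :: "('f, 'v, 'k, 'w) rep"
  assumes K: "field K" and X: "X \<in> Ob (Rep F K)" and Y: "Y \<in> Ob (Rep F K)"
    and m: "m \<in> Mor (Rep F K) X Y"
    and bij: "\<And>V. V \<in> vec F \<Longrightarrow> bij_betw (m V) (carrier (omap X V)) (carrier (omap Y V))"
  shows "isomorphism (Rep F K) X Y m"
proof -
  interpret X: functor_rep F K X by (rule functor_repI[OF K X])
  interpret Y: functor_rep F K Y by (rule functor_repI[OF K Y])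
  define g where "g = (\<lambda>V\<in>vec F. \<lambda>y\<in>Y.Tc V. inv_into (X.Tc V) (m V) y)"
  have g: "g V y \<in> X.Tc V" "m V (g V y) = y" if "V \<in> vec F" "y \<in> Y.Tc V" for V y
    using bij_betw_imp_surj_on[OF bij[OF that(1)]] that by (auto simp: g_def inv_into_into f_inv_into_f)
  have gm: "g V (m V x) = x" if "V \<in> vec F" "x \<in> X.Tc V" for V x
    using bij_betwE[OF bij[OF that(1)]] bij_betw_inv_into_left[OF bij[OF that(1)] that(2)] that by (simp add: g_def)
  have mh: "m V \<in> module_hom K (omap X V) (omap Y V)" if "V \<in> vec F" for V
    using m that by (simp add: Mor_Rep_iff)
  have gI: "g V y = x" if "V \<in> vec F" "x \<in> X.Tc V" "m V x = y" for V x y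
    using gm[OF that(1,2)] that(3) by simp
  have gM: "g \<in> Mor (Rep F K) Y X"
    unfolding Mor_Rep_iff
  proof (intro conjI ballI)
    show "g \<in> extensional (vec F)" by (simp add: g_def)
  next
    fix V :: "('f, 'v) module" assume V: "V \<in> vec F"
    interpret XV: module K "omap X V" by (rule X.T_module[OF V])
    show "g V \<in> extensional (Y.Tc V)" using V by (simp add: g_def)
    show "g V \<in> module_hom K (omap Y V) (omap X V)"
      unfolding module_hom_def mem_Collect_eq
    proof (intro conjI allI impI funcsetI)
      show "g V y \<in> X.Tc V" if "y \<in> Y.Tc V" for y by (rule g(1)[OF V that])
      fix y z assume "y \<in> Y.Tc V \<and> z \<in> Y.Tc V"
      then show "g V (y \<oplus>\<^bsub>omap Y V\<^esub> z) = g V y \<oplus>\<^bsub>omap X V\<^esub> g V z"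
        using g[OF V] module_hom_add[OF mh[OF V]] by (intro gI[OF V]) auto
    next
      fix r y assume "r \<in> carrier K \<and> y \<in> Y.Tc V"
      then show "g V (r \<odot>\<^bsub>omap Y V\<^esub> y) = r \<odot>\<^bsub>omap X V\<^esub> g V y"
        using g[OF V] module_hom_smult[OF mh[OF V]] by (intro gI[OF V]) auto
    qed
  next
    fix V W :: "('f, 'v) module" and f y
    assume V: "V \<in> vec F" and W: "W \<in> vec F" and f: "f \<in> Lin F V W" and y: "y \<in> Y.Tc V"
    have "m W (amap X V W f (g V y)) = amap Y V W f y"
      using m g[OF V y] V W f unfolding Mor_Rep_iff by auto
    then show "g W (amap Y V W f y) = amap X V W f (g V y)"
      using X.T_closed[OF V W f g(1)[OF V y]] by (intro gI[OF W]) auto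
  qed
  moreover have "Cmp (Rep F K) X Y X g m = Idn (Rep F K) X"
    using gm by (auto simp: Cmp_Rep Idn_Rep compose_def fun_eq_iff)
  moreover have "Cmp (Rep F K) Y X Y m g = Idn (Rep F K) Y"
    using g by (auto simp: Cmp_Rep Idn_Rep compose_def fun_eq_iff)
  ultimately show ?thesis using m unfolding isomorphism_def by blast
qed

context functor_rep
begin

text \<open>
  A monic into the subfunctor is injective, and its image is again a subfunctor: by simplicity it is
  \<open>0\<close>, and the source is zero, or everything, and the monic is bijective.
\<close>
theorem simple_object_sub_rep:
  assumes P: "simple_sub P"
  shows "simple_object (Rep F K) (sub_rep P)"
  unfolding simple_object_def
proof (intro conjI ballI allI impI)
  have Ps: "subfun P" using P by (simp add: simple_sub_def)
  show FP: "sub_rep P \<in> Ob (Rep F K)" by (rule sub_rep_functor[OF Ps])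
  show "\<not> zero_object (Rep F K) (sub_rep P)"
  proof
    assume "zero_object (Rep F K) (sub_rep P)"
    then have uniq: "f = g" if "f \<in> Mor (Rep F K) (sub_rep P) (sub_rep P)" "g \<in> Mor (Rep F K) (sub_rep P) (sub_rep P)" for f g
      using that FP unfolding zero_object_def by blast
    have "Idn (Rep F K) (sub_rep P) \<in> Mor (Rep F K) (sub_rep P) (sub_rep P)"
      using category.idn_closed[OF Rep_category FP] .
    then have eq: "Idn (Rep F K) (sub_rep P) = (\<lambda>V\<in>vec F. \<lambda>x\<in>carrier (omap (sub_rep P) V). \<zero>\<^bsub>omap (sub_rep P) V\<^esub>)"
      using zero_Mor[OF field_K FP FP] by (rule uniq)
    have "x = \<zero>\<^bsub>omap T V\<^esub>" if V: "V \<in> vec F" and x: "x \<in> P V" for V x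
      using fun_cong[OF fun_cong[OF eq, of V], of x] V x by (simp add: Idn_Rep)
    then have "P V = {\<zero>\<^bsub>omap T V\<^esub>}" if "V \<in> vec F" for V
      using subfun_zero[OF Ps that] that by blast
    then show False using P by (auto simp: simple_sub_def)
  qed
  fix X :: "('f, 'v, 'k, 'w) rep" and m
  assume X: "X \<in> Ob (Rep F K)" and m: "monic (Rep F K) X (sub_rep P) m"
  interpret X: functor_rep F K X by (rule functor_repI[OF field_K X])
  have mM: "m \<in> Mor (Rep F K) X (sub_rep P)" using m by (simp add: monic_def)
  have inj: "inj_on (m V) (X.Tc V)" if "V \<in> vec F" for V by (rule monic_injective[OF field_K X FP m that])
  define Im where "Im V = m V ` X.Tc V" for V
  have mh: "mod_hom K (omap X V) (omap T V) (m V)" and ImP: "Im V \<subseteq> P V" if V: "V \<in> vec F" for V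
  proof -
    have h: "m V \<in> module_hom K (omap X V) (omap (sub_rep P) V)" using mM V by (simp add: Mor_Rep_iff)
    then show "Im V \<subseteq> P V" using module_hom_closed[OF h] by (auto simp: Im_def)
    have "m V \<in> module_hom K (omap X V) (omap T V)"
      using h subfun_sub[OF Ps V] by (auto simp: module_hom_def Pi_iff)
    then show "mod_hom K (omap X V) (omap T V) (m V)"
      using X.T_module[OF V] T_module[OF V] by (simp add: mod_hom_def mod_hom_axioms_def)
  qed
  have "subfun Im"
    unfolding subfun_def
  proof (intro conjI ballI)
    fix V :: "('f, 'v) module" assume V: "V \<in> vec F"
    show "submodule K (Im V) (omap T V)"
      using mod_hom.im_is_submodule[OF mh[OF V]] mod_hom.im_def[OF mh[OF V]] by (simp add: Im_def)
  next
    fix V W :: "('f, 'v) module" and f y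
    assume V: "V \<in> vec F" and W: "W \<in> vec F" and f: "f \<in> Lin F V W" and "y \<in> Im V"
    then obtain x where x: "x \<in> X.Tc V" "y = m V x" by (auto simp: Im_def)
    have "y \<in> P V" using ImP[OF V] x by (auto simp: Im_def)
    then have "m W (amap X V W f x) = amap T V W f y"
      using mM V W f x by (simp add: Mor_Rep_iff)
    then show "amap T V W f y \<in> Im W"
      unfolding Im_def using X.T_closed[OF V W f x(1)] by (metis imageI)
  qed
  then have "(\<forall>V\<in>vec F. Im V = {\<zero>\<^bsub>omap T V\<^esub>}) \<or> (\<forall>V\<in>vec F. Im V = P V)"
    using P ImP unfolding simple_sub_def by blast
  then show "zero_object (Rep F K) X \<or> isomorphism (Rep F K) X (sub_rep P) m"
  proof
    assume zero: "\<forall>V\<in>vec F. Im V = {\<zero>\<^bsub>omap T V\<^esub>}"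
    have "X.Tc V = {\<zero>\<^bsub>omap X V\<^esub>}" if V: "V \<in> vec F" for V
    proof -
      interpret mV: mod_hom K "omap X V" "omap T V" "m V" by (rule mh[OF V])
      have "x = \<zero>\<^bsub>omap X V\<^esub>" if x: "x \<in> X.Tc V" for x
      proof -
        have "m V x \<in> Im V" using x by (simp add: Im_def)
        then have "m V x = m V \<zero>\<^bsub>omap X V\<^esub>" using zero V by simp
        then show ?thesis using inj_onD[OF inj[OF V]] x mV.M.zero_closed by blast
      qed
      then show ?thesis using mV.M.zero_closed by blast
    qed
    then show ?thesis using zero_functor[OF field_K X] by blast
  next
    assume "\<forall>V\<in>vec F. Im V = P V"
    then have "bij_betw (m V) (X.Tc V) (carrier (omap (sub_rep P) V))" if "V \<in> vec F" for V
      using inj[OF that] that by (simp add: bij_betw_def Im_def)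
    then show ?thesis using bijective_isomorphism[OF field_K X FP mM] by blast
  qed
qed

end

context semisimple_setting
begin

text \<open>
  The morphism out of \<open>T\<close> is obtained space by space from freeness.  It is natural because the two
  composites in the naturality square agree on the summands.
\<close>
theorem free_coproduct:
  assumes sf: "\<And>P. P \<in> \<I> \<Longrightarrow> subfun P" and free: "free \<I>"
    and tot: "\<And>V. V \<in> vec F \<Longrightarrow> total \<I> V = Tc V"
  shows "is_coproduct (Rep F K) ((\<lambda>P. (sub_rep P, inclusion P)) ` \<I>) fst T snd"
proof -
  have TO: "T \<in> Ob (Rep F K)" using T by (simp add: Ob_Rep)
  have md: "(omap T V)\<lparr>carrier := Tc V\<rparr> = omap T V" for V by simp
  have legs: "h V x = \<phi> (sub_rep P, inclusion P) V x"
    if "Cmp (Rep F K) (sub_rep P) T Y h (inclusion P) = \<phi> (sub_rep P, inclusion P)" "V \<in> vec F" "x \<in> P V" for h \<phi> Y V x P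
    using fun_cong[OF fun_cong[OF that(1), of V], of x] that(2,3) by (simp add: Cmp_Rep compose_def inclusion_def)
  have ex1: "\<exists>!h. h \<in> Mor (Rep F K) T Y \<and> (\<forall>P\<in>\<I>. Cmp (Rep F K) (sub_rep P) T Y h (inclusion P) = \<phi> (sub_rep P, inclusion P))"
    if Y: "Y \<in> Ob (Rep F K)" and \<phi>: "\<And>P. P \<in> \<I> \<Longrightarrow> \<phi> (sub_rep P, inclusion P) \<in> Mor (Rep F K) (sub_rep P) Y"
    for Y :: "('f, 'v, 'k, 'w) rep" and \<phi>
  proof -
    interpret Y: functor_rep F K Y by (rule functor_repI[OF field_K Y])
    have uniq: "h x = h' x"
      if V: "V \<in> vec F" and W: "W \<in> vec F"
        and h: "h \<in> module_hom K (omap T V) (omap Y W)" "h' \<in> module_hom K (omap T V) (omap Y W)"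
        and eq: "\<And>P x. P \<in> \<I> \<Longrightarrow> x \<in> P V \<Longrightarrow> h x = h' x" and x: "x \<in> Tc V" for V W h h' x
      by (rule total_hom_unique[OF V Y.T_module[OF W], of \<I>, OF sf, unfolded tot[OF V] md, OF _ h eq x])
    have "\<exists>h. h \<in> module_hom K (omap T V) (omap Y V) \<and> (\<forall>P\<in>\<I>. \<forall>x\<in>P V. h x = \<phi> (sub_rep P, inclusion P) V x)"
      if V: "V \<in> vec F" for V
    proof -
      have "\<exists>h\<in>module_hom K ((omap T V)\<lparr>carrier := total \<I> V\<rparr>) (omap Y V).
          \<forall>P\<in>\<I>. \<forall>x\<in>P V. h x = \<phi> (sub_rep P, inclusion P) V x"
        by (rule freeD[OF free V Y.T_module[OF V]]) (use \<phi> V in \<open>simp add: Mor_Rep_iff\<close>)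
      then show ?thesis unfolding tot[OF V] md by blast
    qed
    then obtain H where H: "\<And>V. V \<in> vec F \<Longrightarrow> H V \<in> module_hom K (omap T V) (omap Y V)"
      and H\<phi>: "\<And>V P x. V \<in> vec F \<Longrightarrow> P \<in> \<I> \<Longrightarrow> x \<in> P V \<Longrightarrow> H V x = \<phi> (sub_rep P, inclusion P) V x"
      by metis
    define h where "h = (\<lambda>V\<in>vec F. restrict (H V) (Tc V))"
    have hx: "h V x = H V x" if "V \<in> vec F" "x \<in> Tc V" for V x using that by (simp add: h_def)
    have hP: "h V x = \<phi> (sub_rep P, inclusion P) V x" if "V \<in> vec F" "P \<in> \<I>" "x \<in> P V" for V P x
      using hx[OF that(1), of x] H\<phi>[OF that] subfun_sub[OF sf[OF that(2)] that(1)] that(3) by auto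
    have hh: "h V \<in> module_hom K (omap T V) (omap Y V)" if V: "V \<in> vec F" for V
    proof -
      interpret TV: module K "omap T V" by (rule T_module[OF V])
      show ?thesis using H[OF V] V by (auto simp: module_hom_def h_def Pi_iff)
    qed
    have hM: "h \<in> Mor (Rep F K) T Y"
      unfolding Mor_Rep_iff
    proof (intro conjI ballI hh)
      show "h \<in> extensional (vec F)" by (simp add: h_def)
      show "h V \<in> extensional (Tc V)" if "V \<in> vec F" for V using that by (simp add: h_def)
      fix V W :: "('f, 'v) module" and f x
      assume V: "V \<in> vec F" and W: "W \<in> vec F" and f: "f \<in> Lin F V W" and x: "x \<in> Tc V"
      interpret Tf: mod_hom K "omap T V" "omap T W" "amap T V W f" by (rule T_mod_hom[OF V W f])
      interpret Yf: mod_hom K "omap Y V" "omap Y W" "amap Y V W f" by (rule Y.T_mod_hom[OF V W f])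
      have c1: "(\<lambda>x. h W (amap T V W f x)) \<in> module_hom K (omap T V) (omap Y W)"
        using hh[OF W] by (auto simp: module_hom_def Pi_iff)
      have c2: "(\<lambda>x. amap Y V W f (h V x)) \<in> module_hom K (omap T V) (omap Y W)"
        using hh[OF V] by (auto simp: module_hom_def Pi_iff)
      have "h W (amap T V W f y) = amap Y V W f (h V y)" if P: "P \<in> \<I>" and y: "y \<in> P V" for P y
      proof -
        have "\<phi> (sub_rep P, inclusion P) W (amap T V W f y) = amap Y V W f (\<phi> (sub_rep P, inclusion P) V y)"
          using \<phi>[OF P] V W f y by (simp add: Mor_Rep_iff)
        then show ?thesis using hP[OF V P y] hP[OF W P subfun_closed[OF sf[OF P] V W f y]] by simp
      qed
      then show "h W (amap T V W f x) = amap Y V W f (h V x)" by (rule uniq[OF V W c1 c2 _ x])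
    qed
    show ?thesis
    proof (rule ex1I[of _ h], intro conjI ballI hM)
      fix P assume P: "P \<in> \<I>"
      show "Cmp (Rep F K) (sub_rep P) T Y h (inclusion P) = \<phi> (sub_rep P, inclusion P)"
      proof (rule Mor_Rep_eqI)
        show "Cmp (Rep F K) (sub_rep P) T Y h (inclusion P) \<in> Mor (Rep F K) (sub_rep P) Y"
          by (rule category.cmp_closed[OF Rep_category sub_rep_functor[OF sf[OF P]] TO Y inclusion_Mor[OF sf[OF P]] hM])
        show "\<phi> (sub_rep P, inclusion P) \<in> Mor (Rep F K) (sub_rep P) Y" by (rule \<phi>[OF P])
        fix V :: "('f, 'v) module" and x assume V: "V \<in> vec F" and "x \<in> carrier (omap (sub_rep P) V)"
        then have x: "x \<in> P V" by simp
        then show "Cmp (Rep F K) (sub_rep P) T Y h (inclusion P) V x = \<phi> (sub_rep P, inclusion P) V x"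
          using hP[OF V P x] V by (simp add: Cmp_Rep compose_def inclusion_def)
      qed
    next
      fix k assume k: "k \<in> Mor (Rep F K) T Y \<and> (\<forall>P\<in>\<I>. Cmp (Rep F K) (sub_rep P) T Y k (inclusion P) = \<phi> (sub_rep P, inclusion P))"
      show "k = h"
      proof (rule Mor_Rep_eqI)
        show "k \<in> Mor (Rep F K) T Y" "h \<in> Mor (Rep F K) T Y" using k hM by auto
        fix V :: "('f, 'v) module" and x assume V: "V \<in> vec F" and x: "x \<in> Tc V"
        have kV: "k V \<in> module_hom K (omap T V) (omap Y V)" using k V by (simp add: Mor_Rep_iff)
        show "k V x = h V x"
        proof (rule uniq[OF V V kV hh[OF V] _ x])
          fix P y assume P: "P \<in> \<I>" and y: "y \<in> P V"
          show "k V y = h V y" using legs[where P = P and Y = Y and h = k and \<phi> = \<phi> and V = V and x = y] k P V y hP[OF V P y] by simp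
        qed
      qed
    qed
  qed
  show ?thesis
    unfolding is_coproduct_def
  proof (intro conjI ballI allI impI TO)
    fix i assume "i \<in> (\<lambda>P. (sub_rep P, inclusion P)) ` \<I>"
    then show "fst i \<in> Ob (Rep F K)" "snd i \<in> Mor (Rep F K) (fst i) T"
      using sub_rep_functor[OF sf] inclusion_Mor[OF sf] by auto
  next
    fix Y :: "('f, 'v, 'k, 'w) rep" and \<phi>
    assume Y: "Y \<in> Ob (Rep F K)" and "\<forall>i\<in>(\<lambda>P. (sub_rep P, inclusion P)) ` \<I>. \<phi> i \<in> Mor (Rep F K) (fst i) Y"
    then show "\<exists>!h. h \<in> Mor (Rep F K) T Y \<and>
        (\<forall>i\<in>(\<lambda>P. (sub_rep P, inclusion P)) ` \<I>. Cmp (Rep F K) (fst i) T Y h (snd i) = \<phi> i)"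
      using ex1[OF Y, of \<phi>] by simp
  qed
qed

end

theorem corollary1p3:
  fixes F :: "('f, 'm) ring_scheme" and K :: "('k, 'n) ring_scheme"
  assumes "infinite (UNIV :: 'v set)"
    and "field F" and "finite (carrier F)"
    and "field K" and "\<forall>n::nat. n > 0 \<longrightarrow> [n] \<cdot>\<^bsub>K\<^esub> \<one>\<^bsub>K\<^esub> \<noteq> \<zero>\<^bsub>K\<^esub>"
  shows "semisimple_category (Rep F K :: ('f, 'v, 'k, 'w) rep_category)"
  unfolding semisimple_category_def
proof
  fix T :: "('f, 'v, 'k, 'w) rep" assume T: "T \<in> Ob (Rep F K)"
  interpret T: semisimple_setting F K T
    by (intro semisimple_setting.intro semisimple_setting_axioms.intro functor_repI T) (use assms in auto)
  obtain \<I> where simple: "\<And>P. P \<in> \<I> \<Longrightarrow> T.simple_sub P" and free: "T.free \<I>"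
    and total: "\<And>V. V \<in> vec F \<Longrightarrow> T.total \<I> V = T.Tc V"
    using T.free_simple_decomposition by blast
  have "is_coproduct (Rep F K) ((\<lambda>P. (T.sub_rep P, T.inclusion P)) ` \<I>) fst T snd"
    by (rule T.free_coproduct[OF _ free total]) (use simple in \<open>auto simp: T.simple_sub_def\<close>)
  moreover have "\<forall>(S, \<iota>)\<in>(\<lambda>P. (T.sub_rep P, T.inclusion P)) ` \<I>. simple_object (Rep F K) S"
    using T.simple_object_sub_rep[OF simple] by auto
  ultimately show "\<exists>I. (\<forall>(S, \<iota>)\<in>I. simple_object (Rep F K) S) \<and> is_coproduct (Rep F K) I fst T snd"
    by (intro exI conjI)
qed

end
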